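(* Let $X\in\mathfrak{sp}(p,q)$ be a non-zero nilpotent element, and let $\{X,H,Y\}$ be an $\mathfrak{sl}_2(\mathbb R)$-triple in $\mathfrak{sp}(p,q)$. Let the nilpotent orbit $\mathcal O_X$ correspond to a signed Young diagram of signature $(p,q)$ with underlying partition $\mathbf d$ of $p+q$ (with even parts $\mathbb E_{\mathbf d}$, odd parts $\mathbb O_{\mathbf d}$, and multiplicities $t_d$), where for $\theta\in\mathbb O_{\mathbf d}$, $p_\theta$ (respectively $q_\theta$) denotes the number of $+1$ (respectively $-1$) in the first column of the block of size $t_\theta\times\theta$. Then $$\mathcal Z_{\mathrm{Sp}(p,q)}(X,H,Y)\simeq\prod_{\eta\in\mathbb E_{\mathbf d}}\mathrm{SO}^*(2t_\eta)\times\prod_{\theta\in\mathbb O_{\mathbf d}}\mathrm{Sp}(p_\theta,q_\theta).$$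
   Context: $\mathbb H$ is the real quaternions with units $\mathbf i,\mathbf j,\mathbf k$. $\mathrm{Sp}(p,q)=\{g\in\mathrm{SL}_{p+q}(\mathbb H):\bar g^t\mathrm I_{p,q}g=\mathrm I_{p,q}\}$, $\mathrm I_{p,q}=\mathrm{diag}(\mathrm I_p,-\mathrm I_q)$, is the isometry group of $\langle x,y\rangle=\bar x^t\mathrm I_{p,q}y$ on the right $\mathbb H$-space $V=\mathbb H^{p+q}$; $\mathfrak{sp}(p,q)$ is its Lie algebra. $\mathrm{SO}^*(2m)$ is the group of $\mathbb H$-linear automorphisms of $\mathbb H^m$ (of reduced norm $1$) preserving a non-degenerate skew-Hermitian form, e.g. $\bar x^t\mathbf jy$. An $\mathfrak{sl}_2(\mathbb R)$-triple satisfies $X\ne0$, $[H,X]=2X$, $[H,Y]=-2Y$, $[X,Y]=H$. $\mathcal Z_G(X,H,Y)$ is the subgroup of $G$ fixing $X,H,Y$ under the adjoint action; $\mathcal O_X$ is the adjoint $\mathrm{Sp}(p,q)$-orbit. Signed Young diagram of $\mathcal O_X$: let $M(d-1)$ be the sum of all irreducible $\mathrm{Span}_{\mathbb R}\{X,H,Y\}$-submodules of $V$ of real dimension $d$, $L(d-1)=M(d-1)\cap\ker Y$ (an $\mathbb H$-subspace), $t_d=\dim_{\mathbb H}L(d-1)$; the parts of $\mathbf d$ are the $d$ with $t_d>0$, with multiplicity $t_d$. The form $(v,u)_d=\langle v,X^{d-1}u\rangle$ on $L(d-1)$ is Hermitian for $d$ odd and skew-Hermitian for $d$ even. For each odd part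 $\theta$, the first column of the $t_\theta\times\theta$ block of the diagram contains $p_\theta$ entries $+1$ and $q_\theta$ entries $-1$, where $(p_\theta,q_\theta)$ is the signature of $(\cdot,\cdot)_\theta$ on $L(\theta-1)$; for each even part all first-column entries are $+1$. *)

theory Defs
  imports
    "Jordan_Normal_Form.Determinant"
    "HOL-Analysis.Function_Topology"
    "HOL-Analysis.Product_Topology"
    "HOL-Algebra.Product_Groups"
    "HOL-Library.Multiset"
begin

section \<open>The real quaternions\<close>

text \<open>\<open>Quat a b c d\<close> stands for \<open>a + b i + c j + d k\<close>.\<close>

datatype quat = Quat (Rq: real) (Iq: real) (Jq: real) (Kq: real)

lemma quat_eqI:
  "Rq x = Rq y \<Longrightarrow> Iq x = Iq y \<Longrightarrow> Jq x = Jq y \<Longrightarrow> Kq x = Kq y \<Longrightarrow> x = y"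
  by (cases x; cases y) simp

lemma quat_eq_iff:
  "x = y \<longleftrightarrow> Rq x = Rq y \<and> Iq x = Iq y \<and> Jq x = Jq y \<and> Kq x = Kq y"
  by (auto intro: quat_eqI)

definition qcnj :: "quat \<Rightarrow> quat" where
  "qcnj x = Quat (Rq x) (- Iq x) (- Jq x) (- Kq x)"

definition quat_j :: quat where
  "quat_j = Quat 0 0 1 0"

instantiation quat :: real_normed_div_algebra
begin

definition zero_quat where "0 = Quat 0 0 0 0"
definition one_quat where "1 = Quat 1 0 0 0"
definition plus_quat where
  "x + y = Quat (Rq x + Rq y) (Iq x + Iq y) (Jq x + Jq y) (Kq x + Kq y)"
definition minus_quat where
  "x - y = Quat (Rq x - Rq y) (Iq x - Iq y) (Jq x - Jq y) (Kq x - Kq y)"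
definition uminus_quat where
  "- x = Quat (- Rq x) (- Iq x) (- Jq x) (- Kq x)"
definition times_quat where
  "x * y = Quat
     (Rq x * Rq y - Iq x * Iq y - Jq x * Jq y - Kq x * Kq y)
     (Rq x * Iq y + Iq x * Rq y + Jq x * Kq y - Kq x * Jq y)
     (Rq x * Jq y - Iq x * Kq y + Jq x * Rq y + Kq x * Iq y)
     (Rq x * Kq y + Iq x * Jq y - Jq x * Iq y + Kq x * Rq y)"
definition scaleR_quat where
  "r *\<^sub>R x = Quat (r * Rq x) (r * Iq x) (r * Jq x) (r * Kq x)"
definition norm_quat where
  "norm x = sqrt ((Rq x)\<^sup>2 + (Iq x)\<^sup>2 + (Jq x)\<^sup>2 + (Kq x)\<^sup>2)"
definition inverse_quat where
  "inverse x = (1 / (norm x)\<^sup>2) *\<^sub>R qcnj x"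
definition divide_quat where
  "x div y = x * inverse (y :: quat)"
definition sgn_quat where
  "sgn x = inverse (norm x) *\<^sub>R (x :: quat)"
definition dist_quat where
  "dist x y = norm (x - y :: quat)"
definition uniformity_quat where
  "uniformity = (INF e\<in>{0 <..}. principal {(x :: quat, y). dist x y < e})"
definition open_quat where
  "open U \<longleftrightarrow> (\<forall>x\<in>U. eventually (\<lambda>(x' :: quat, y). x' = x \<longrightarrow> y \<in> U) uniformity)"

lemmas quat_ops = zero_quat_def one_quat_def plus_quat_def minus_quat_def uminus_quat_def
  times_quat_def scaleR_quat_def

instance
proof
  fix x y z :: quat and a b :: real
  show "x + y + z = x + (y + z)" "x + y = y + x" "0 + x = x" "- x + x = 0" "x - y = x + - y"
    by (simp_all add: quat_ops)
  show "x * y * z = x * (y * z)" "(x + y) * z = x * z + y * z" "x * (y + z) = x * y + x * z"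
    by (simp_all add: quat_ops algebra_simps)
  show "1 * x = x" "x * 1 = x" "(0::quat) \<noteq> 1"
    by (simp_all add: quat_ops)
  show "a *\<^sub>R (x + y) = a *\<^sub>R x + a *\<^sub>R y" "(a + b) *\<^sub>R x = a *\<^sub>R x + b *\<^sub>R x"
    "a *\<^sub>R b *\<^sub>R x = (a * b) *\<^sub>R x" "1 *\<^sub>R x = x"
    "a *\<^sub>R x * y = a *\<^sub>R (x * y)" "x * a *\<^sub>R y = a *\<^sub>R (x * y)"
    by (simp_all add: quat_ops algebra_simps)
  have nz: "norm x = 0 \<longleftrightarrow> x = 0" for x :: quat
    by (auto simp: norm_quat_def quat_ops quat_eq_iff add_nonneg_eq_0_iff)
  then show "norm x = 0 \<longleftrightarrow> x = 0" .
  have n2: "(norm x)\<^sup>2 = (Rq x)\<^sup>2 + (Iq x)\<^sup>2 + (Jq x)\<^sup>2 + (Kq x)\<^sup>2" for x :: quat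
    by (simp add: norm_quat_def)
  show inv_left: "inverse x * x = 1" "x * inverse x = 1" if "x \<noteq> 0"
  proof -
    have *: "(norm x)\<^sup>2 \<noteq> 0" using that nz by simp
    have c: "qcnj x * x = ((norm x)\<^sup>2) *\<^sub>R 1" "x * qcnj x = ((norm x)\<^sup>2) *\<^sub>R 1"
      unfolding n2 by (simp_all add: qcnj_def quat_ops power2_eq_square algebra_simps)
    have "inverse x * x = (1 / (norm x)\<^sup>2) *\<^sub>R (qcnj x * x)"
      "x * inverse x = (1 / (norm x)\<^sup>2) *\<^sub>R (x * qcnj x)"
      by (simp_all add: inverse_quat_def quat_ops algebra_simps)
    then show "inverse x * x = 1" "x * inverse x = 1"
      unfolding c using * by (simp_all add: quat_ops)
  qed
  show "inverse (0::quat) = 0"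
    by (simp add: inverse_quat_def qcnj_def quat_ops)
  show "x div y = x * inverse y"
    by (rule divide_quat_def)
  show "sgn x = inverse (norm x) *\<^sub>R x"
    by (rule sgn_quat_def)
  show "dist x y = norm (x - y)"
    by (rule dist_quat_def)
  show "(uniformity :: (quat \<times> quat) filter) = (INF e\<in>{0 <..}. principal {(x, y). dist x y < e})"
    by (rule uniformity_quat_def)
  show "open U \<longleftrightarrow> (\<forall>x\<in>U. \<forall>\<^sub>F (x', y) in uniformity. x' = x \<longrightarrow> y \<in> U)" for U :: "quat set"
    by (rule open_quat_def)
  show "norm (a *\<^sub>R x) = \<bar>a\<bar> * norm x"
  proof -
    have "norm (a *\<^sub>R x) = sqrt (a\<^sup>2 * ((Rq x)\<^sup>2 + (Iq x)\<^sup>2 + (Jq x)\<^sup>2 + (Kq x)\<^sup>2))"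
      by (simp add: norm_quat_def quat_ops power_mult_distrib algebra_simps)
    then show ?thesis
      by (simp add: norm_quat_def real_sqrt_mult)
  qed
  show "norm (x * y) = norm x * norm y"
    unfolding norm_quat_def real_sqrt_mult[symmetric]
    by (rule arg_cong[where f = sqrt]) (simp add: quat_ops power2_eq_square algebra_simps)
  show "norm (x + y) \<le> norm x + norm y"
  proof -
    have split: "norm x = sqrt ((sqrt ((Rq x)\<^sup>2 + (Iq x)\<^sup>2))\<^sup>2 + (sqrt ((Jq x)\<^sup>2 + (Kq x)\<^sup>2))\<^sup>2)"
      for x :: quat
      by (simp add: norm_quat_def algebra_simps)
    have "norm (x + y) \<le>
      sqrt ((sqrt ((Rq x)\<^sup>2 + (Iq x)\<^sup>2) + sqrt ((Rq y)\<^sup>2 + (Iq y)\<^sup>2))\<^sup>2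
          + (sqrt ((Jq x)\<^sup>2 + (Kq x)\<^sup>2) + sqrt ((Jq y)\<^sup>2 + (Kq y)\<^sup>2))\<^sup>2)"
      unfolding split[of "x + y"]
      by (intro real_sqrt_le_mono add_mono power_mono)
        (simp_all add: plus_quat_def real_sqrt_sum_squares_triangle_ineq)
    also have "\<dots> \<le> norm x + norm y"
      unfolding split[of x] split[of y] by (rule real_sqrt_sum_squares_triangle_ineq)
    finally show ?thesis .
  qed
qed

end


section \<open>Quaternionic linear algebra\<close>

text \<open>\<open>V = \<bbbH>\<^sup>n\<close> is \<open>carrier_vec n\<close>, regarded as a \<^emph>\<open>right\<close> vector space, so that left multiplication
  by matrices is linear. Consequently linear combinations have their coefficients on the right, and
  the combination of vectors \<open>vs\<close> with coefficient vector \<open>c\<close> is \<open>mat_of_cols n vs *\<^sub>v c\<close>.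
  (The library's \<open>a \<cdot>\<^sub>v v\<close> multiplies from the left.)

  Real and quaternionic notions are treated uniformly through the subfield \<open>F\<close> of admissible
  scalars, which is \<open>\<real>\<close> or \<open>UNIV\<close>.\<close>

definition right_smult_vec :: "quat vec \<Rightarrow> quat \<Rightarrow> quat vec" where
  "right_smult_vec v a = map_vec (\<lambda>x. x * a) v"

definition right_subspace :: "quat set \<Rightarrow> nat \<Rightarrow> quat vec set \<Rightarrow> bool" where
  "right_subspace F n W \<longleftrightarrow> W \<subseteq> carrier_vec n \<and> 0\<^sub>v n \<in> W \<and>
     (\<forall>v\<in>W. \<forall>w\<in>W. v + w \<in> W) \<and> (\<forall>v\<in>W. \<forall>a\<in>F. right_smult_vec v a \<in> W)"

definition right_basis :: "quat set \<Rightarrow> nat \<Rightarrow> quat vec list \<Rightarrow> quat vec set \<Rightarrow> bool" where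
  "right_basis F n vs W \<longleftrightarrow> set vs \<subseteq> carrier_vec n \<and>
     bij_betw (\<lambda>c. mat_of_cols n vs *\<^sub>v c)
       {c \<in> carrier_vec (length vs). \<forall>i<length vs. c $ i \<in> F} W"

definition right_dim :: "quat set \<Rightarrow> nat \<Rightarrow> quat vec set \<Rightarrow> nat" where
  "right_dim F n W = (THE m. \<exists>vs. right_basis F n vs W \<and> length vs = m)"

definition mat_star :: "quat mat \<Rightarrow> quat mat" where
  "mat_star A = map_mat qcnj (transpose_mat A)"

text \<open>Writing \<open>A = Z + W j\<close> with complex matrices \<open>Z\<close>, \<open>W\<close>, the following is the standard embedding
  of \<open>M\<^sub>n(\<bbbH>)\<close> into \<open>M\<^sub>2\<^sub>n(\<complex>)\<close>; the reduced norm is the determinant there.\<close>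

definition complexify :: "quat mat \<Rightarrow> complex mat" where
  "complexify A =
    (let Z = map_mat (\<lambda>x. Complex (Rq x) (Iq x)) A;
         W = map_mat (\<lambda>x. Complex (Jq x) (Kq x)) A
     in four_block_mat Z W (map_mat (\<lambda>w. - cnj w) W) (map_mat cnj Z))"

definition reduced_norm :: "quat mat \<Rightarrow> complex" where
  "reduced_norm A = det (complexify A)"

definition SL_H :: "nat \<Rightarrow> quat mat set" where
  "SL_H n = {g \<in> carrier_mat n n. reduced_norm g = 1}"


section \<open>The classical groups\<close>

definition mat_group :: "nat \<Rightarrow> quat mat set \<Rightarrow> quat mat monoid" where
  "mat_group n S = \<lparr>carrier = S, monoid.mult = (*), one = 1\<^sub>m n\<rparr>"

definition I_pq :: "nat \<Rightarrow> nat \<Rightarrow> quat mat" where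
  "I_pq p q = mat (p + q) (p + q) (\<lambda>(i, j). if i = j then (if i < p then 1 else - 1) else 0)"

definition Sp :: "nat \<Rightarrow> nat \<Rightarrow> quat mat monoid" where
  "Sp p q = mat_group (p + q) {g \<in> SL_H (p + q). mat_star g * I_pq p q * g = I_pq p q}"

text \<open>\<open>SO_star m\<close> is \<open>SO\<^sup>*(2m)\<close>, realised on \<open>\<bbbH>\<^sup>m\<close> with the skew-Hermitian form
  \<open>x\<^sup>* j y\<close>.\<close>

definition SO_star :: "nat \<Rightarrow> quat mat monoid" where
  "SO_star m = mat_group m
     {g \<in> SL_H m. mat_star g * (quat_j \<cdot>\<^sub>m 1\<^sub>m m) * g = quat_j \<cdot>\<^sub>m 1\<^sub>m m}"

text \<open>The Lie algebra of a group of \<open>n \<times> n\<close> matrices, as its tangent space at the identity: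
  the velocities at \<open>0\<close> of curves in the group through the identity. Derivatives are entrywise.\<close>

definition lie_algebra :: "nat \<Rightarrow> quat mat monoid \<Rightarrow> quat mat set" where
  "lie_algebra n G = {A \<in> carrier_mat n n.
     \<exists>\<gamma> :: real \<Rightarrow> quat mat. (\<forall>t. \<gamma> t \<in> carrier G) \<and> \<gamma> 0 = 1\<^sub>m n \<and>
       (\<forall>i<n. \<forall>j<n. ((\<lambda>t. \<gamma> t $$ (i, j)) has_vector_derivative A $$ (i, j)) (at 0))}"

abbreviation sp :: "nat \<Rightarrow> nat \<Rightarrow> quat mat set" where
  "sp p q \<equiv> lie_algebra (p + q) (Sp p q)"

definition nilpotent_mat :: "nat \<Rightarrow> quat mat \<Rightarrow> bool" where
  "nilpotent_mat n A \<longleftrightarrow> (\<exists>k. A ^\<^sub>m k = 0\<^sub>m n n)"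

definition lie_bracket :: "quat mat \<Rightarrow> quat mat \<Rightarrow> quat mat" where
  "lie_bracket A B = A * B - B * A"

definition sl2_triple :: "nat \<Rightarrow> quat mat set \<Rightarrow> quat mat \<Rightarrow> quat mat \<Rightarrow> quat mat \<Rightarrow> bool" where
  "sl2_triple n \<gg> X H Y \<longleftrightarrow> X \<in> \<gg> \<and> H \<in> \<gg> \<and> Y \<in> \<gg> \<and> X \<noteq> 0\<^sub>m n n \<and>
     lie_bracket H X = 2 \<cdot>\<^sub>m X \<and> lie_bracket H Y = (- 2) \<cdot>\<^sub>m Y \<and> lie_bracket X Y = H"

definition Ad :: "quat mat monoid \<Rightarrow> quat mat \<Rightarrow> quat mat \<Rightarrow> quat mat" where
  "Ad G g A = g * A * inv\<^bsub>G\<^esub> g"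

definition centralizer :: "quat mat monoid \<Rightarrow> quat mat \<Rightarrow> quat mat \<Rightarrow> quat mat \<Rightarrow> quat mat monoid" where
  "centralizer G X H Y = G\<lparr>carrier := {g \<in> carrier G. Ad G g X = X \<and> Ad G g H = H \<and> Ad G g Y = Y}\<rparr>"


section \<open>The signed Young diagram\<close>

definition sl2_span :: "quat mat \<Rightarrow> quat mat \<Rightarrow> quat mat \<Rightarrow> quat mat set" where
  "sl2_span X H Y =
     {of_real a \<cdot>\<^sub>m X + of_real b \<cdot>\<^sub>m H + of_real c \<cdot>\<^sub>m Y | a b c. True}"

definition submodule :: "nat \<Rightarrow> quat mat set \<Rightarrow> quat vec set \<Rightarrow> bool" where
  "submodule n \<aa> W \<longleftrightarrow> right_subspace \<real> n W \<and> (\<forall>A\<in>\<aa>. \<forall>v\<in>W. A *\<^sub>v v \<in> W)"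

definition irreducible_submodule :: "nat \<Rightarrow> quat mat set \<Rightarrow> quat vec set \<Rightarrow> bool" where
  "irreducible_submodule n \<aa> W \<longleftrightarrow> submodule n \<aa> W \<and> W \<noteq> {0\<^sub>v n} \<and>
     (\<forall>U. submodule n \<aa> U \<and> U \<subseteq> W \<longrightarrow> U = {0\<^sub>v n} \<or> U = W)"

text \<open>The index of the following is the real dimension \<open>d\<close>: \<open>isotypic n X H Y d\<close> is \<open>M(d - 1)\<close> and
  \<open>lowest n X H Y d\<close> is \<open>L(d - 1)\<close>. The sum of a family of subspaces is the real subspace hull of
  their union.\<close>

definition isotypic :: "nat \<Rightarrow> quat mat \<Rightarrow> quat mat \<Rightarrow> quat mat \<Rightarrow> nat \<Rightarrow> quat vec set" where
  "isotypic n X H Y d = right_subspace \<real> n hull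
     \<Union>{W. irreducible_submodule n (sl2_span X H Y) W \<and> right_dim \<real> n W = d}"

definition lowest :: "nat \<Rightarrow> quat mat \<Rightarrow> quat mat \<Rightarrow> quat mat \<Rightarrow> nat \<Rightarrow> quat vec set" where
  "lowest n X H Y d = {v \<in> isotypic n X H Y d. Y *\<^sub>v v = 0\<^sub>v n}"

definition form_pq :: "nat \<Rightarrow> nat \<Rightarrow> quat vec \<Rightarrow> quat vec \<Rightarrow> quat" where
  "form_pq p q x y = scalar_prod (map_vec qcnj x) (I_pq p q *\<^sub>v y)"

definition form_d :: "nat \<Rightarrow> nat \<Rightarrow> quat mat \<Rightarrow> nat \<Rightarrow> quat vec \<Rightarrow> quat vec \<Rightarrow> quat" where
  "form_d p q X d v u = form_pq p q v ((X ^\<^sub>m (d - 1)) *\<^sub>v u)"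

text \<open>The signature of a Hermitian form on a subspace \<open>L\<close>: the maximal dimensions of subspaces on
  which the form is positive, respectively negative, definite. The values \<open>B v v\<close> are real.\<close>

definition positive_index :: "nat \<Rightarrow> quat vec set \<Rightarrow> (quat vec \<Rightarrow> quat vec \<Rightarrow> quat) \<Rightarrow> nat" where
  "positive_index n L B = Max {right_dim UNIV n W | W.
     right_subspace UNIV n W \<and> W \<subseteq> L \<and> (\<forall>v\<in>W. v \<noteq> 0\<^sub>v n \<longrightarrow> Rq (B v v) > 0)}"

definition negative_index :: "nat \<Rightarrow> quat vec set \<Rightarrow> (quat vec \<Rightarrow> quat vec \<Rightarrow> quat) \<Rightarrow> nat" where
  "negative_index n L B = positive_index n L (\<lambda>v u. - B v u)"

text \<open>The rows of length \<open>d\<close> form a block, and the entries of a block are determined by those of its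
  first column (up to the order of the rows). So a signed Young diagram is recorded by its underlying
  partition together with the multiset of first-column entries of the block of each part.\<close>

record signed_diagram =
  underlying_partition :: "nat multiset"
  first_column :: "nat \<Rightarrow> int multiset"

definition signed_young_diagram ::
    "nat \<Rightarrow> nat \<Rightarrow> quat mat \<Rightarrow> quat mat \<Rightarrow> quat mat \<Rightarrow> signed_diagram" where
  "signed_young_diagram p q X H Y =
    (let n = p + q;
         L = lowest n X H Y;
         t = (\<lambda>d. right_dim UNIV n (L d))
     in \<lparr>underlying_partition = (\<Sum>d \<in> {d. t d > 0}. replicate_mset (t d) d),
         first_column = (\<lambda>d.
           if even d then replicate_mset (t d) 1
           else replicate_mset (positive_index n (L d) (form_d p q X d)) 1
              + replicate_mset (negative_index n (L d) (form_d p q X d)) (- 1))\<rparr>)"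

definition even_parts :: "nat multiset \<Rightarrow> nat set" where
  "even_parts d = {\<eta> \<in> set_mset d. even \<eta>}"

definition odd_parts :: "nat multiset \<Rightarrow> nat set" where
  "odd_parts d = {\<theta> \<in> set_mset d. odd \<theta>}"


section \<open>Isomorphism of matrix Lie groups\<close>

text \<open>The topology of entrywise convergence on a group of \<open>n \<times> n\<close> matrices.\<close>

definition mat_topology :: "nat \<Rightarrow> quat mat monoid \<Rightarrow> quat mat topology" where
  "mat_topology n G = pullback_topology (carrier G)
     (\<lambda>A. \<lambda>ij\<in>{..<n} \<times> {..<n}. A $$ ij)
     (product_topology (\<lambda>_. euclidean) ({..<n} \<times> {..<n}))"

text \<open>Between Lie groups, a group isomorphism that is a homeomorphism is automatically a
  diffeomorphism, so this is isomorphism of Lie groups.\<close>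

definition topological_group_iso ::
    "('a, 'c) monoid_scheme \<Rightarrow> 'a topology \<Rightarrow> ('b, 'd) monoid_scheme \<Rightarrow> 'b topology \<Rightarrow> bool" where
  "topological_group_iso G S K T \<longleftrightarrow> (\<exists>\<phi> \<in> iso G K. homeomorphic_map S T \<phi>)"

end

theory Submission
  imports Defs "HOL-Library.Function_Algebras"
begin

text \<open>
  Let \<open>L(d)\<close> be the space of lowest weight vectors of weight \<open>1 - d\<close>. The form
  \<open>(v, u)\<^sub>d = \<langle>v, X\<^bsup>d-1\<^esup> u\<rangle>\<close> is non-degenerate on \<open>L(d)\<close>, so there is a matrix \<open>B\<^sub>d\<close> whose columns
  are a basis of \<open>L(d)\<close> with Gram matrix \<open>S\<^sub>d = B\<^sub>d\<^sup>* I\<^sub>p\<^sub>q X\<^bsup>d-1\<^esup> B\<^sub>d\<close> equal to \<open>I\<^sub>p\<^sub>q\<close> (\<open>d\<close> odd, with the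
  signature as \<open>(p, q)\<close>) or to \<open>j\<close> times the identity (\<open>d\<close> even). Comparing \<open>H\<close>-weights shows that
  \<open>B\<^sub>d\<^sup>* I\<^sub>p\<^sub>q g X\<^sup>k B\<^sub>e = 0\<close> unless \<open>d = e = k + 1\<close>, for every \<open>g\<close> commuting with \<open>X\<close> and \<open>H\<close>. For \<open>g = 1\<close>
  this says that the matrices \<open>C\<^sub>d\<^sub>l = S\<^sub>d\<^sup>-\<^sup>1 B\<^sub>d\<^sup>* I\<^sub>p\<^sub>q X\<^bsup>d-1-l\<^esup>\<close> are dual to the matrices \<open>X\<^sup>l B\<^sub>d\<close>, and
  in general that \<open>g B\<^sub>d = B\<^sub>d g\<^sub>d\<close> with \<open>g\<^sub>d = C\<^sub>d\<^sub>0 g B\<^sub>d\<close>. Hence \<open>g \<mapsto> (g\<^sub>d)\<close> and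
  \<open>(g\<^sub>d) \<mapsto> \<Sum>\<^sub>d\<^sub>,\<^sub>l X\<^sup>l B\<^sub>d g\<^sub>d C\<^sub>d\<^sub>l\<close> are mutually inverse, and both are linear in the matrix entries.
\<close>


section \<open>Quaternions\<close>

text \<open>Three gaps separate this outline from the statement. The groups demand reduced norm 1,
  while the outline handles only isometries. The condition is automatic: invariance of a
  non-degenerate form makes the square of the reduced norm 1, and the reduced norm of every
  quaternionic matrix is a nonnegative real number, because elimination matrices are squares. Next,
  the spaces of the diagram are defined through real irreducible submodules. The Casimir operator
  identifies them with eigenspaces of \<open>H\<close> on the kernel of \<open>Y\<close>, where
  closure under right multiplication by quaternions is visible. Finally, the signature is defined by
  maximal definite subspaces, and Sylvester's argument recovers it from an orthogonal basis.
  Non-degeneracy on L(d) rests on the strings \<open>X^l v\<close> spanning the whole space: by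
  weights, \<open>X^(d-1) v\<close> can pair nontrivially only with L(d), and \<open>X^(d-1)\<close>
  is injective there. Spanning is proved from nilpotency of \<open>X\<close> and \<open>Y\<close>
  alone, without assuming that \<open>H\<close> is diagonalizable.\<close>

lemma qcnj_simps [simp]:
  "qcnj 0 = 0" "qcnj 1 = 1" "qcnj (x + y) = qcnj x + qcnj y" "qcnj (x - y) = qcnj x - qcnj y"
  "qcnj (- x) = - qcnj x" "qcnj (qcnj x) = x" "qcnj (r *\<^sub>R x) = r *\<^sub>R qcnj x"
  by (simp_all add: qcnj_def quat_ops)

lemma qcnj_mult: "qcnj (x * y) = qcnj y * qcnj x"
  by (simp add: qcnj_def quat_ops algebra_simps)

lemma qcnj_eq_0_iff [simp]: "qcnj x = 0 \<longleftrightarrow> x = 0"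
  by (metis qcnj_simps(1,6))

lemma qcnj_sum: "qcnj (sum f A) = (\<Sum>a\<in>A. qcnj (f a))"
  by (induction A rule: infinite_finite_induct) auto

lemma of_real_quat: "of_real r = Quat r 0 0 0"
  by (simp add: of_real_def quat_ops)

lemma qcnj_of_real [simp]: "qcnj (of_real r) = of_real r"
  by (simp add: of_real_def)

lemma of_real_quat_commute: "of_real r * (x :: quat) = x * of_real r"
  by (simp add: of_real_def)

lemma Rq_simps [simp]:
  "Rq 0 = 0" "Rq 1 = 1" "Rq (x + y) = Rq x + Rq y" "Rq (x - y) = Rq x - Rq y" "Rq (- x) = - Rq x"
  "Rq (r *\<^sub>R x) = r * Rq x" "Rq (qcnj x) = Rq x" "Rq (of_real r) = r"
  by (simp_all add: qcnj_def quat_ops of_real_quat)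

lemma Rq_sum: "Rq (sum f A) = (\<Sum>a\<in>A. Rq (f a))"
  by (induction A rule: infinite_finite_induct) auto

lemma norm_quat_sq: "(norm x)\<^sup>2 = (Rq x)\<^sup>2 + (Iq x)\<^sup>2 + (Jq x)\<^sup>2 + (Kq x)\<^sup>2" for x :: quat
  by (simp add: norm_quat_def)

lemma qcnj_mult_self: "qcnj x * x = of_real ((norm x)\<^sup>2)"
  unfolding norm_quat_sq by (simp add: of_real_quat qcnj_def quat_ops power2_eq_square algebra_simps)

lemma quat_selfadjoint_real: "qcnj x = x \<Longrightarrow> x = of_real (Rq x)"
  by (auto simp: qcnj_def of_real_quat quat_eq_iff)

text \<open>Every quaternion lies in a subfield isomorphic to the complex numbers, so it has a
  square root. The clause \<open>s \<noteq> - 1\<close> serves \<open>column_mat_square\<close>,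
  where \<open>1 + s\<close> is inverted.\<close>

lemma quat_square_root: "\<exists>s :: quat. s * s = x \<and> s \<noteq> - 1"
proof -
  obtain a b c d where x: "x = Quat a b c d" by (cases x)
  define r where "r = norm x"
  have r: "r\<^sup>2 = a\<^sup>2 + b\<^sup>2 + c\<^sup>2 + d\<^sup>2" "r \<ge> 0"
    by (simp_all add: r_def norm_quat_sq x)
  consider "b = 0 \<and> c = 0 \<and> d = 0 \<and> a \<ge> 0" | "b = 0 \<and> c = 0 \<and> d = 0 \<and> a < 0" | "b\<^sup>2 + c\<^sup>2 + d\<^sup>2 > 0"
  proof (cases "b = 0 \<and> c = 0 \<and> d = 0")
    case False
    then have "b\<^sup>2 + c\<^sup>2 + d\<^sup>2 > 0"
      by (metis add_nonneg_eq_0_iff add_nonneg_nonneg less_le zero_eq_power2 zero_le_power2)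
    then show ?thesis using that by blast
  qed (use that in fastforce)
  then show ?thesis
  proof cases
    case 1
    then show ?thesis
      by (intro exI[of _ "Quat (sqrt a) 0 0 0"])
        (use real_sqrt_ge_zero[of a] in \<open>simp add: x quat_ops; linarith\<close>)
  next
    case 2
    \<comment> \<open>A negative real number has a whole sphere of square roots; the one along i is
      taken.\<close>
    define e where "e = sqrt (- a)"
    have e: "e * e = - a"
      unfolding e_def using 2 by (subst real_sqrt_mult_self) linarith
    have "Quat 0 e 0 0 * Quat 0 e 0 0 = x"
      using 2 by (simp add: x times_quat_def e)
    moreover have "Quat 0 e 0 0 \<noteq> - 1" by (simp add: one_quat_def uminus_quat_def)
    ultimately show ?thesis by blast
  next
    case 3
    then have "\<bar>a\<bar>\<^sup>2 < r\<^sup>2" unfolding r(1) by simp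
    then have "\<bar>a\<bar> < r" using r(2) by (rule power2_less_imp_less)
    \<comment> \<open>The real part of the root, as for complex numbers: if \<open>f\<close> is the
      norm of its imaginary part, then \<open>e^2 - f^2 = a\<close> and
      \<open>e^2 + f^2 = r\<close>. The imaginary part is that of \<open>x\<close> divided by
      \<open>2 * e\<close>.\<close>
    define e where "e = sqrt ((r + a) / 2)"
    have e: "e > 0" "e * e = (r + a) / 2"
      using \<open>\<bar>a\<bar> < r\<close> by (auto simp: e_def)
    have "e * e - (b / (2 * e)) * (b / (2 * e)) - (c / (2 * e)) * (c / (2 * e)) - (d / (2 * e)) * (d / (2 * e)) = a"
    proof -
      have "b\<^sup>2 + c\<^sup>2 + d\<^sup>2 = (r - a) * (r + a)"
        using r by (simp add: algebra_simps power2_eq_square)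
      also have "\<dots> = (r - a) * (2 * (e * e))" using e by simp
      finally have "(b\<^sup>2 + c\<^sup>2 + d\<^sup>2) / (4 * (e * e)) = (r - a) / 2"
        using e(1) by (simp add: field_simps)
      moreover have "(b / (2 * e)) * (b / (2 * e)) + (c / (2 * e)) * (c / (2 * e)) + (d / (2 * e)) * (d / (2 * e))
          = (b\<^sup>2 + c\<^sup>2 + d\<^sup>2) / (4 * (e * e))"
        by (simp add: power2_eq_square add_divide_distrib)
      moreover have "u = (r + a) / 2 \<Longrightarrow> s = (r - a) / 2 \<Longrightarrow> x + y + z = s \<Longrightarrow> u - x - y - z = a"
        for u s x y z :: real by (simp add: field_simps)
      ultimately show ?thesis using e(2) by blast
    qed
    then show ?thesis using e(1)
      by (intro exI[of _ "Quat e (b / (2 * e)) (c / (2 * e)) (d / (2 * e))"])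
        (simp add: x quat_ops)
  qed
qed

text \<open>With \<open>r = norm x\<close>, the identity \<open>x * x = - r^2\<close> shows that
  \<open>a = r - x j\<close> satisfies \<open>x * a = a * (r j)\<close>. Multiplying by
  \<open>qcnj a\<close> gives a positive multiple of j, which a real rescaling of \<open>a\<close>
  normalises. Only \<open>x = - r j\<close> makes this \<open>a\<close> vanish.\<close>

lemma imaginary_quat_congruent_j:
  assumes "Rq x = 0" "x \<noteq> 0"
  shows "\<exists>a. a \<noteq> 0 \<and> qcnj a * x * a = quat_j"
proof -
  have rescale: "\<exists>a. a \<noteq> 0 \<and> qcnj a * x * a = quat_j"
    if "s > 0" "a \<noteq> 0" "qcnj a * x * a = s *\<^sub>R quat_j" for a s
    using that by (intro exI[of _ "(1 / sqrt s) *\<^sub>R a"]) (auto simp: scaleR_scaleR[symmetric])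
  define r where "r = norm x"
  have "r > 0" using assms by (simp add: r_def)
  define a where "a = r *\<^sub>R 1 - x * quat_j"
  have jj: "quat_j * quat_j = - 1" by (simp add: quat_j_def quat_ops)
  have "x * x = - (qcnj x * x)"
    using assms by (simp add: qcnj_def quat_ops)
  then have xx: "x * x = - (r\<^sup>2 *\<^sub>R 1)"
    by (simp add: qcnj_mult_self r_def of_real_def)
  show ?thesis
  proof (cases "a = 0")
    case True
    then have "(r *\<^sub>R 1) * quat_j = x * quat_j * quat_j" by (simp add: a_def)
    then have "r *\<^sub>R quat_j = - x" by (simp add: mult.assoc jj)
    then have x: "x = r *\<^sub>R (- quat_j)" by simp
    \<comment> \<open>Here \<open>x = - r j\<close>, and i turns - j into j under
      conjugation.\<close>
    show ?thesis using \<open>r > 0\<close>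
      by (intro rescale[of r "Quat 0 1 0 0"]) (auto simp: x quat_j_def qcnj_def quat_ops)
  next
    case False
    have "x * a = r *\<^sub>R x - x * x * quat_j"
      by (simp add: a_def algebra_simps)
    also have "\<dots> = a * (r *\<^sub>R quat_j)"
      by (simp add: a_def xx algebra_simps jj power2_eq_square)
    finally have "qcnj a * x * a = ((norm a)\<^sup>2 * r) *\<^sub>R quat_j"
      by (metis mult.assoc qcnj_mult_self of_real_def mult_scaleR_left mult_scaleR_right mult_1 scaleR_scaleR)
    then show ?thesis
      using False \<open>r > 0\<close> by (intro rescale[of "(norm a)\<^sup>2 * r" a]) auto
  qed
qed


section \<open>Dimension of right vector spaces\<close>

text \<open>One notion covers both coefficient domains of the statement: the real numbers inside the
  quaternions, and all quaternions.\<close>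

definition division_subring :: "'a :: division_ring set \<Rightarrow> bool" where
  "division_subring F \<longleftrightarrow> 0 \<in> F \<and> 1 \<in> F \<and>
     (\<forall>x\<in>F. \<forall>y\<in>F. x - y \<in> F \<and> x * y \<in> F) \<and> (\<forall>x\<in>F. inverse x \<in> F)"

lemma division_subring_UNIV [simp]: "division_subring UNIV"
  by (simp add: division_subring_def)

lemma division_subring_Reals [simp]: "division_subring (\<real> :: 'a :: real_div_algebra set)"
  by (simp add: division_subring_def)

lemma division_subringD:
  assumes "division_subring F"
  shows "0 \<in> F" "1 \<in> F" "x \<in> F \<Longrightarrow> y \<in> F \<Longrightarrow> x - y \<in> F" "x \<in> F \<Longrightarrow> y \<in> F \<Longrightarrow> x * y \<in> F"
    "x \<in> F \<Longrightarrow> inverse x \<in> F" "x \<in> F \<Longrightarrow> - x \<in> F" "x \<in> F \<Longrightarrow> y \<in> F \<Longrightarrow> x + y \<in> F"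
proof -
  show 1: "0 \<in> F" "1 \<in> F" "x \<in> F \<Longrightarrow> y \<in> F \<Longrightarrow> x - y \<in> F" "x \<in> F \<Longrightarrow> y \<in> F \<Longrightarrow> x * y \<in> F"
    "x \<in> F \<Longrightarrow> inverse x \<in> F" for x y
    using assms by (auto simp: division_subring_def)
  show 2: "x \<in> F \<Longrightarrow> - x \<in> F" for x using 1(1) 1(3)[of 0 x] by simp
  show "x \<in> F \<Longrightarrow> y \<in> F \<Longrightarrow> x + y \<in> F" using 1(3)[of x "- y"] 2[of y] by simp
qed

lemma division_subring_sum:
  assumes "division_subring F" "\<And>a. a \<in> A \<Longrightarrow> f a \<in> F"
  shows "sum f A \<in> F"
  using assms(2) by (induction A rule: infinite_finite_induct) (auto intro: division_subringD[OF assms(1)])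

text \<open>Gaussian elimination without commutativity: coefficients stand to the left of the
  unknowns, so equations may be multiplied from the left. The unknowns are indexed by an arbitrary
  finite set so that a pivot can simply be removed from it.\<close>

lemma homogeneous_system_nontrivial_solution:
  fixes a :: "nat \<Rightarrow> 'j \<Rightarrow> 'a :: division_ring"
  assumes F: "division_subring F"
    and "finite J" "m < card J" "\<And>i j. i < m \<Longrightarrow> j \<in> J \<Longrightarrow> a i j \<in> F"
  shows "\<exists>c. (\<forall>j\<in>J. c j \<in> F) \<and> (\<exists>j\<in>J. c j \<noteq> 0) \<and> (\<forall>i<m. (\<Sum>j\<in>J. a i j * c j) = 0)"
  using assms(2-4)
proof (induction m arbitrary: J a)
  case 0
  then obtain j where "j \<in> J" by (auto simp: card_gt_0_iff)
  then show ?case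
    using division_subringD[OF F] by (intro exI[of _ "\<lambda>_. 1"]) auto
next
  case (Suc m)
  show ?case
  proof (cases "\<exists>k\<in>J. a m k \<noteq> 0")
    case False
    have "\<exists>c. (\<forall>j\<in>J. c j \<in> F) \<and> (\<exists>j\<in>J. c j \<noteq> 0) \<and> (\<forall>i<m. (\<Sum>j\<in>J. a i j * c j) = 0)"
      using Suc.prems by (intro Suc.IH) auto
    then obtain c where "\<forall>j\<in>J. c j \<in> F" "\<exists>j\<in>J. c j \<noteq> 0" "\<forall>i<m. (\<Sum>j\<in>J. a i j * c j) = 0"
      by blast
    moreover have "(\<Sum>j\<in>J. a m j * c j) = 0" using False by (intro sum.neutral) auto
    ultimately show ?thesis by (intro exI[of _ c]) (auto simp: less_Suc_eq)
  next
    case True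
    then obtain k where k: "k \<in> J" "a m k \<noteq> 0" by blast
    define J' where "J' = J - {k}"
    \<comment> \<open>Equation \<open>m\<close>, solved for the unknown \<open>k\<close>, reads
      \<open>c k = - (\<Sum>j. e j * c j)\<close>; this is substituted into the others.\<close>
    define e where "e j = inverse (a m k) * a m j" for j
    have "\<exists>c. (\<forall>j\<in>J'. c j \<in> F) \<and> (\<exists>j\<in>J'. c j \<noteq> 0) \<and>
        (\<forall>i<m. (\<Sum>j\<in>J'. (a i j - a i k * e j) * c j) = 0)"
      using Suc.prems k unfolding J'_def e_def
      by (intro Suc.IH) (auto intro!: division_subringD[OF F])
    then obtain c where c: "\<And>j. j \<in> J' \<Longrightarrow> c j \<in> F" "\<exists>j\<in>J'. c j \<noteq> 0"
      "\<And>i. i < m \<Longrightarrow> (\<Sum>j\<in>J'. (a i j - a i k * e j) * c j) = 0" by blast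
    define s where "s = (\<Sum>j\<in>J'. e j * c j)"
    define c' where "c' = c(k := - s)"
    have split: "(\<Sum>j\<in>J. a i j * c' j) = (\<Sum>j\<in>J'. a i j * c j) - a i k * s" for i
      using Suc.prems(1) k(1)
      by (subst sum.remove[of J k]) (auto simp: J'_def c'_def intro!: sum.cong)
    have "s \<in> F"
      unfolding s_def e_def using Suc.prems k c(1)
      by (intro division_subring_sum[OF F] division_subringD[OF F]) (auto simp: J'_def)
    then have "\<forall>j\<in>J. c' j \<in> F"
      using c(1) by (auto simp: c'_def J'_def intro: division_subringD[OF F])
    moreover have "\<exists>j\<in>J. c' j \<noteq> 0"
      using c(2) by (auto simp: c'_def J'_def)
    moreover have "(\<Sum>j\<in>J. a i j * c' j) = 0" if "i < m" for i
      using c(3)[OF that] unfolding split s_def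
      by (simp add: algebra_simps sum_subtractf sum_distrib_left)
    moreover have "(\<Sum>j\<in>J. a m j * c' j) = 0"
      unfolding split s_def using k(2)
      by (simp add: e_def sum_distrib_left mult.assoc[symmetric])
    ultimately show ?thesis by (intro exI[of _ c']) (auto simp: less_Suc_eq)
  qed
qed

lemma wide_mat_kernel:
  fixes A :: "'a :: division_ring mat"
  assumes "division_subring F" "A \<in> carrier_mat m k" "m < k"
    "\<And>i j. i < m \<Longrightarrow> j < k \<Longrightarrow> A $$ (i, j) \<in> F"
  obtains c where "c \<in> carrier_vec k" "c \<noteq> 0\<^sub>v k" "\<And>i. i < k \<Longrightarrow> c $ i \<in> F" "A *\<^sub>v c = 0\<^sub>v m"
proof -
  obtain c where c: "\<forall>j\<in>{..<k}. c j \<in> F" "\<exists>j\<in>{..<k}. c j \<noteq> 0"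
      "\<forall>i<m. (\<Sum>j\<in>{..<k}. A $$ (i, j) * c j) = 0"
    using homogeneous_system_nontrivial_solution[of F "{..<k}" m "\<lambda>i j. A $$ (i, j)"] assms by auto
  show ?thesis
  proof
    show "vec k c \<noteq> 0\<^sub>v k" using c(2) by (metis index_vec index_zero_vec(1) lessThan_iff)
    show "A *\<^sub>v vec k c = 0\<^sub>v m"
      using assms(2) c(3) by (intro eq_vecI) (auto simp: scalar_prod_def atLeast0LessThan)
  qed (use c in auto)
qed

definition right_indep :: "quat set \<Rightarrow> nat \<Rightarrow> quat vec list \<Rightarrow> bool" where
  "right_indep F n vs \<longleftrightarrow> set vs \<subseteq> carrier_vec n \<and>
     (\<forall>c\<in>carrier_vec (length vs). (\<forall>i<length vs. c $ i \<in> F) \<longrightarrow>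
        mat_of_cols n vs *\<^sub>v c = 0\<^sub>v n \<longrightarrow> c = 0\<^sub>v (length vs))"

lemma right_smult_vec_carrier [simp]: "v \<in> carrier_vec n \<Longrightarrow> right_smult_vec v a \<in> carrier_vec n"
  and right_smult_vec_index [simp]: "i < dim_vec v \<Longrightarrow> right_smult_vec v a $ i = v $ i * a"
  and right_smult_vec_dim [simp]: "dim_vec (right_smult_vec v a) = dim_vec v"
  by (auto simp: right_smult_vec_def)

lemma right_smult_vec_zero [simp]: "right_smult_vec (0\<^sub>v n) a = 0\<^sub>v n"
  by (rule eq_vecI) auto

lemma mult_mat_vec_right_smult:
  assumes "A \<in> carrier_mat m n" "v \<in> carrier_vec n"
  shows "A *\<^sub>v right_smult_vec v a = right_smult_vec (A *\<^sub>v v) a"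
  using assms by (intro eq_vecI) (auto simp: scalar_prod_def sum_distrib_right mult.assoc)

lemma mult_mat_vec_zero: "A \<in> carrier_mat m n \<Longrightarrow> A *\<^sub>v 0\<^sub>v n = (0\<^sub>v m :: quat vec)"
  by (rule eq_vecI) auto

lemma mat_of_cols_mult_vec_carrier [simp]: "mat_of_cols n vs *\<^sub>v c \<in> carrier_vec n"
  by (rule carrier_vecI) simp

lemma mat_of_cols_mult_unit:
  fixes vs :: "'a :: semiring_1 vec list"
  assumes "i < length vs" "vs ! i \<in> carrier_vec n"
  shows "mat_of_cols n vs *\<^sub>v unit_vec (length vs) i = vs ! i"
proof (rule eq_vecI)
  fix k assume "k < dim_vec (vs ! i)"
  then have k: "k < n" using assms(2) by simp
  then have "(mat_of_cols n vs *\<^sub>v unit_vec (length vs) i) $ k =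
      (\<Sum>j\<in>{0..<length vs}. vs ! j $ k * (if i = j then 1 else 0))"
    using assms(1) by (auto simp: scalar_prod_def mat_of_cols_index intro!: sum.cong)
  also have "\<dots> = vs ! i $ k"
    using assms(1) by (subst sum.remove[of _ i]) (auto intro!: sum.neutral)
  finally show "(mat_of_cols n vs *\<^sub>v unit_vec (length vs) i) $ k = vs ! i $ k" .
qed (use assms in auto)

lemma mat_of_cols_snoc_mult:
  assumes "set vs \<subseteq> carrier_vec n" "w \<in> carrier_vec n" "c \<in> carrier_vec (Suc (length vs))"
  shows "mat_of_cols n (vs @ [w]) *\<^sub>v c =
    mat_of_cols n vs *\<^sub>v vec (length vs) (\<lambda>i. c $ i) + right_smult_vec w (c $ length vs)"
  using assms
  by (intro eq_vecI)
    (auto simp: scalar_prod_def mat_of_cols_index nth_append intro!: sum.cong)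

lemma right_subspace_mat_of_cols:
  assumes W: "right_subspace F n W" and "set vs \<subseteq> W" "c \<in> carrier_vec (length vs)"
    "\<And>i. i < length vs \<Longrightarrow> c $ i \<in> F"
  shows "mat_of_cols n vs *\<^sub>v c \<in> W"
  using assms(2-4)
proof (induction vs arbitrary: c rule: rev_induct)
  case Nil
  then have "mat_of_cols n [] *\<^sub>v c = 0\<^sub>v n" by (intro eq_vecI) (auto simp: scalar_prod_def)
  then show ?case using W by (simp add: right_subspace_def)
next
  case (snoc w vs)
  have "set vs \<subseteq> carrier_vec n" "w \<in> carrier_vec n"
    using W snoc.prems by (auto simp: right_subspace_def)
  moreover have "mat_of_cols n vs *\<^sub>v vec (length vs) (\<lambda>i. c $ i) \<in> W"
    using snoc.prems by (intro snoc.IH) auto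
  moreover have "right_smult_vec w (c $ length vs) \<in> W"
    using W snoc.prems by (auto simp: right_subspace_def)
  ultimately show ?case
    using W snoc.prems by (auto simp: right_subspace_def mat_of_cols_snoc_mult)
qed

text \<open>The coordinates of \<open>ws\<close> with respect to \<open>vs\<close> form a matrix; if
  \<open>ws\<close> were longer, a kernel vector of this matrix would be a relation between the
  vectors of \<open>ws\<close>.\<close>

lemma right_indep_length_le:
  assumes F: "division_subring F" and vs: "set vs \<subseteq> carrier_vec n" and ws: "right_indep F n ws"
    and span: "\<And>w. w \<in> set ws \<Longrightarrow>
      \<exists>c\<in>carrier_vec (length vs). (\<forall>i<length vs. c $ i \<in> F) \<and> mat_of_cols n vs *\<^sub>v c = w"
  shows "length ws \<le> length vs"
proof (rule ccontr)
  assume "\<not> ?thesis"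
  then have lt: "length vs < length ws" by simp
  obtain c where c: "\<And>w. w \<in> set ws \<Longrightarrow> c w \<in> carrier_vec (length vs)"
     "\<And>w i. w \<in> set ws \<Longrightarrow> i < length vs \<Longrightarrow> c w $ i \<in> F"
     "\<And>w. w \<in> set ws \<Longrightarrow> mat_of_cols n vs *\<^sub>v c w = w"
    using span by metis
  define A where "A = mat_of_cols (length vs) (map c ws)"
  have A: "A \<in> carrier_mat (length vs) (length ws)" by (auto simp: A_def)
  have "A $$ (i, j) \<in> F" if "i < length vs" "j < length ws" for i j
    using that c(2) by (auto simp: A_def mat_of_cols_index)
  then obtain x where x: "x \<in> carrier_vec (length ws)" "x \<noteq> 0\<^sub>v (length ws)"
      "\<And>i. i < length ws \<Longrightarrow> x $ i \<in> F" "A *\<^sub>v x = 0\<^sub>v (length vs)"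
    using wide_mat_kernel[OF F A lt] by metis
  have eq: "mat_of_cols n ws = mat_of_cols n vs * A"
  proof (rule mat_col_eqI)
    fix j assume "j < dim_col (mat_of_cols n vs * A)"
    then have j: "j < length ws" using A by auto
    then have "ws ! j \<in> carrier_vec n" using ws by (auto simp: right_indep_def)
    then show "col (mat_of_cols n ws) j = col (mat_of_cols n vs * A) j"
      using j c A by (subst col_mult2[of _ n "length vs" _ "length ws"]) (auto simp: A_def)
  qed (use A in auto)
  then have "mat_of_cols n ws *\<^sub>v x = 0\<^sub>v n"
    using A x(1,4) by (subst eq, subst assoc_mult_mat_vec[of _ n "length vs" _ "length ws"])
      (auto intro!: eq_vecI)
  then show False using ws x by (auto simp: right_indep_def)
qed

lemma right_indep_length_le_dim:
  assumes "right_indep UNIV n ws"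
  shows "length ws \<le> n"
proof (rule ccontr)
  assume "\<not> ?thesis"
  then obtain c where "c \<in> carrier_vec (length ws)" "c \<noteq> 0\<^sub>v (length ws)" "mat_of_cols n ws *\<^sub>v c = 0\<^sub>v n"
    using wide_mat_kernel[of UNIV "mat_of_cols n ws" n "length ws"] by auto
  then show False using assms by (auto simp: right_indep_def)
qed

text \<open>Bridges the definition of a basis by bijectivity of the coordinate map to independence
  and spanning, the form in which bases are built and used below.\<close>

lemma right_basis_iff:
  assumes F: "division_subring F" and W: "right_subspace F n W"
  shows "right_basis F n vs W \<longleftrightarrow> right_indep F n vs \<and> set vs \<subseteq> W \<and>
    (\<forall>w\<in>W. \<exists>c\<in>carrier_vec (length vs). (\<forall>i<length vs. c $ i \<in> F) \<and> mat_of_cols n vs *\<^sub>v c = w)"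
    (is "_ \<longleftrightarrow> ?R")
proof
  let ?C = "{c \<in> carrier_vec (length vs). \<forall>i<length vs. c $ i \<in> F}"
  let ?f = "\<lambda>c. mat_of_cols n vs *\<^sub>v c"
  have zero: "?f (0\<^sub>v (length vs)) = 0\<^sub>v n" "0\<^sub>v (length vs) \<in> ?C"
    using division_subringD[OF F] by (auto intro!: eq_vecI)
  {
    assume b: "right_basis F n vs W"
    then have inj: "inj_on ?f ?C" and img: "?f ` ?C = W" and vs: "set vs \<subseteq> carrier_vec n"
      by (auto simp: right_basis_def bij_betw_def)
    have "c = 0\<^sub>v (length vs)" if "c \<in> ?C" "?f c = 0\<^sub>v n" for c
      using inj_onD[OF inj, of c "0\<^sub>v (length vs)"] that zero by metis
    then have "right_indep F n vs"
      unfolding right_indep_def using vs by blast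
    moreover have "set vs \<subseteq> W"
    proof
      fix v assume "v \<in> set vs"
      then obtain i where i: "i < length vs" "v = vs ! i" by (auto simp: in_set_conv_nth)
      have "?f (unit_vec (length vs) i) = v"
        using vs nth_mem[OF i(1)] unfolding i(2) by (intro mat_of_cols_mult_unit i(1)) auto
      moreover have "unit_vec (length vs) i \<in> ?C"
        using division_subringD[OF F] i by auto
      ultimately show "v \<in> W" using img by blast
    qed
    ultimately show ?R using img by blast
  }
  assume R: ?R
  then have vs: "set vs \<subseteq> carrier_vec n" by (auto simp: right_indep_def)
  have "inj_on ?f ?C"
  proof
    fix c c' assume c: "c \<in> ?C" "c' \<in> ?C" "?f c = ?f c'"
    then have "?f (c - c') = 0\<^sub>v n"
      by (subst mult_minus_distrib_mat_vec[of _ n "length vs"]) auto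
    moreover have "c - c' \<in> ?C" using c division_subringD(3)[OF F] by auto
    ultimately have "c - c' = 0\<^sub>v (length vs)" using R by (auto simp: right_indep_def)
    then show "c = c'" using c
      by (metis (no_types, lifting) eq_vecI carrier_vecD index_minus_vec(1) index_zero_vec(1)
          mem_Collect_eq right_minus_eq)
  qed
  moreover have "?f ` ?C \<subseteq> W"
    using R right_subspace_mat_of_cols[OF W] by (intro image_subsetI) simp
  moreover have "W \<subseteq> ?f ` ?C"
    using R by (fastforce simp: image_iff)
  ultimately show "right_basis F n vs W" using vs by (auto simp: right_basis_def bij_betw_def)
qed

text \<open>Any two bases bound each other's length, so the definite description in
  \<open>right_dim\<close> is well defined as soon as one basis is known.\<close>

lemma right_dim_eq:
  assumes F: "division_subring F" and W: "right_subspace F n W" and b: "right_basis F n vs W"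
  shows "right_dim F n W = length vs"
  unfolding right_dim_def
proof (rule the_equality)
  show "\<exists>us. right_basis F n us W \<and> length us = length vs" using b by blast
  fix m assume "\<exists>us. right_basis F n us W \<and> length us = m"
  then obtain us where us: "right_basis F n us W" "length us = m" by blast
  have "length ws' \<le> length ws" if "right_basis F n ws W" "right_basis F n ws' W" for ws ws'
  proof (rule right_indep_length_le[OF F])
    show "set ws \<subseteq> carrier_vec n" "right_indep F n ws'"
      using that by (simp_all add: right_basis_iff[OF F W] right_indep_def)
    show "\<exists>c\<in>carrier_vec (length ws). (\<forall>i<length ws. c $ i \<in> F) \<and> mat_of_cols n ws *\<^sub>v c = w"
      if "w \<in> set ws'" for w
      using that \<open>right_basis F n ws W\<close> \<open>right_basis F n ws' W\<close>
      by (meson right_basis_iff[OF F W] subset_iff)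
  qed
  then show "m = length vs" using us b by (metis antisym)
qed

text \<open>A longest independent list inside \<open>W\<close> exists because \<open>n\<close>
  bounds the length. Appending any \<open>w\<close> of \<open>W\<close> makes it dependent, and the
  relation can be solved for \<open>w\<close>.\<close>

lemma right_basis_exists:
  assumes W: "right_subspace UNIV n W"
  obtains vs where "right_basis UNIV n vs W" "length vs \<le> n" "right_dim UNIV n W = length vs"
proof -
  let ?P = "\<lambda>vs. right_indep UNIV n vs \<and> set vs \<subseteq> W"
  have "?P []" by (auto simp: right_indep_def)
  then obtain vs where vs: "?P vs" and max: "\<And>us. ?P us \<Longrightarrow> length us \<le> length vs"
    using ex_has_greatest_nat[of ?P "[]" length "Suc n"] right_indep_length_le_dim
    by (metis (no_types, lifting) less_Suc_eq_le)
  have vs': "set vs \<subseteq> carrier_vec n" using vs by (auto simp: right_indep_def)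
  have "\<exists>c\<in>carrier_vec (length vs). mat_of_cols n vs *\<^sub>v c = w" if w: "w \<in> W" for w
  proof -
    have wc: "w \<in> carrier_vec n" using w W by (auto simp: right_subspace_def)
    have "\<not> right_indep UNIV n (vs @ [w])"
      using max[of "vs @ [w]"] vs w by auto
    then obtain c where c: "c \<in> carrier_vec (Suc (length vs))" "mat_of_cols n (vs @ [w]) *\<^sub>v c = 0\<^sub>v n"
        "c \<noteq> 0\<^sub>v (Suc (length vs))"
      using vs' wc by (auto simp: right_indep_def)
    define c1 where "c1 = vec (length vs) (\<lambda>i. c $ i)"
    define a where "a = c $ length vs"
    have c1: "c1 \<in> carrier_vec (length vs)" by (simp add: c1_def)
    have eq: "mat_of_cols n vs *\<^sub>v c1 + right_smult_vec w a = 0\<^sub>v n"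
      using c mat_of_cols_snoc_mult[OF vs' wc c(1)] by (simp add: c1_def a_def)
    have "a \<noteq> 0"
    proof
      assume "a = 0"
      then have "mat_of_cols n vs *\<^sub>v c1 + 0\<^sub>v n = 0\<^sub>v n"
        using eq wc by (metis (no_types, lifting) carrier_vecD eq_vecI index_zero_vec(1,2) mult_zero_right
            right_smult_vec_dim right_smult_vec_index)
      then have "mat_of_cols n vs *\<^sub>v c1 = 0\<^sub>v n"
        by (subst (asm) right_zero_vec[of _ n]) simp_all
      then have "c1 = 0\<^sub>v (length vs)" using vs c1 by (auto simp: right_indep_def)
      then have "c $ i = 0" if "i < length vs" for i
        using that by (auto simp: c1_def dest: arg_cong[where f = "\<lambda>v. v $ i"])
      then have "c = 0\<^sub>v (Suc (length vs))"
        using c(1) \<open>a = 0\<close> unfolding a_def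
        by (intro eq_vecI) (auto simp: less_Suc_eq)
      with c(3) show False by simp
    qed
    \<comment> \<open>The relation is multiplied by \<open>- inverse a\<close> from the right, the
      side on which coefficients stand.\<close>
    have "mat_of_cols n vs *\<^sub>v right_smult_vec c1 (- inverse a) = w"
    proof (rule eq_vecI)
      fix i assume "i < dim_vec w"
      then have i: "i < n" using wc by simp
      have "(mat_of_cols n vs *\<^sub>v c1) $ i + w $ i * a = 0"
        using arg_cong[OF eq, of "\<lambda>v. v $ i"] i wc by simp
      then have "(mat_of_cols n vs *\<^sub>v c1) $ i = - (w $ i * a)" by (simp add: eq_neg_iff_add_eq_0)
      moreover have "(mat_of_cols n vs *\<^sub>v right_smult_vec c1 (- inverse a)) $ i =
          (mat_of_cols n vs *\<^sub>v c1) $ i * (- inverse a)"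
      proof -
        have "(mat_of_cols n vs *\<^sub>v right_smult_vec c1 b) $ i = (mat_of_cols n vs *\<^sub>v c1) $ i * b" for b
          using i c1 by (simp add: scalar_prod_def sum_distrib_right mult.assoc)
        then show ?thesis by blast
      qed
      ultimately show "(mat_of_cols n vs *\<^sub>v right_smult_vec c1 (- inverse a)) $ i = w $ i"
        using \<open>a \<noteq> 0\<close> by (simp add: mult.assoc)
    qed (use wc in auto)
    then show ?thesis using c1 by (intro bexI[of _ "right_smult_vec c1 (- inverse a)"]) auto
  qed
  then have b: "right_basis UNIV n vs W" using vs by (auto simp: right_basis_iff[OF _ W])
  show ?thesis
    using that[OF b] right_indep_length_le_dim[of n vs] right_dim_eq[OF division_subring_UNIV W b] vs
    by blast
qed


section \<open>The reduced norm\<close>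

definition zpart :: "quat \<Rightarrow> complex" where "zpart x = Complex (Rq x) (Iq x)"
definition wpart :: "quat \<Rightarrow> complex" where "wpart x = Complex (Jq x) (Kq x)"

text \<open>The two product rules are \<open>(z + w j) (z' + w' j)\<close> expanded by means of
  \<open>j z = (cnj z) j\<close>.\<close>

lemma zpart_wpart_simps [simp]:
  "zpart 0 = 0" "wpart 0 = 0" "zpart 1 = 1" "wpart 1 = 0"
  "zpart (x + y) = zpart x + zpart y" "wpart (x + y) = wpart x + wpart y"
  "zpart (x * y) = zpart x * zpart y - wpart x * cnj (wpart y)"
  "wpart (x * y) = zpart x * wpart y + wpart x * cnj (zpart y)"
  "zpart (qcnj x) = cnj (zpart x)" "wpart (qcnj x) = - wpart x"
  "zpart quat_j = 0" "wpart quat_j = 1" "zpart (- x) = - zpart x" "wpart (- x) = - wpart x"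
  by (simp_all add: zpart_def wpart_def quat_ops qcnj_def quat_j_def complex_eq_iff)

lemma zpart_wpart_sum: "zpart (sum f A) = (\<Sum>a\<in>A. zpart (f a))" "wpart (sum f A) = (\<Sum>a\<in>A. wpart (f a))"
  by (induction A rule: infinite_finite_induct) auto

lemma complexify_four_block:
  "complexify A = four_block_mat (map_mat zpart A) (map_mat wpart A)
     (map_mat (\<lambda>x. - cnj (wpart x)) A) (map_mat (\<lambda>x. cnj (zpart x)) A)"
  unfolding complexify_def Let_def zpart_def[abs_def] wpart_def[abs_def]
  by (intro arg_cong2[where f = "four_block_mat _ _"] eq_matI) auto

lemma complexify_carrier [simp]: "A \<in> carrier_mat n n \<Longrightarrow> complexify A \<in> carrier_mat (n + n) (n + n)"
  unfolding complexify_four_block by auto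

lemma complexify_mult:
  assumes A: "A \<in> carrier_mat n n" and B: "B \<in> carrier_mat n n"
  shows "complexify (A * B) = complexify A * complexify B"
proof -
  have *: "four_block_mat P Q R S = four_block_mat P' Q' R' S'"
    if "P = P'" "Q = Q'" "R = R'" "S = S'" for P Q R S P' Q' R' S' :: "complex mat"
    using that by simp
  show ?thesis
    unfolding complexify_four_block
    apply (subst mult_four_block_mat[of _ n n _ n _ n _ _ n _ n])
    subgoal using A by auto
    subgoal using A by auto
    subgoal using A by auto
    subgoal using A by auto
    subgoal using B by auto
    subgoal using B by auto
    subgoal using B by auto
    subgoal using B by auto
    using A B
    by (intro * eq_matI)
      (auto simp: scalar_prod_def zpart_wpart_sum sum.distrib[symmetric] sum_negf[symmetric]
        algebra_simps intro!: sum.cong)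
qed

lemma complexify_one: "complexify (1\<^sub>m n) = 1\<^sub>m (n + n)"
  unfolding complexify_four_block by (rule eq_matI) auto

lemma reduced_norm_mult:
  assumes "A \<in> carrier_mat n n" "B \<in> carrier_mat n n"
  shows "reduced_norm (A * B) = reduced_norm A * reduced_norm B"
  using assms unfolding reduced_norm_def
  by (metis complexify_mult complexify_carrier det_mult)

lemma reduced_norm_one [simp]: "reduced_norm (1\<^sub>m n) = 1"
  by (simp add: reduced_norm_def complexify_one)

section \<open>Behaviour under conjugation; the reduced norm is real\<close>

lemma det_map_cnj: "det (map_mat cnj A) = cnj (det A)"
proof -
  interpret comm_ring_hom cnj by standard auto
  show ?thesis by simp
qed

lemma mat_star_carrier [simp]: "A \<in> carrier_mat m n \<Longrightarrow> mat_star A \<in> carrier_mat n m"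
  by (simp add: mat_star_def)

text \<open>The embedding into complex matrices turns \<open>mat_star\<close> into the conjugate
  transpose.\<close>

lemma reduced_norm_mat_star:
  assumes "A \<in> carrier_mat n n"
  shows "reduced_norm (mat_star A) = cnj (reduced_norm A)"
proof -
  have "complexify (mat_star A) = transpose_mat (map_mat cnj (complexify A))"
    using assms unfolding complexify_four_block mat_star_def by (intro eq_matI) auto
  then show ?thesis
    using assms by (simp add: reduced_norm_def det_transpose[of _ "n + n"] det_map_cnj)
qed

text \<open>Entrywise conjugation of \<open>complexify A\<close> amounts to conjugating \<open>A\<close> by the scalar \<open>j\<close>.\<close>

lemma reduced_norm_real:
  assumes A: "A \<in> carrier_mat n n"
  shows "cnj (reduced_norm A) = reduced_norm A"
proof -
  let ?J = "quat_j \<cdot>\<^sub>m 1\<^sub>m n :: quat mat"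
  let ?J' = "(- quat_j) \<cdot>\<^sub>m 1\<^sub>m n :: quat mat"
  have jj: "quat_j * quat_j = - 1" by (simp add: quat_j_def quat_ops)
  have J: "?J \<in> carrier_mat n n" "?J' \<in> carrier_mat n n" by auto
  have JJ': "?J * ?J' = 1\<^sub>m n"
    by (rule eq_matI) (auto simp: scalar_prod_def if_distrib[of "\<lambda>x. _ * x"] if_distrib[of "\<lambda>x. x * _"] jj cong: if_cong)
  have entry: "(?J * A * ?J') $$ (i, j) = - (quat_j * A $$ (i, j) * quat_j)" if "i < n" "j < n" for i j
    using that A
    by (simp add: scalar_prod_def if_distrib[of "\<lambda>x. _ * x"] if_distrib[of "\<lambda>x. x * _"] cong: if_cong)
  have zw: "zpart (- (quat_j * x * quat_j)) = cnj (zpart x)" "wpart (- (quat_j * x * quat_j)) = cnj (wpart x)"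
    for x by (simp_all del: mult_minus_left mult_minus_right)
  have JA: "?J * A * ?J' \<in> carrier_mat n n" using A by auto
  have "complexify (?J * A * ?J') = map_mat cnj (complexify A)"
    using A JA unfolding complexify_four_block
    by (intro eq_matI) (auto simp del: index_mult_mat(1) simp: entry zw[simplified])
  then have "reduced_norm (?J * A * ?J') = cnj (reduced_norm A)"
    by (simp add: reduced_norm_def det_map_cnj)
  moreover have "reduced_norm (?J * A * ?J') = reduced_norm A * (reduced_norm ?J * reduced_norm ?J')"
    using reduced_norm_mult[OF mult_carrier_mat[OF J(1) A] J(2)] reduced_norm_mult[OF J(1) A]
    by (simp only: mult_ac)
  moreover have "reduced_norm ?J * reduced_norm ?J' = 1"
    using J by (metis JJ' reduced_norm_mult reduced_norm_one)
  ultimately show ?thesis by simp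
qed

section \<open>Elimination matrices and the sign of the reduced norm\<close>

definition column_mat :: "nat \<Rightarrow> nat \<Rightarrow> (nat \<Rightarrow> quat) \<Rightarrow> quat mat" where
  "column_mat n k u = mat n n (\<lambda>(i, j). if j = k then u i else if i = j then 1 else 0)"

lemma column_mat_carrier [simp]: "column_mat n k u \<in> carrier_mat n n"
  by (simp add: column_mat_def)

lemma column_mat_dim [simp]: "dim_row (column_mat n k u) = n" "dim_col (column_mat n k u) = n"
  by (simp_all add: column_mat_def)

lemma column_mat_mult_index:
  assumes "A \<in> carrier_mat n m" "i < n" "j < m" "k < n"
  shows "(column_mat n k u * A) $$ (i, j) = (if i = k then 0 else A $$ (i, j)) + u i * A $$ (k, j)"
proof -
  have "(column_mat n k u * A) $$ (i, j) =
      (\<Sum>l = 0..<n. (if l = k then u i else if i = l then 1 else 0) * A $$ (l, j))"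
    using assms by (auto simp: scalar_prod_def column_mat_def intro!: sum.cong)
  also have "\<dots> = u i * A $$ (k, j) +
      (\<Sum>l \<in> {0..<n} - {k}. (if l = k then u i else if i = l then 1 else 0) * A $$ (l, j))"
    using assms by (subst sum.remove[of _ k]) auto
  also have "(\<Sum>l \<in> {0..<n} - {k}. (if l = k then u i else if i = l then 1 else 0) * A $$ (l, j)) =
      (\<Sum>l \<in> {0..<n} - {k}. if l = i then A $$ (i, j) else 0)"
    by (intro sum.cong) auto
  also have "\<dots> = (if i = k then 0 else A $$ (i, j))"
    using assms by (simp add: sum.delta)
  finally show ?thesis by simp
qed

lemma mult_column_mat_index:
  assumes "A \<in> carrier_mat m n" "i < m" "j < n" "k < n"
  shows "(A * column_mat n k u) $$ (i, j) = (if j = k then \<Sum>l<n. A $$ (i, l) * u l else A $$ (i, j))"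
proof -
  have "(A * column_mat n k u) $$ (i, j) =
      (\<Sum>l<n. A $$ (i, l) * (if j = k then u l else if l = j then 1 else 0))"
    using assms by (auto simp: scalar_prod_def column_mat_def atLeast0LessThan intro!: sum.cong)
  also have "\<dots> = (if j = k then \<Sum>l<n. A $$ (i, l) * u l else A $$ (i, j))"
    using assms by (auto simp: if_distrib[of "\<lambda>x. _ * x"] cong: if_cong)
  finally show ?thesis .
qed

text \<open>Squaring \<open>column_mat n k v\<close> changes only column \<open>k\<close>: the
  diagonal entry becomes \<open>v k * v k\<close>, every other one \<open>v i + v i * v k\<close>.
  With \<open>v k = s\<close> a root of \<open>u k\<close> other than \<open>- 1\<close>, the
  equations \<open>v i * (1 + s) = u i\<close> are solvable. The entry \<open>u k\<close> may be 0,
  so singular matrices are within reach.\<close>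

lemma column_mat_square:
  assumes "k < n"
  shows "\<exists>S\<in>carrier_mat n n. column_mat n k u = S * S"
proof -
  obtain s where s: "s * s = u k" "s \<noteq> - 1" using quat_square_root by blast
  then have s1: "1 + s \<noteq> 0" by (metis add_eq_0_iff minus_unique)
  define v where "v = (\<lambda>i. if i = k then s else u i * inverse (1 + s))"
  have v: "v i + v i * s = u i" if "i \<noteq> k" for i
  proof -
    have "v i + v i * s = u i * (inverse (1 + s) * (1 + s))"
      using that by (simp add: v_def distrib_left mult.assoc)
    then show ?thesis using s1 by simp
  qed
  have "column_mat n k v * column_mat n k v = column_mat n k u"
  proof (rule eq_matI)
    fix i j assume "i < dim_row (column_mat n k u)" "j < dim_col (column_mat n k u)"
    then have ij: "i < n" "j < n" by (simp_all add: column_mat_def)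
    show "(column_mat n k v * column_mat n k v) $$ (i, j) = column_mat n k u $$ (i, j)"
      using ij assms v[of i] s
      by (subst column_mat_mult_index[OF column_mat_carrier]) (auto simp: column_mat_def v_def)
  qed auto
  then show ?thesis by (metis column_mat_carrier)
qed

lemma reduced_norm_column_mat_nonneg:
  assumes "k < n"
  shows "Re (reduced_norm (column_mat n k u)) \<ge> 0"
proof -
  obtain S where S: "S \<in> carrier_mat n n" "column_mat n k u = S * S"
    using column_mat_square[OF assms] by blast
  have "Im (reduced_norm S) = 0"
    using reduced_norm_real[OF S(1)] by (simp add: complex_eq_iff)
  then show ?thesis using S by (simp add: reduced_norm_mult)
qed

lemma reduced_norm_nonneg_mult:
  assumes "A \<in> carrier_mat n n" "B \<in> carrier_mat n n"
    "Re (reduced_norm A) \<ge> 0" "Re (reduced_norm B) \<ge> 0"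
  shows "Re (reduced_norm (A * B)) \<ge> 0"
proof -
  have "Im (reduced_norm A) = 0"
    using reduced_norm_real[OF assms(1)] by (simp add: complex_eq_iff)
  then show ?thesis using assms by (simp add: reduced_norm_mult)
qed

text \<open>The conditions on \<open>u\<close> and \<open>u'\<close> say that column
  \<open>k\<close> of the product of the two column matrices is a unit vector. The conclusion writes
  \<open>A\<close> as a column matrix times the result of row operations on
  \<open>A\<close>.\<close>

lemma column_mat_inverse:
  assumes A: "A \<in> carrier_mat n n" and k: "k < n" and u: "u k * u' k = 1"
    "\<And>i. i < n \<Longrightarrow> i \<noteq> k \<Longrightarrow> u' i + u i * u' k = 0"
  shows "column_mat n k u * (column_mat n k u' * A) = A"
proof -
  have "column_mat n k u * column_mat n k u' = 1\<^sub>m n"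
  proof (rule eq_matI)
    fix i j assume "i < dim_row (1\<^sub>m n :: quat mat)" "j < dim_col (1\<^sub>m n :: quat mat)"
    then have ij: "i < n" "j < n" by simp_all
    show "(column_mat n k u * column_mat n k u') $$ (i, j) = (1\<^sub>m n) $$ (i, j)"
      using ij k u(1) u(2)[of i]
      by (subst column_mat_mult_index[OF column_mat_carrier]) (auto simp: column_mat_def)
  qed auto
  then show ?thesis using A by (subst assoc_mult_mat[symmetric, of _ n n _ n _ n]) auto
qed

text \<open>Gaussian elimination: column by column, a matrix is a product of matrices \<open>column_mat n k u\<close>,
  each of which is a square.\<close>

lemma reduced_norm_nonneg:
  assumes "A \<in> carrier_mat n n"
  shows "Re (reduced_norm A) \<ge> 0"
proof -
  \<comment> \<open>Induction on the number \<open>m\<close> of columns, counted from the right,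
    that need not yet agree with the identity matrix.\<close>
  have "Re (reduced_norm A) \<ge> 0"
    if "A \<in> carrier_mat n n" "m \<le> n" "\<And>i j. i < n \<Longrightarrow> j < n - m \<Longrightarrow> A $$ (i, j) = (if i = j then 1 else 0)"
    for A m
    using that
  proof (induction m arbitrary: A)
    case 0
    then have "A = 1\<^sub>m n" by (intro eq_matI) auto
    then show ?case by simp
  next
    case (Suc m)
    define k where "k = n - Suc m"
    have k: "k < n" "n - m = Suc k" using Suc.prems(2) by (auto simp: k_def)
    note A = Suc.prems(1)
    have idc: "A $$ (i, j) = (if i = j then 1 else 0)" if "i < n" "j < k" for i j
      using Suc.prems(3) that by (simp add: k_def)
    have IH: "Re (reduced_norm B) \<ge> 0"
      if "B \<in> carrier_mat n n" "\<And>i j. i < n \<Longrightarrow> j < Suc k \<Longrightarrow> B $$ (i, j) = (if i = j then 1 else 0)" for B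
      using Suc.IH[of B] that Suc.prems(2) k(2) by simp
    have pivot: "Re (reduced_norm B) \<ge> 0"
      if B: "B \<in> carrier_mat n n" "\<And>i j. i < n \<Longrightarrow> j < k \<Longrightarrow> B $$ (i, j) = (if i = j then 1 else 0)"
        and nz: "B $$ (k, k) \<noteq> 0" for B
    proof -
      \<comment> \<open>Multiplication by the column matrix of \<open>?u'\<close> turns the pivot
        into 1 and clears the rest of column \<open>k\<close>; that of \<open>?u\<close> undoes
        it.\<close>
      let ?b = "inverse (B $$ (k, k))"
      let ?u = "\<lambda>i. B $$ (i, k)" and ?u' = "\<lambda>i. if i = k then ?b else - (B $$ (i, k) * ?b)"
      have "B = column_mat n k ?u * (column_mat n k ?u' * B)"
        using k nz by (intro column_mat_inverse[symmetric] B) auto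
      moreover have "Re (reduced_norm (column_mat n k ?u' * B)) \<ge> 0"
      proof (rule IH)
        show "column_mat n k ?u' * B \<in> carrier_mat n n" using B by (intro mult_carrier_mat) auto
        show "(column_mat n k ?u' * B) $$ (i, j) = (if i = j then 1 else 0)"
          if "i < n" "j < Suc k" for i j
          using that k nz B(2)
          by (subst column_mat_mult_index[OF B(1)]) (auto simp: less_Suc_eq mult.assoc)
      qed
      ultimately show ?thesis
        using reduced_norm_nonneg_mult[of "column_mat n k ?u" n "column_mat n k ?u' * B"]
          reduced_norm_column_mat_nonneg[OF k(1)] B mult_carrier_mat[of "column_mat n k ?u'" n n B n]
        by (metis column_mat_carrier)
    qed
    show ?case
    proof (cases "\<exists>i<n. i > k \<and> A $$ (i, k) \<noteq> 0")
      case True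
      then obtain l where l: "l < n" "l > k" "A $$ (l, k) \<noteq> 0" by blast
      show ?thesis
      proof (cases "A $$ (k, k) = 0")
        case True
        \<comment> \<open>The column matrix of \<open>?u\<close> adds row \<open>l\<close> to row
          \<open>k\<close>, which makes the pivot nonzero; that of \<open>?u'\<close> subtracts it
          again.\<close>
        let ?u = "\<lambda>i. if i = l then 1 else if i = k then 1 else 0 :: quat"
        let ?u' = "\<lambda>i. if i = l then 1 else if i = k then - 1 else 0 :: quat"
        have "A = column_mat n l ?u' * (column_mat n l ?u * A)"
          using k l by (intro column_mat_inverse[symmetric] A) auto
        moreover have "Re (reduced_norm (column_mat n l ?u * A)) \<ge> 0"
        proof (rule pivot)
          show "column_mat n l ?u * A \<in> carrier_mat n n" using A by (intro mult_carrier_mat) auto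
          show "(column_mat n l ?u * A) $$ (i, j) = (if i = j then 1 else 0)"
            if "i < n" "j < k" for i j
            using that k l idc by (subst column_mat_mult_index[OF A]) auto
          show "(column_mat n l ?u * A) $$ (k, k) \<noteq> 0"
            using k l True by (subst column_mat_mult_index[OF A]) auto
        qed
        ultimately show ?thesis
          using reduced_norm_nonneg_mult[of "column_mat n l ?u'" n "column_mat n l ?u * A"]
            reduced_norm_column_mat_nonneg[OF l(1)] A mult_carrier_mat[of "column_mat n l ?u" n n A n]
          by (metis column_mat_carrier)
      qed (use pivot A idc in blast)
    next
      case False
      \<comment> \<open>Column \<open>k\<close> vanishes below the diagonal and is split off on the
        right: the first columns of \<open>B\<close> are unit vectors, so \<open>B\<close> maps the
        column \<open>c\<close> to itself. Nothing is inverted here, so the diagonal entry may be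
        0.\<close>
      define B where "B = mat n n (\<lambda>(i, j). if j = k then (if i = k then 1 else 0) else A $$ (i, j))"
      define c where "c = (\<lambda>i. if i \<le> k then A $$ (i, k) else 0)"
      have B: "B \<in> carrier_mat n n" by (simp add: B_def)
      have B': "B $$ (i, j) = (if i = j then 1 else 0)" if "i < n" "j < Suc k" for i j
        using that k idc by (auto simp: B_def less_Suc_eq)
      have "A = B * column_mat n k c"
      proof (rule eq_matI)
        fix i j assume "i < dim_row (B * column_mat n k c)" "j < dim_col (B * column_mat n k c)"
        then have ij: "i < n" "j < n" using B by (auto simp: column_mat_def)
        have "(\<Sum>l<n. B $$ (i, l) * c l) = (\<Sum>l<n. if l = i then c l else 0)"
          using ij B' by (intro sum.cong) (auto simp: c_def)
        also have "\<dots> = A $$ (i, k)" using ij False by (auto simp: c_def)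
        finally show "A $$ (i, j) = (B * column_mat n k c) $$ (i, j)"
          using ij k by (subst mult_column_mat_index[OF B]) (auto simp: B_def)
      qed (use A B in \<open>auto simp: column_mat_def\<close>)
      then show ?thesis
        using reduced_norm_nonneg_mult[OF B _ IH[OF B B'] reduced_norm_column_mat_nonneg[OF k(1)]]
        by (metis column_mat_carrier)
    qed
  qed
  from this[of A n] show ?thesis using assms by simp
qed

text \<open>Reduced norms turn the invariance equation into
  \<open>reduced_norm g * reduced_norm g = 1\<close>, since the conjugate of a real number is that
  number; nonnegativity excludes \<open>- 1\<close>. Hence the determinant condition in
  \<open>Sp\<close> and \<open>SO_star\<close> follows from invariance of the form.\<close>

lemma reduced_norm_isometry:
  assumes g: "g \<in> carrier_mat n n" and S: "S \<in> carrier_mat n n" and T: "T \<in> carrier_mat n n" "S * T = 1\<^sub>m n"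
    and eq: "mat_star g * S * g = S"
  shows "reduced_norm g = 1"
proof -
  have nz: "reduced_norm S \<noteq> 0"
    using reduced_norm_mult[OF S T(1)] T(2) by auto
  have "reduced_norm (mat_star g * S * g) = reduced_norm (mat_star g) * reduced_norm S * reduced_norm g"
    using reduced_norm_mult[OF mult_carrier_mat[OF mat_star_carrier[OF g] S] g]
      reduced_norm_mult[OF mat_star_carrier[OF g] S] by simp
  then have "(reduced_norm g * reduced_norm g - 1) * reduced_norm S = 0"
    unfolding eq using g by (simp add: reduced_norm_mat_star reduced_norm_real algebra_simps)
  then have "reduced_norm g = 1 \<or> reduced_norm g = - 1"
    using nz by (metis mult_eq_0_iff right_minus_eq square_eq_1_iff)
  then show ?thesis using reduced_norm_nonneg[OF g] by auto
qed


section \<open>Representations of the Lie algebra sl2\<close>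

locale sl2_rep =
  fixes x h y :: "'v :: real_vector \<Rightarrow> 'v"
  assumes linear_x: "linear x" and linear_h: "linear h" and linear_y: "linear y"
    and hx: "h (x v) = x (h v) + 2 *\<^sub>R x v"
    and hy: "h (y v) = y (h v) - 2 *\<^sub>R y v"
    and xy: "x (y v) = y (x v) + h v"
begin

lemmas lin [simp] =
  linear_0[OF linear_x] linear_0[OF linear_h] linear_0[OF linear_y]
  linear_add[OF linear_x] linear_add[OF linear_h] linear_add[OF linear_y]
  linear_diff[OF linear_x] linear_diff[OF linear_h] linear_diff[OF linear_y]
  linear_scale[OF linear_x] linear_scale[OF linear_h] linear_scale[OF linear_y]

lemma linear_funpow: "linear f \<Longrightarrow> linear (f ^^ k)" for f :: "'v \<Rightarrow> 'v"
proof (induction k)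
  case 0
  then show ?case using linear_id by (simp add: id_def)
next
  case (Suc k)
  then show ?case using linear_compose[of "f ^^ k" f] by (simp add: o_def)
qed

lemmas lin_pow [simp] =
  linear_0[OF linear_funpow[OF linear_x]] linear_0[OF linear_funpow[OF linear_y]]
  linear_add[OF linear_funpow[OF linear_x]] linear_add[OF linear_funpow[OF linear_y]]
  linear_diff[OF linear_funpow[OF linear_x]] linear_diff[OF linear_funpow[OF linear_y]]
  linear_scale[OF linear_funpow[OF linear_x]] linear_scale[OF linear_funpow[OF linear_y]]

section \<open>Commutation with powers, and strings of lowest weight vectors\<close>

lemma h_x_pow: "h ((x ^^ k) v) = (x ^^ k) (h v) + (2 * real k) *\<^sub>R (x ^^ k) v"
  by (induction k) (simp_all add: hx algebra_simps scaleR_2)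

lemma h_y_pow: "h ((y ^^ k) v) = (y ^^ k) (h v) - (2 * real k) *\<^sub>R (y ^^ k) v"
proof (induction k)
  case (Suc k)
  have "h ((y ^^ Suc k) v) = y (h ((y ^^ k) v)) - 2 *\<^sub>R y ((y ^^ k) v)" by (simp add: hy)
  also have "\<dots> = (y ^^ Suc k) (h v) - (2 * real k) *\<^sub>R (y ^^ Suc k) v - 2 *\<^sub>R (y ^^ Suc k) v"
    unfolding Suc by simp
  finally show ?case by (simp add: algebra_simps)
qed simp

definition lowest_weight :: "nat \<Rightarrow> 'v \<Rightarrow> bool" where
  "lowest_weight d v \<longleftrightarrow> y v = 0 \<and> h v = (1 - real d) *\<^sub>R v"

lemma lowest_weight_h:
  assumes "lowest_weight d v"
  shows "h ((x ^^ k) v) = (2 * real k + 1 - real d) *\<^sub>R (x ^^ k) v"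
proof -
  have "h ((x ^^ k) v) = ((1 - real d) + 2 * real k) *\<^sub>R (x ^^ k) v"
    using assms by (simp add: lowest_weight_def h_x_pow scaleR_add_left)
  then show ?thesis by (simp add: algebra_simps)
qed

text \<open>Commuting \<open>y\<close> past each \<open>x\<close> subtracts one value of
  \<open>h\<close>, so the coefficient is minus the sum of the weights \<open>2 * i + 1 - d\<close>
  for \<open>i \<le> k\<close>. It vanishes exactly when \<open>Suc k = d\<close>.\<close>

lemma lowest_weight_y:
  assumes "lowest_weight d v"
  shows "y ((x ^^ Suc k) v) = (real (Suc k) * (real d - real (Suc k))) *\<^sub>R (x ^^ k) v"
proof (induction k)
  case 0
  have "y (x v) = x (y v) - h v" by (simp add: xy)
  then have "y (x v) = 0 - (1 - real d) *\<^sub>R v" using assms by (simp add: lowest_weight_def)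
  then show ?case by (simp add: algebra_simps)
next
  case (Suc k)
  have "y ((x ^^ Suc (Suc k)) v) = x (y ((x ^^ Suc k) v)) - h ((x ^^ Suc k) v)"
    by (simp add: xy)
  also have "\<dots> = (real (Suc k) * (real d - real (Suc k)) - (2 * real (Suc k) + 1 - real d)) *\<^sub>R (x ^^ Suc k) v"
    unfolding Suc lowest_weight_h[OF assms] by (simp add: scaleR_left_diff_distrib)
  also have "real (Suc k) * (real d - real (Suc k)) - (2 * real (Suc k) + 1 - real d) =
      real (Suc (Suc k)) * (real d - real (Suc (Suc k)))"
    by (simp add: algebra_simps)
  finally show ?case .
qed

text \<open>The steps contribute factors \<open>j * (d - j)\<close> with \<open>0 < j < d\<close>,
  none of them 0. So \<open>y^k\<close> inverts \<open>x^k\<close> on the vector up to a nonzero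
  factor.\<close>

lemma lowest_weight_y_pow:
  assumes "lowest_weight d v" "k < d"
  shows "\<exists>c. c \<noteq> 0 \<and> (y ^^ k) ((x ^^ k) v) = c *\<^sub>R v"
  using assms(2)
proof (induction k)
  case 0
  then show ?case by (intro exI[of _ 1]) simp
next
  case (Suc k)
  then obtain c where c: "c \<noteq> 0" "(y ^^ k) ((x ^^ k) v) = c *\<^sub>R v" by auto
  have "(y ^^ Suc k) ((x ^^ Suc k) v) = (y ^^ k) (y ((x ^^ Suc k) v))"
    by (simp only: funpow_Suc_right o_apply)
  also have "\<dots> = (real (Suc k) * (real d - real (Suc k)) * c) *\<^sub>R v"
    unfolding lowest_weight_y[OF assms(1)] using c by simp
  finally show ?case using c(1) Suc.prems
    by (intro exI[of _ "real (Suc k) * (real d - real (Suc k)) * c"]) auto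
qed

lemma lowest_weight_y_pow_less:
  assumes "lowest_weight d v" "l < k" "l < d"
  shows "(y ^^ k) ((x ^^ l) v) = 0"
proof -
  obtain c where "(y ^^ l) ((x ^^ l) v) = c *\<^sub>R v" using lowest_weight_y_pow[OF assms(1,3)] by blast
  then have "(y ^^ Suc l) ((x ^^ l) v) = 0" using assms(1) by (simp add: lowest_weight_def)
  moreover have "(y ^^ k) w = (y ^^ (k - Suc l)) ((y ^^ Suc l) w)" for w
  proof -
    have "y ^^ k = (y ^^ (k - Suc l)) \<circ> (y ^^ Suc l)"
      using assms(2) by (simp only: funpow_add[symmetric] le_add_diff_inverse2 Suc_leI)
    then show ?thesis by (simp only: o_apply)
  qed
  ultimately show ?thesis by simp
qed

section \<open>The kernel of y, filtered by the images of the powers of y\<close>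

lemma x_y_pow:
  "x ((y ^^ Suc k) v) = (y ^^ Suc k) (x v) + real (Suc k) *\<^sub>R (h ((y ^^ k) v) + real k *\<^sub>R (y ^^ k) v)"
proof (induction k arbitrary: v)
  case 0
  show ?case by (simp add: xy)
next
  case (Suc k)
  have "x ((y ^^ Suc (Suc k)) v) = x ((y ^^ Suc k) (y v))"
    by (simp only: funpow_Suc_right[of "Suc k"] o_apply)
  also have "\<dots> = (y ^^ Suc k) (x (y v)) +
      real (Suc k) *\<^sub>R (h ((y ^^ k) (y v)) + real k *\<^sub>R (y ^^ k) (y v))"
    by (rule Suc)
  also have "(y ^^ k) (y v) = (y ^^ Suc k) v" by (simp add: funpow_swap1)
  also have "(y ^^ Suc k) (x (y v)) = (y ^^ Suc k) (y (x v)) + (y ^^ Suc k) (h v)"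
    by (simp only: xy lin_pow)
  also have "(y ^^ Suc k) (y (x v)) = (y ^^ Suc (Suc k)) (x v)"
    by (simp only: funpow_Suc_right[of "Suc k"] o_apply)
  also have "(y ^^ Suc k) (h v) = h ((y ^^ Suc k) v) + (2 * real (Suc k)) *\<^sub>R (y ^^ Suc k) v"
    by (simp only: h_y_pow diff_add_cancel)
  finally show ?case by (simp add: algebra_simps scaleR_2 del: funpow.simps)
qed

text \<open>This decreasing filtration replaces the weight decomposition as long as \<open>h\<close>
  is not known to be diagonalizable.\<close>

definition ker_im :: "nat \<Rightarrow> 'v set" where
  "ker_im k = {w. y w = 0 \<and> w \<in> range (y ^^ k)}"

text \<open>For \<open>w = y^k v\<close> with \<open>y w = 0\<close> the left side of
  \<open>x_y_pow\<close> vanishes, which exhibits \<open>h w + k w\<close> as an image under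
  \<open>y^(k+1)\<close>. Thus \<open>h\<close> acts as \<open>- k\<close> modulo the next level;
  this is the origin of the integral weights.\<close>

lemma ker_im_step:
  assumes "w \<in> ker_im k"
  shows "h w + real k *\<^sub>R w \<in> ker_im (Suc k)"
proof -
  obtain v where v: "w = (y ^^ k) v" "y w = 0" using assms by (auto simp: ker_im_def)
  have "x ((y ^^ Suc k) v) = 0" using v by simp
  then have "real (Suc k) *\<^sub>R (h w + real k *\<^sub>R w) = - (y ^^ Suc k) (x v)"
    unfolding x_y_pow v(1) by (metis add_eq_0_iff)
  then have "real (Suc k) *\<^sub>R (h w + real k *\<^sub>R w) = (y ^^ Suc k) (- x v)"
    by (simp only: linear_neg[OF linear_funpow[OF linear_y]])
  then have "(1 / real (Suc k)) *\<^sub>R real (Suc k) *\<^sub>R (h w + real k *\<^sub>R w) =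
      (y ^^ Suc k) ((1 / real (Suc k)) *\<^sub>R (- x v))"
    by (simp only: lin_pow)
  then have "h w + real k *\<^sub>R w = (y ^^ Suc k) ((1 / real (Suc k)) *\<^sub>R (- x v))"
    by (simp del: funpow.simps of_nat_Suc)
  moreover have "y (h w + real k *\<^sub>R w) = 0" using hy[of w] v(2) by simp
  ultimately show ?thesis
    unfolding ker_im_def mem_Collect_eq using v(2) by (intro conjI range_eqI) simp_all
qed

end

text \<open>Nilpotency of \<open>x\<close> and \<open>y\<close> stands in for finite dimension: the
  matrices will act on the space of all sequences, which is infinite-dimensional.\<close>

locale sl2_rep_nilpotent = sl2_rep x h y for x h y :: "'v :: real_vector \<Rightarrow> 'v" +
  assumes nil_x: "\<exists>N. \<forall>v. (x ^^ N) v = 0" and nil_y: "\<exists>N. \<forall>v. (y ^^ N) v = 0"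
begin

lemma nil_y_ge: "\<exists>N. \<forall>k\<ge>N. \<forall>v. (y ^^ k) v = 0"
proof -
  obtain N where N: "\<forall>v. (y ^^ N) v = 0" using nil_y by blast
  have "(y ^^ k) v = 0" if "k \<ge> N" for k v
  proof -
    have "y ^^ k = (y ^^ (k - N)) \<circ> (y ^^ N)"
      using that by (simp only: funpow_add[symmetric] le_add_diff_inverse2)
    then show ?thesis using N by simp
  qed
  then show ?thesis by blast
qed

text \<open>At the first power \<open>m\<close> with \<open>x^m v = 0\<close>, applying
  \<open>y\<close> shows that the coefficient \<open>m * (d - m)\<close> is 0, so
  \<open>m = d\<close>.\<close>

lemma lowest_weight_x_pow:
  assumes "lowest_weight d v" "v \<noteq> 0"
  shows "d > 0" "(x ^^ d) v = 0" "l < d \<Longrightarrow> (x ^^ l) v \<noteq> 0"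
proof -
  define m where "m = (LEAST m. (x ^^ m) v = 0)"
  have m: "(x ^^ m) v = 0" unfolding m_def using nil_x by (metis (mono_tags) LeastI)
  have less: "(x ^^ l) v \<noteq> 0" if "l < m" for l using that not_less_Least unfolding m_def by blast
  obtain k where k: "m = Suc k" using m assms(2) by (cases m) auto
  have "(real (Suc k) * (real d - real (Suc k))) *\<^sub>R (x ^^ k) v = 0"
    using lowest_weight_y[OF assms(1), of k] m unfolding k by (simp del: funpow.simps)
  then have "d = m" using less[of k] k by auto
  with m less k show "d > 0" "(x ^^ d) v = 0" "l < d \<Longrightarrow> (x ^^ l) v \<noteq> 0" by auto
qed

lemma lowest_weight_x_pow_eq_0:
  assumes "lowest_weight d v" "k \<ge> d"
  shows "(x ^^ k) v = 0"
proof (cases "v = 0")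
  case False
  have "x ^^ k = (x ^^ (k - d)) \<circ> (x ^^ d)"
    using assms(2) by (simp only: funpow_add[symmetric] le_add_diff_inverse2)
  then show ?thesis using lowest_weight_x_pow(2)[OF assms(1) False] by simp
qed simp

lemma lowest_weight_x_pow_inj:
  assumes "lowest_weight d v" "(x ^^ l) v = 0" "l < d"
  shows "v = 0"
  using assms lowest_weight_x_pow(3) by blast

text \<open>For \<open>w\<close> on level \<open>k\<close>, the vector \<open>h w + k w\<close> lies
  on the next level, hence by induction in a span of vectors with \<open>h = - i\<close>,
  \<open>i > k\<close>, on which \<open>h + k\<close> is invertible. Subtracting a solution
  \<open>u\<close> of \<open>h u + k u = h w + k w\<close> leaves weight exactly \<open>- k\<close>.
  The induction descends from a level where the power of \<open>y\<close> is 0.\<close>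

lemma ker_im_subset_span:
  "ker_im k \<subseteq> span {w. \<exists>i\<ge>k. lowest_weight (Suc i) w}"
proof -
  obtain N where y_pow_eq_0: "\<And>k v. k \<ge> N \<Longrightarrow> (y ^^ k) v = 0" using nil_y_ge by blast
  show ?thesis
  proof (induction "N - k" arbitrary: k)
    case 0
    then have "(y ^^ k) v = 0" for v by (intro y_pow_eq_0) simp
    then show ?case by (auto simp: ker_im_def span_zero)
  next
    case (Suc n)
    then have "n = N - Suc k" by simp
    then have IH: "ker_im (Suc k) \<subseteq> span {w. \<exists>i\<ge>Suc k. lowest_weight (Suc i) w}"
      by (rule Suc.hyps(1))
    have solve: "\<exists>u \<in> span {w. \<exists>i\<ge>Suc k. lowest_weight (Suc i) w}. y u = 0 \<and> h u + real k *\<^sub>R u = w"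
      if "w \<in> span {w. \<exists>i\<ge>Suc k. lowest_weight (Suc i) w}" for w
      using that
    proof (induction rule: span_induct_alt)
      case base
      show ?case by (intro bexI[of _ 0]) (auto simp: span_zero)
    next
      case (step c a b)
      then obtain i where i: "i \<ge> Suc k" "lowest_weight (Suc i) a" by blast
      obtain u where u: "u \<in> span {w. \<exists>i\<ge>Suc k. lowest_weight (Suc i) w}" "y u = 0" "h u + real k *\<^sub>R u = b"
        using step by blast
      \<comment> \<open>The denominator is the eigenvalue of \<open>h + k\<close> on
        \<open>a\<close>, nonzero because \<open>i > k\<close>.\<close>
      define e where "e = c / (real k - real i)"
      have ha: "h a + real k *\<^sub>R a = (real k - real i) *\<^sub>R a"
        using i(2) by (simp add: lowest_weight_def algebra_simps)
      have "e *\<^sub>R (h a + real k *\<^sub>R a) = c *\<^sub>R a"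
        unfolding ha e_def using i(1) by simp
      then have "h (e *\<^sub>R a + u) + real k *\<^sub>R (e *\<^sub>R a + u) = c *\<^sub>R a + b"
        using u(3) by (simp add: algebra_simps)
      moreover have "y (e *\<^sub>R a + u) = 0" using u i(2) by (simp add: lowest_weight_def)
      moreover have "e *\<^sub>R a + u \<in> span {w. \<exists>i\<ge>Suc k. lowest_weight (Suc i) w}"
        using u i by (intro span_add span_scale) (auto intro: span_base)
      ultimately show ?case by blast
    qed
    show ?case
    proof
      fix w assume w: "w \<in> ker_im k"
      obtain u where u: "u \<in> span {w. \<exists>i\<ge>Suc k. lowest_weight (Suc i) w}" "y u = 0"
          "h u + real k *\<^sub>R u = h w + real k *\<^sub>R w"
        using solve[OF subsetD[OF IH ker_im_step[OF w]]] by blast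
      have "h (w - u) = - (real k *\<^sub>R (w - u))"
        using u(3) by (simp add: algebra_simps)
      then have "lowest_weight (Suc k) (w - u)"
        using w u(2) by (simp add: ker_im_def lowest_weight_def)
      then have "w - u \<in> span {w. \<exists>i\<ge>k. lowest_weight (Suc i) w}" by (auto intro: span_base)
      moreover have "{w. \<exists>i\<ge>Suc k. lowest_weight (Suc i) w} \<subseteq> {w. \<exists>i\<ge>k. lowest_weight (Suc i) w}"
        using Suc_leD by blast
      then have "u \<in> span {w. \<exists>i\<ge>k. lowest_weight (Suc i) w}"
        using u(1) span_mono by blast
      ultimately show "w \<in> span {w. \<exists>i\<ge>k. lowest_weight (Suc i) w}"
        using span_add[of "w - u" _ u] by simp
    qed
  qed
qed

text \<open>The part of complete reducibility that is used. If \<open>y^(k+1) v = 0\<close>, then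
  \<open>y^k v\<close> is a combination of lowest weight vectors \<open>a\<close> of index above
  \<open>k\<close>. Each of them is \<open>y^k (x^k a)\<close> up to a nonzero factor, so
  subtracting elements of strings makes \<open>v\<close> vanish under \<open>y^k\<close>
  already.\<close>

lemma span_lowest_weight: "v \<in> span {(x ^^ l) u | l u d. lowest_weight d u}"
proof -
  let ?S = "span {(x ^^ l) u | l u d. lowest_weight d u}"
  have "v \<in> ?S" if "(y ^^ k) v = 0" for k v
    using that
  proof (induction k arbitrary: v)
    case 0
    then show ?case by (simp add: span_zero)
  next
    case (Suc k)
    have lift: "\<exists>u\<in>?S. (y ^^ k) u = w" if "w \<in> span {w. \<exists>i\<ge>k. lowest_weight (Suc i) w}" for w
      using that
    proof (induction rule: span_induct_alt)
      case base
      show ?case by (intro bexI[of _ 0]) (auto simp: span_zero)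
    next
      case (step c a b)
      then obtain i u where i: "i \<ge> k" "lowest_weight (Suc i) a" and u: "u \<in> ?S" "(y ^^ k) u = b" by blast
      obtain e where e: "e \<noteq> 0" "(y ^^ k) ((x ^^ k) a) = e *\<^sub>R a"
        using lowest_weight_y_pow[OF i(2) le_imp_less_Suc[OF i(1)]] by blast
      have "(c / e) *\<^sub>R (x ^^ k) a + u \<in> ?S"
        using i(2) u(1) by (intro span_add span_scale) (auto intro: span_base)
      moreover have "(y ^^ k) ((c / e) *\<^sub>R (x ^^ k) a + u) = c *\<^sub>R a + b"
        using e u(2) by simp
      ultimately show ?case by blast
    qed
    have "(y ^^ k) v \<in> ker_im k" using Suc.prems by (simp add: ker_im_def)
    then obtain u where u: "u \<in> ?S" "(y ^^ k) u = (y ^^ k) v"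
      using lift ker_im_subset_span by blast
    then have "v - u \<in> ?S" using Suc.IH by simp
    then show ?case using u(1) span_add[of "v - u" _ u] by simp
  qed
  then show ?thesis using nil_y by blast
qed

section \<open>Submodules and strings\<close>

definition invariant :: "'v set \<Rightarrow> bool" where
  "invariant W \<longleftrightarrow> subspace W \<and> (\<forall>w\<in>W. x w \<in> W \<and> h w \<in> W \<and> y w \<in> W)"

lemma invariant_y_pow: "invariant W \<Longrightarrow> w \<in> W \<Longrightarrow> (y ^^ k) w \<in> W"
  and invariant_x_pow: "invariant W \<Longrightarrow> w \<in> W \<Longrightarrow> (x ^^ k) w \<in> W"
  by (induction k) (auto simp: invariant_def)

text \<open>From a nonzero vector of \<open>W\<close> in the kernel of \<open>y\<close>, the
  operators \<open>h + k\<close> climb the filtration without leaving \<open>W\<close>. The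
  filtration ends in 0, so some step yields 0, and the last nonzero vector is a lowest weight
  vector.\<close>

lemma invariant_lowest_weight:
  assumes W: "invariant W" "w \<in> W" "w \<noteq> 0"
  obtains d v where "v \<in> W" "v \<noteq> 0" "lowest_weight d v"
proof -
  obtain N where y_pow_eq_0: "\<And>k v. k \<ge> N \<Longrightarrow> (y ^^ k) v = 0" using nil_y_ge by blast
  have ex: "\<exists>d v. v \<in> W \<and> v \<noteq> 0 \<and> lowest_weight d v"
    if "u \<in> ker_im k" "u \<in> W" "u \<noteq> 0" for k u
    using that
  proof (induction "N - k" arbitrary: k u)
    case 0
    then have "(y ^^ k) v = 0" for v by (intro y_pow_eq_0) simp
    then show ?case using 0 by (auto simp: ker_im_def)
  next
    case (Suc n)
    let ?u = "h u + real k *\<^sub>R u"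
    show ?case
    proof (cases "?u = 0")
      case True
      then have "h u = - (real k *\<^sub>R u)" by (simp add: eq_neg_iff_add_eq_0)
      then have "lowest_weight (Suc k) u"
        using Suc.prems by (simp add: lowest_weight_def ker_im_def)
      then show ?thesis using Suc.prems by blast
    next
      case False
      have "?u \<in> W" using W(1) Suc.prems by (auto simp: invariant_def intro: subspace_add subspace_scale)
      then show ?thesis using Suc.hyps(2) ker_im_step[OF Suc.prems(1)] False
        by (intro Suc.hyps(1)[of "Suc k" ?u]) simp_all
    qed
  qed
  define m where "m = (LEAST m. (y ^^ m) w = 0)"
  have m: "(y ^^ m) w = 0" unfolding m_def using y_pow_eq_0[of N w] by (metis (mono_tags) LeastI order_refl)
  obtain k where k: "m = Suc k" using m W(3) by (cases m) auto
  have "(y ^^ k) w \<noteq> 0" using not_less_Least[of k "\<lambda>m. (y ^^ m) w = 0"] k by (simp add: m_def[symmetric])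
  moreover have "(y ^^ k) w \<in> ker_im 0" using m k by (simp add: ker_im_def)
  ultimately show ?thesis using ex invariant_y_pow[OF W(1,2)] that by blast
qed

definition string_space :: "nat \<Rightarrow> 'v \<Rightarrow> 'v set" where
  "string_space d v = range (\<lambda>c :: nat \<Rightarrow> real. \<Sum>l<d. c l *\<^sub>R (x ^^ l) v)"

text \<open>If \<open>m\<close> is the largest index with nonzero coefficient, \<open>y^m\<close>
  kills the lower terms and sends the top one to a nonzero multiple of \<open>v\<close>. Both
  independence and irreducibility of a string come from this.\<close>

lemma y_pow_string_combination:
  assumes v: "lowest_weight d v" and c: "l < d" "c l \<noteq> 0"
  shows "\<exists>m k. k \<noteq> 0 \<and> (y ^^ m) (\<Sum>l<d. c l *\<^sub>R (x ^^ l) v) = k *\<^sub>R v"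
proof -
  let ?A = "{l. l < d \<and> c l \<noteq> 0}"
  define m where "m = Max ?A"
  have fin: "finite ?A" by simp
  have "m \<in> ?A" unfolding m_def by (rule Max_in[OF fin]) (use c in blast)
  then have m: "m < d" "c m \<noteq> 0" by simp_all
  have max: "c l = 0" if "l < d" "m < l" for l
  proof (rule ccontr)
    assume "c l \<noteq> 0"
    then have "l \<le> m" unfolding m_def using that(1) by (intro Max_ge[OF fin]) simp
    with that(2) show False by simp
  qed
  obtain e where e: "e \<noteq> 0" "(y ^^ m) ((x ^^ m) v) = e *\<^sub>R v"
    using lowest_weight_y_pow[OF v m(1)] by blast
  have "(y ^^ m) (\<Sum>l<d. c l *\<^sub>R (x ^^ l) v) = (\<Sum>l<d. c l *\<^sub>R (y ^^ m) ((x ^^ l) v))"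
    by (simp add: linear_sum[OF linear_funpow[OF linear_y]])
  also have "\<dots> = (\<Sum>l<d. if l = m then (c m * e) *\<^sub>R v else 0)"
  proof (rule sum.cong)
    fix l assume "l \<in> {..<d}"
    then show "c l *\<^sub>R (y ^^ m) ((x ^^ l) v) = (if l = m then (c m * e) *\<^sub>R v else 0)"
      using e(2) max[of l] lowest_weight_y_pow_less[OF v, of l m] by (cases l m rule: linorder_cases) auto
  qed simp
  also have "\<dots> = (c m * e) *\<^sub>R v" using m by simp
  finally show ?thesis using m e by (intro exI[of _ m] exI[of _ "c m * e"]) auto
qed

lemma string_combination_eq_0:
  assumes "lowest_weight d v" "v \<noteq> 0" "(\<Sum>l<d. c l *\<^sub>R (x ^^ l) v) = 0" "l < d"
  shows "c l = 0"
proof (rule ccontr)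
  assume "c l \<noteq> 0"
  then obtain m k where "k \<noteq> 0" "(y ^^ m) (\<Sum>l<d. c l *\<^sub>R (x ^^ l) v) = k *\<^sub>R v"
    using y_pow_string_combination[OF assms(1,4)] by blast
  then show False using assms(2,3) by simp
qed

lemma string_space_subspace: "subspace (string_space d v)"
proof (rule subspaceI)
  show "0 \<in> string_space d v" unfolding string_space_def by (rule range_eqI[of _ _ "\<lambda>_. 0"]) simp
  fix u w assume "u \<in> string_space d v" "w \<in> string_space d v"
  then obtain a b where "u = (\<Sum>l<d. a l *\<^sub>R (x ^^ l) v)" "w = (\<Sum>l<d. b l *\<^sub>R (x ^^ l) v)"
    by (auto simp: string_space_def)
  then show "u + w \<in> string_space d v"
    unfolding string_space_def
    by (intro range_eqI[of _ _ "\<lambda>l. a l + b l"]) (simp add: scaleR_add_left sum.distrib)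
next
  fix c u assume "u \<in> string_space d v"
  then obtain a where "u = (\<Sum>l<d. a l *\<^sub>R (x ^^ l) v)" by (auto simp: string_space_def)
  then show "c *\<^sub>R u \<in> string_space d v"
    unfolding string_space_def
    by (intro range_eqI[of _ _ "\<lambda>l. c * a l"]) (simp add: scaleR_sum_right)
qed

lemma string_space_base: "l < d \<Longrightarrow> (x ^^ l) v \<in> string_space d v"
  unfolding string_space_def
  by (rule range_eqI[of _ _ "\<lambda>i. if i = l then 1 else 0"])
    (simp add: sum.remove[of "{..<d}" l] sum.neutral)

lemma string_space_subset:
  assumes "subspace S" "\<And>l. l < d \<Longrightarrow> (x ^^ l) v \<in> S"
  shows "string_space d v \<subseteq> S"
  unfolding string_space_def
  by (intro image_subsetI subspace_sum[OF assms(1)] subspace_scale[OF assms(1)] assms(2)) simp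

lemma string_space_invariant:
  assumes v: "lowest_weight d v"
  shows "invariant (string_space d v)"
proof -
  note S = string_space_subspace[of d v]
  have "string_space d v \<subseteq> {w. x w \<in> string_space d v \<and> h w \<in> string_space d v \<and> y w \<in> string_space d v}"
  proof (rule string_space_subset)
    show "subspace {w. x w \<in> string_space d v \<and> h w \<in> string_space d v \<and> y w \<in> string_space d v}"
      using S by (auto simp: subspace_def)
    fix l assume l: "l < d"
    have "x ((x ^^ l) v) \<in> string_space d v"
    proof (cases "Suc l < d")
      case True
      then show ?thesis using string_space_base[of "Suc l" d v] by simp
    next
      case False
      then have "(x ^^ Suc l) v = 0" by (intro lowest_weight_x_pow_eq_0[OF v]) simp
      then show ?thesis using subspace_0[OF S] by simp
    qed
    moreover have "h ((x ^^ l) v) \<in> string_space d v"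
      unfolding lowest_weight_h[OF v] by (intro subspace_scale[OF S] string_space_base l)
    moreover have "y ((x ^^ l) v) \<in> string_space d v"
    proof (cases l)
      case 0
      then show ?thesis using v subspace_0[OF S] by (simp add: lowest_weight_def)
    next
      case (Suc k)
      then show ?thesis using l unfolding Suc lowest_weight_y[OF v]
        by (intro subspace_scale[OF S] string_space_base) simp
    qed
    ultimately show "(x ^^ l) v \<in> {w. x w \<in> string_space d v \<and> h w \<in> string_space d v \<and> y w \<in> string_space d v}"
      by blast
  qed
  then show ?thesis using S unfolding invariant_def by blast
qed

lemma string_space_irreducible:
  assumes v: "lowest_weight d v" and W: "invariant W" "W \<subseteq> string_space d v" "w \<in> W" "w \<noteq> 0"
  shows "W = string_space d v"
proof -
  obtain c where c: "w = (\<Sum>l<d. c l *\<^sub>R (x ^^ l) v)" using W by (auto simp: string_space_def)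
  have "\<exists>l<d. c l \<noteq> 0"
  proof (rule ccontr)
    assume "\<not> (\<exists>l<d. c l \<noteq> 0)"
    then have "w = 0" unfolding c by (intro sum.neutral) simp
    with W(4) show False by simp
  qed
  then obtain l where "l < d" "c l \<noteq> 0" by blast
  then obtain m k where mk: "k \<noteq> 0" "(y ^^ m) w = k *\<^sub>R v" using y_pow_string_combination[OF v] c by blast
  have "subspace W" using W(1) by (simp add: invariant_def)
  moreover have "k *\<^sub>R v \<in> W" using invariant_y_pow[OF W(1,3), of m] mk by simp
  ultimately have "(1 / k) *\<^sub>R k *\<^sub>R v \<in> W" by (rule subspace_scale)
  then have "v \<in> W" using mk(1) by simp
  then have "string_space d v \<subseteq> W"
    using W(1) invariant_x_pow[OF W(1)] by (intro string_space_subset) (auto simp: invariant_def)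
  with W(2) show ?thesis by blast
qed

text \<open>This is \<open>h^2 + 2 x y + 2 y x\<close> with \<open>y x\<close> rewritten as
  \<open>x y - h\<close>, so that its last term vanishes on the kernel of \<open>y\<close>.\<close>

definition casimir :: "'v \<Rightarrow> 'v" where
  "casimir v = h (h v) - 2 *\<^sub>R h v + 4 *\<^sub>R x (y v)"

lemma casimir_x: "casimir (x v) = x (casimir v)"
proof -
  have "y (x v) = x (y v) - h v" by (simp add: xy)
  then have "casimir (x v) = h (h (x v)) - 2 *\<^sub>R h (x v) + 4 *\<^sub>R x (x (y v) - h v)"
    by (simp add: casimir_def)
  also have "\<dots> = x (casimir v)"
    by (simp add: casimir_def hx algebra_simps scaleR_2[symmetric])
  finally show ?thesis .
qed

text \<open>The eigenvalue is computed at the bottom of the string, as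
  \<open>(1 - d)^2 - 2 (1 - d)\<close>, and carried upwards by \<open>casimir_x\<close>.\<close>

lemma casimir_lowest_weight:
  assumes "lowest_weight d v"
  shows "casimir ((x ^^ l) v) = ((real d)\<^sup>2 - 1) *\<^sub>R (x ^^ l) v"
proof (induction l)
  case 0
  have "casimir v = ((1 - real d) * (1 - real d) - 2 * (1 - real d)) *\<^sub>R v"
    using assms by (simp add: casimir_def lowest_weight_def scaleR_left_diff_distrib[symmetric])
  also have "(1 - real d) * (1 - real d) - 2 * (1 - real d) = (real d)\<^sup>2 - 1"
    by (simp add: power2_eq_square algebra_simps)
  finally show ?case by simp
qed (simp add: casimir_x)

lemma subspace_casimir: "subspace {v. casimir v = a *\<^sub>R v}"
proof -
  have "casimir 0 = 0" "casimir (u + w) = casimir u + casimir w" "casimir (c *\<^sub>R u) = c *\<^sub>R casimir u"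
    for u w c by (simp_all add: casimir_def algebra_simps)
  then show ?thesis by (intro subspaceI) (simp_all add: scaleR_add_right)
qed

text \<open>On such a vector \<open>ker_im_step\<close> multiplies by \<open>a + k\<close>, which is
  never 0, so \<open>z\<close> lies in the image of every power of \<open>y\<close>; one of these
  powers is 0.\<close>

lemma ker_y_weight_nonpos:
  assumes "y z = 0" "h z = a *\<^sub>R z" "a > 0"
  shows "z = 0"
proof -
  have "z \<in> ker_im k" for k
  proof (induction k)
    case 0
    then show ?case using assms by (simp add: ker_im_def)
  next
    case (Suc k)
    have "(a + real k) *\<^sub>R z \<in> ker_im (Suc k)"
      using ker_im_step[OF Suc] assms(2) by (simp add: scaleR_add_left)
    then obtain u where "(a + real k) *\<^sub>R z = (y ^^ Suc k) u" unfolding ker_im_def by blast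
    then have "(1 / (a + real k)) *\<^sub>R (a + real k) *\<^sub>R z = (y ^^ Suc k) ((1 / (a + real k)) *\<^sub>R u)"
      by (simp only: lin_pow)
    moreover have "a + real k \<noteq> 0" using assms(3) by linarith
    ultimately have "z = (y ^^ Suc k) ((1 / (a + real k)) *\<^sub>R u)"
      by (simp del: funpow.simps)
    then show ?case using assms(1) unfolding ker_im_def by blast
  qed
  then have "\<exists>u. z = (y ^^ k) u" for k unfolding ker_im_def by blast
  moreover obtain N where "\<forall>v. (y ^^ N) v = 0" using nil_y by blast
  ultimately show ?thesis by metis
qed

text \<open>The Casimir operator separates the isotypic components: on the kernel of \<open>y\<close> its eigenvalue
  determines the weight up to sign, and positive weights do not occur there.\<close>

lemma casimir_ker_y:
  assumes "casimir u = ((real d)\<^sup>2 - 1) *\<^sub>R u" "y u = 0"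
  shows "lowest_weight d u"
proof -
  \<comment> \<open>On the kernel of \<open>y\<close> the eigenvalue equation factors as
    \<open>(h - (d + 1)) (h + (d - 1)) u = 0\<close>, so \<open>z\<close> would have the positive
    weight \<open>d + 1\<close>.\<close>
  define z where "z = h u + (real d - 1) *\<^sub>R u"
  have hh: "h (h u) = 2 *\<^sub>R h u + ((real d)\<^sup>2 - 1) *\<^sub>R u"
    using assms by (simp add: casimir_def algebra_simps)
  have "y z = 0" using hy[of u] assms(2) by (simp add: z_def)
  moreover have "h z = (real d + 1) *\<^sub>R z"
    by (simp add: z_def hh algebra_simps power2_eq_square scaleR_2)
  ultimately have "z = 0" by (rule ker_y_weight_nonpos) simp
  then show ?thesis using assms(2) by (simp add: lowest_weight_def z_def algebra_simps)
qed

end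


section \<open>Matrices acting on functions\<close>

instantiation "fun" :: (type, real_vector) real_vector
begin

definition scaleR_fun :: "real \<Rightarrow> ('a \<Rightarrow> 'b) \<Rightarrow> 'a \<Rightarrow> 'b" where
  "scaleR_fun r f = (\<lambda>x. r *\<^sub>R f x)"

instance
  by standard (auto simp: scaleR_fun_def fun_eq_iff algebra_simps)

end

lemma scaleR_fun_apply [simp]: "(r *\<^sub>R f) x = r *\<^sub>R f x" for f :: "_ \<Rightarrow> _ :: real_vector"
  by (simp add: scaleR_fun_def)

lemma sum_fun_apply: "(\<Sum>a\<in>A. f a) x = (\<Sum>a\<in>A. f a x)" for f :: "_ \<Rightarrow> _ \<Rightarrow> _ :: comm_monoid_add"
  by (induction A rule: infinite_finite_induct) auto

text \<open>Vectors and matrices of size \<open>n\<close> are embedded into the real vector space of all sequences, so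
  that the abstract representation theory applies; coordinates from \<open>n\<close> on carry the zero action.\<close>

definition of_vec :: "quat vec \<Rightarrow> nat \<Rightarrow> quat" where
  "of_vec v = (\<lambda>i. if i < dim_vec v then v $ i else 0)"

definition act :: "nat \<Rightarrow> quat mat \<Rightarrow> (nat \<Rightarrow> quat) \<Rightarrow> nat \<Rightarrow> quat" where
  "act n A f = (\<lambda>i. if i < n then \<Sum>j<n. A $$ (i, j) * f j else 0)"

lemma linear_act: "linear (act n A)"
  by (rule linearI) (auto simp: act_def fun_eq_iff distrib_left sum.distrib scaleR_sum_right)

lemma of_vec_mult: "A \<in> carrier_mat n n \<Longrightarrow> v \<in> carrier_vec n \<Longrightarrow> of_vec (A *\<^sub>v v) = act n A (of_vec v)"
  by (auto simp: of_vec_def act_def fun_eq_iff scalar_prod_def atLeast0LessThan)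

lemma vec_act: "A \<in> carrier_mat n n \<Longrightarrow> vec n (act n A f) = A *\<^sub>v vec n f"
  by (auto simp: act_def scalar_prod_def atLeast0LessThan intro!: eq_vecI)

lemma act_mult:
  assumes "A \<in> carrier_mat n n" "B \<in> carrier_mat n n"
  shows "act n (A * B) f = act n A (act n B f)"
proof
  fix i
  have "(\<Sum>j<n. (\<Sum>k<n. A $$ (i, k) * B $$ (k, j)) * f j) = (\<Sum>k<n. A $$ (i, k) * (\<Sum>j<n. B $$ (k, j) * f j))"
    unfolding sum_distrib_left sum_distrib_right mult.assoc by (rule sum.swap)
  then show "act n (A * B) f i = act n A (act n B f) i"
    using assms by (auto simp: act_def scalar_prod_def atLeast0LessThan)
qed

lemma act_diff:
  assumes "A \<in> carrier_mat n n" "B \<in> carrier_mat n n"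
  shows "act n (A - B) f = act n A f - act n B f"
  using assms by (auto simp: act_def fun_eq_iff left_diff_distrib sum_subtractf)

lemma act_of_real:
  assumes "A \<in> carrier_mat n n"
  shows "act n (of_real r \<cdot>\<^sub>m A) f = r *\<^sub>R act n A f"
  using assms by (auto simp: act_def fun_eq_iff scaleR_sum_right of_real_def)

lemma of_vec_inject:
  assumes "v \<in> carrier_vec n" "w \<in> carrier_vec n" "of_vec v = of_vec w"
  shows "v = w"
proof (rule eq_vecI)
  fix i assume "i < dim_vec w"
  then show "v $ i = w $ i" using fun_cong[OF assms(3), of i] assms(1,2) by (simp add: of_vec_def)
qed (use assms in simp)

lemma of_vec_simps [simp]:
  "of_vec (0\<^sub>v n) = 0"
  "v \<in> carrier_vec n \<Longrightarrow> w \<in> carrier_vec n \<Longrightarrow> of_vec (v + w) = of_vec v + of_vec w"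
  "of_vec (right_smult_vec v (of_real r)) = r *\<^sub>R of_vec v"
  by (auto simp: of_vec_def fun_eq_iff of_real_def)

lemma vec_of_vec [simp]: "v \<in> carrier_vec n \<Longrightarrow> vec n (of_vec v) = v"
  by (auto simp: of_vec_def)

lemma of_vec_eq_0_iff: "v \<in> carrier_vec n \<Longrightarrow> of_vec v = 0 \<longleftrightarrow> v = 0\<^sub>v n"
  using of_vec_inject[of v n "0\<^sub>v n"] by auto

lemma right_subspace_of_vec:
  assumes "W \<subseteq> carrier_vec n"
  shows "right_subspace \<real> n W \<longleftrightarrow> subspace (of_vec ` W)"
proof
  assume W: "right_subspace \<real> n W"
  show "subspace (of_vec ` W)"
  proof (rule subspaceI)
    show "0 \<in> of_vec ` W" using W by (force simp: right_subspace_def)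
    fix f g assume "f \<in> of_vec ` W" "g \<in> of_vec ` W"
    then obtain v w where "f = of_vec v" "g = of_vec w" "v \<in> W" "w \<in> W" by blast
    then have "v + w \<in> W" "f + g = of_vec (v + w)"
      using W assms of_vec_simps(2)[of v n w] by (auto simp: right_subspace_def subset_iff)
    then show "f + g \<in> of_vec ` W" by blast
  next
    fix r f assume "f \<in> of_vec ` W"
    then obtain v where v: "f = of_vec v" "v \<in> W" by blast
    have "right_smult_vec v (of_real r) \<in> W" using W v by (auto simp: right_subspace_def)
    moreover have "r *\<^sub>R f = of_vec (right_smult_vec v (of_real r))" using v by simp
    ultimately show "r *\<^sub>R f \<in> of_vec ` W" by blast
  qed
next
  assume S: "subspace (of_vec ` W)"
  have mem: "v \<in> W" if "v \<in> carrier_vec n" "of_vec v \<in> of_vec ` W" for v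
    using that assms of_vec_inject[of v n] by blast
  show "right_subspace \<real> n W"
    unfolding right_subspace_def
  proof (intro conjI ballI)
    show "0\<^sub>v n \<in> W" using subspace_0[OF S] by (intro mem) simp_all
    show "v + w \<in> W" if "v \<in> W" "w \<in> W" for v w
    proof (rule mem)
      show "v + w \<in> carrier_vec n" using that assms by (auto simp: subset_iff)
      show "of_vec (v + w) \<in> of_vec ` W"
        using that assms subspace_add[OF S, of "of_vec v" "of_vec w"] of_vec_simps(2)[of v n w]
        by (auto simp: subset_iff)
    qed
    fix v and a :: quat assume v: "v \<in> W" and "a \<in> \<real>"
    then obtain r where a: "a = of_real r" by (auto elim: Reals_cases)
    show "right_smult_vec v a \<in> W"
      using v assms subspace_scale[OF S, of "of_vec v" r] unfolding a by (intro mem) auto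
  qed (use assms in blast)
qed

lemma of_vec_mat_of_cols:
  assumes "set vs \<subseteq> carrier_vec n" "c \<in> carrier_vec (length vs)" "\<And>i. i < length vs \<Longrightarrow> c $ i = of_real (r i)"
  shows "of_vec (mat_of_cols n vs *\<^sub>v c) = (\<Sum>i<length vs. r i *\<^sub>R of_vec (vs ! i))"
proof
  fix k
  have "dim_vec (vs ! i) = n" if "i < length vs" for i
    using that assms(1) by (auto simp: subset_iff)
  then show "of_vec (mat_of_cols n vs *\<^sub>v c) k = (\<Sum>i<length vs. r i *\<^sub>R of_vec (vs ! i)) k"
    using assms(2,3)
    by (auto simp: of_vec_def sum_fun_apply scalar_prod_def mat_of_cols_index of_real_def
        atLeast0LessThan intro!: sum.cong)
qed

lemma pow_mat_Suc_left:
  assumes "A \<in> carrier_mat n n"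
  shows "A ^\<^sub>m Suc k = A * A ^\<^sub>m k"
proof (induction k)
  case 0
  then show ?case using assms by simp
next
  case (Suc k)
  then show ?case using assms by (simp add: assoc_mult_mat[of _ n n _ n _ n])
qed

lemma of_vec_pow_mat:
  assumes "A \<in> carrier_mat n n" "v \<in> carrier_vec n"
  shows "of_vec (A ^\<^sub>m k *\<^sub>v v) = (act n A ^^ k) (of_vec v)"
proof (induction k)
  case (Suc k)
  have "A ^\<^sub>m Suc k *\<^sub>v v = A *\<^sub>v (A ^\<^sub>m k *\<^sub>v v)"
    unfolding pow_mat_Suc_left[OF assms(1)]
    using assms pow_carrier_mat[OF assms(1)] by (intro assoc_mult_mat_vec) auto
  then show ?case
    using Suc assms mult_mat_vec_carrier[OF pow_carrier_mat[OF assms(1)] assms(2), of k]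
    by (simp add: of_vec_mult)
qed (use assms in simp)

lemma vec_act_pow:
  assumes "A \<in> carrier_mat n n"
  shows "vec n ((act n A ^^ k) f) = A ^\<^sub>m k *\<^sub>v vec n f"
proof (induction k)
  case (Suc k)
  then show ?case
    using assms pow_carrier_mat[OF assms]
    by (simp del: pow_mat.simps add: pow_mat_Suc_left vec_act assoc_mult_mat_vec[of _ n n _ n])
qed (use assms in simp)

lemma hull_right_subspace_subset:
  assumes "right_subspace F n S" "\<And>W. W \<in> C \<Longrightarrow> W \<subseteq> S"
  shows "right_subspace F n hull \<Union>C \<subseteq> S"
  using assms by (intro hull_minimal) blast+

lemma right_subspace_zero: "right_subspace F n {0\<^sub>v n}"
  by (auto simp: right_subspace_def)


section \<open>Triples of matrices\<close>

locale sl2_matrices =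
  fixes n :: nat and X H Y :: "quat mat"
  assumes X: "X \<in> carrier_mat n n" and H: "H \<in> carrier_mat n n" and Y: "Y \<in> carrier_mat n n"
    and HX: "lie_bracket H X = 2 \<cdot>\<^sub>m X" and HY: "lie_bracket H Y = (- 2) \<cdot>\<^sub>m Y"
    and XY: "lie_bracket X Y = H" and nilX: "nilpotent_mat n X"
begin

sublocale V: sl2_rep "act n X" "act n H" "act n Y"
proof (rule sl2_rep.intro)
  fix f
  have HX': "act n (lie_bracket H X) f = 2 *\<^sub>R act n X f"
    unfolding HX using act_of_real[OF X, of 2 f] by simp
  show "act n H (act n X f) = act n X (act n H f) + 2 *\<^sub>R act n X f"
    unfolding HX'[symmetric] using X H by (simp add: lie_bracket_def act_diff[of _ n] act_mult)
  have HY': "act n (lie_bracket H Y) f = - 2 *\<^sub>R act n Y f"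
    unfolding HY using act_of_real[OF Y, of "- 2" f] by simp
  show "act n H (act n Y f) = act n Y (act n H f) - 2 *\<^sub>R act n Y f"
    using X H Y HY' by (simp add: lie_bracket_def act_diff[of _ n] act_mult algebra_simps)
  have "act n (lie_bracket X Y) f = act n H f" unfolding XY ..
  then show "act n X (act n Y f) = act n Y (act n X f) + act n H f"
    using X H Y by (simp add: lie_bracket_def act_diff[of _ n] act_mult algebra_simps)
qed (rule linear_act)+

text \<open>From \<open>[H, Y\<^sup>k] = - 2 k Y\<^sup>k\<close> one gets \<open>2 k \<parallel>Y\<^sup>k\<parallel> \<le> 2 \<parallel>H\<parallel> \<parallel>Y\<^sup>k\<parallel>\<close> for the entrywise sum norm.\<close>

lemma nilY: "nilpotent_mat n Y"
proof -
  define nrm where "nrm A = (\<Sum>i<n. \<Sum>j<n. norm (A $$ (i, j)))" for A :: "quat mat"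
  have nrm_mult: "nrm (A * B) \<le> nrm A * nrm B" if "A \<in> carrier_mat n n" "B \<in> carrier_mat n n" for A B
  proof -
    have "nrm (A * B) \<le> (\<Sum>i<n. \<Sum>j<n. \<Sum>l<n. norm (A $$ (i, l)) * norm (B $$ (l, j)))"
      unfolding nrm_def using that
      by (intro sum_mono) (auto simp: scalar_prod_def atLeast0LessThan norm_mult intro!: sum_norm_le)
    also have "\<dots> \<le> (\<Sum>i<n. \<Sum>j<n. \<Sum>l<n. norm (A $$ (i, l)) * (\<Sum>m<n. norm (B $$ (m, j))))"
      by (intro sum_mono mult_left_mono member_le_sum) auto
    also have "\<dots> = nrm A * nrm B"
    proof -
      have "nrm A * nrm B = (\<Sum>i<n. \<Sum>l<n. norm (A $$ (i, l))) * (\<Sum>j<n. \<Sum>m<n. norm (B $$ (m, j)))"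
        unfolding nrm_def by (subst (3) sum.swap) simp
      then show ?thesis by (simp only: sum_distrib_right[symmetric] sum_distrib_left[symmetric])
    qed
    finally show ?thesis .
  qed
  \<comment> \<open>Beyond the norm of \<open>H\<close> the estimate leaves only
    \<open>Y^k = 0\<close>.\<close>
  obtain k :: nat where k: "real k > nrm H" using reals_Archimedean2 by blast
  define P where "P = Y ^\<^sub>m k"
  have P: "P \<in> carrier_mat n n" using Y by (simp add: P_def)
  have entry: "(2 * real k) *\<^sub>R P $$ (i, j) = (P * H) $$ (i, j) - (H * P) $$ (i, j)"
    if ij: "i < n" "j < n" for i j
  proof -
    define v :: "quat vec" where "v = unit_vec n j"
    have v: "v \<in> carrier_vec n" by (simp add: v_def)
    have col: "of_vec (A *\<^sub>v v) i = A $$ (i, j)" if "A \<in> carrier_mat n n" for A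
      using that ij by (auto simp: of_vec_def v_def scalar_prod_def unit_vec_def
          if_distrib[of "\<lambda>x. _ * x"] cong: if_cong)
    have "act n H ((act n Y ^^ k) (of_vec v)) = (act n Y ^^ k) (act n H (of_vec v)) - (2 * real k) *\<^sub>R (act n Y ^^ k) (of_vec v)"
      by (rule V.h_y_pow)
    moreover have "(act n Y ^^ k) (of_vec w) = of_vec (P *\<^sub>v w)" "act n H (of_vec w) = of_vec (H *\<^sub>v w)"
      if "w \<in> carrier_vec n" for w
      using that Y H by (simp_all add: P_def of_vec_pow_mat of_vec_mult)
    moreover have "P *\<^sub>v v \<in> carrier_vec n" "H *\<^sub>v v \<in> carrier_vec n"
      using P H v by (simp_all add: mult_mat_vec_carrier)
    ultimately have "of_vec (H *\<^sub>v (P *\<^sub>v v)) = of_vec (P *\<^sub>v (H *\<^sub>v v)) - (2 * real k) *\<^sub>R of_vec (P *\<^sub>v v)"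
      using v by simp
    then have "of_vec ((H * P) *\<^sub>v v) = of_vec ((P * H) *\<^sub>v v) - (2 * real k) *\<^sub>R of_vec (P *\<^sub>v v)"
      using H P v by (simp add: assoc_mult_mat_vec[of _ n n _ n])
    from fun_cong[OF this, of i] show ?thesis
      using H P by (simp add: col)
  qed
  have "(2 * real k) * nrm P = (\<Sum>i<n. \<Sum>j<n. norm ((2 * real k) *\<^sub>R P $$ (i, j)))"
    by (simp add: nrm_def sum_distrib_left)
  also have "\<dots> \<le> (\<Sum>i<n. \<Sum>j<n. norm ((P * H) $$ (i, j)) + norm ((H * P) $$ (i, j)))"
    by (intro sum_mono) (use entry norm_triangle_ineq4 in auto)
  also have "\<dots> = nrm (P * H) + nrm (H * P)" by (simp add: nrm_def sum.distrib)
  also have "\<dots> \<le> 2 * (nrm H * nrm P)"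
    using nrm_mult[OF P H] nrm_mult[OF H P] mult.commute[of "nrm P" "nrm H"] by linarith
  finally have le: "(real k - nrm H) * nrm P \<le> 0" by (simp add: algebra_simps)
  have "nrm P \<ge> 0" by (simp add: nrm_def sum_nonneg)
  with le k have nP: "nrm P = 0" by (simp add: mult_le_0_iff)
  have "P $$ (i, j) = 0" if "i < n" "j < n" for i j
  proof -
    have "(\<Sum>j<n. norm (P $$ (i, j))) = 0"
      using nP that unfolding nrm_def by (subst (asm) sum_nonneg_eq_0_iff) (auto intro: sum_nonneg)
    then show ?thesis using that by (subst (asm) sum_nonneg_eq_0_iff) auto
  qed
  then have "P = 0\<^sub>m n n" using P by (intro eq_matI) auto
  then show ?thesis unfolding nilpotent_mat_def P_def by blast
qed

lemma act_nilpotent: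
  assumes A: "A \<in> carrier_mat n n" and "nilpotent_mat n A"
  shows "\<exists>N. \<forall>f. (act n A ^^ N) f = 0"
proof -
  obtain k where k: "A ^\<^sub>m k = 0\<^sub>m n n" using assms by (auto simp: nilpotent_mat_def)
  \<comment> \<open>The extra factor clears the coordinates from \<open>n\<close> on, which survive
    if \<open>k = 0\<close>; that happens for \<open>n = 0\<close>.\<close>
  have "(act n A ^^ Suc k) f = 0" for f
  proof
    fix i
    have "vec n ((act n A ^^ Suc k) f) = A *\<^sub>v (A ^\<^sub>m k *\<^sub>v vec n f)"
      using A by (simp add: vec_act vec_act_pow)
    also have "\<dots> = 0\<^sub>v n" unfolding k using A by (auto intro!: eq_vecI simp: scalar_prod_def)
    finally have "vec n ((act n A ^^ Suc k) f) $ i = 0\<^sub>v n $ i" by simp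
    then show "(act n A ^^ Suc k) f i = 0 i" by (cases "i < n") (auto simp: act_def)
  qed
  then show ?thesis by blast
qed

sublocale V: sl2_rep_nilpotent "act n X" "act n H" "act n Y"
  by unfold_locales (use act_nilpotent X Y nilX nilY in blast)+

section \<open>Lowest weight spaces in coordinates\<close>

definition lw :: "nat \<Rightarrow> quat vec set" where
  "lw d = {v \<in> carrier_vec n. Y *\<^sub>v v = 0\<^sub>v n \<and> H *\<^sub>v v = right_smult_vec v (of_real (1 - real d))}"

lemma lw_carrier: "v \<in> lw d \<Longrightarrow> v \<in> carrier_vec n"
  by (simp add: lw_def)

lemma lw_iff: "v \<in> carrier_vec n \<Longrightarrow> v \<in> lw d \<longleftrightarrow> V.lowest_weight d (of_vec v)"
proof -
  assume v: "v \<in> carrier_vec n"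
  have "H *\<^sub>v v = right_smult_vec v (of_real (1 - real d)) \<longleftrightarrow>
      of_vec (H *\<^sub>v v) = of_vec (right_smult_vec v (of_real (1 - real d)))"
    using v H by (metis of_vec_inject mult_mat_vec_carrier right_smult_vec_carrier)
  then show ?thesis
    using v H Y of_vec_eq_0_iff[of "Y *\<^sub>v v" n]
    by (simp add: lw_def V.lowest_weight_def of_vec_mult del: of_real_diff)
qed

lemma pow_vec_carrier [simp]: "v \<in> carrier_vec n \<Longrightarrow> X ^\<^sub>m k *\<^sub>v v \<in> carrier_vec n"
  using X by (intro mult_mat_vec_carrier) auto

lemma lw_H:
  assumes "v \<in> lw d"
  shows "H *\<^sub>v (X ^\<^sub>m k *\<^sub>v v) = right_smult_vec (X ^\<^sub>m k *\<^sub>v v) (of_real (2 * real k + 1 - real d))"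
proof -
  have v: "v \<in> carrier_vec n" using assms by (rule lw_carrier)
  have "of_vec (H *\<^sub>v (X ^\<^sub>m k *\<^sub>v v)) = (2 * real k + 1 - real d) *\<^sub>R of_vec (X ^\<^sub>m k *\<^sub>v v)"
    using V.lowest_weight_h[of d "of_vec v" k] assms v H X
    by (simp add: lw_iff of_vec_mult of_vec_pow_mat)
  also have "\<dots> = of_vec (right_smult_vec (X ^\<^sub>m k *\<^sub>v v) (of_real (2 * real k + 1 - real d)))"
    by (simp only: of_vec_simps)
  finally show ?thesis using v H
    by (intro of_vec_inject[of _ n]) (auto intro: mult_mat_vec_carrier)
qed

lemma lw_Y:
  assumes "v \<in> lw d"
  shows "Y *\<^sub>v (X ^\<^sub>m Suc k *\<^sub>v v) =
    right_smult_vec (X ^\<^sub>m k *\<^sub>v v) (of_real (real (Suc k) * (real d - real (Suc k))))"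
proof -
  have v: "v \<in> carrier_vec n" using assms by (rule lw_carrier)
  have "of_vec (Y *\<^sub>v (X ^\<^sub>m Suc k *\<^sub>v v)) = (real (Suc k) * (real d - real (Suc k))) *\<^sub>R of_vec (X ^\<^sub>m k *\<^sub>v v)"
    using V.lowest_weight_y[of d "of_vec v" k] assms v Y X
    by (simp only: lw_iff of_vec_mult of_vec_pow_mat pow_vec_carrier)
  also have "\<dots> = of_vec (right_smult_vec (X ^\<^sub>m k *\<^sub>v v) (of_real (real (Suc k) * (real d - real (Suc k)))))"
    by (simp only: of_vec_simps)
  finally show ?thesis using v Y pow_vec_carrier[OF v, of "Suc k"]
    by (intro of_vec_inject[of _ n]) (auto intro: mult_mat_vec_carrier simp del: pow_mat.simps)
qed

lemma lw_X_pow_eq_0: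
  assumes "v \<in> lw d" "d \<le> k"
  shows "X ^\<^sub>m k *\<^sub>v v = 0\<^sub>v n"
proof -
  have v: "v \<in> carrier_vec n" using assms(1) by (rule lw_carrier)
  then show ?thesis
    using V.lowest_weight_x_pow_eq_0[of d "of_vec v" k] assms X of_vec_eq_0_iff[of "X ^\<^sub>m k *\<^sub>v v" n]
    by (simp add: lw_iff of_vec_pow_mat)
qed

lemma lw_X_pow_inj:
  assumes "v \<in> lw d" "X ^\<^sub>m k *\<^sub>v v = 0\<^sub>v n" "k < d"
  shows "v = 0\<^sub>v n"
proof -
  have v: "v \<in> carrier_vec n" using assms(1) by (rule lw_carrier)
  have "(act n X ^^ k) (of_vec v) = 0"
    by (simp add: of_vec_pow_mat[OF X v, symmetric] assms(2))
  then show ?thesis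
    using V.lowest_weight_x_pow_inj[of d "of_vec v" k] assms(1,3) v of_vec_eq_0_iff[of v n]
    by (simp add: lw_iff)
qed

text \<open>The eigenvalue is real, hence central in the quaternions, so the eigenspace is closed
  under right multiplication by all quaternions.\<close>

lemma lw_right_subspace: "right_subspace UNIV n (lw d)"
  unfolding right_subspace_def
proof (intro conjI ballI)
  show "lw d \<subseteq> carrier_vec n" by (auto simp: lw_def)
  show "0\<^sub>v n \<in> lw d" using Y H by (simp add: lw_def mult_mat_vec_zero[of _ n])
  show "v + w \<in> lw d" if "v \<in> lw d" "w \<in> lw d" for v w
  proof -
    have "right_smult_vec (v + w) a = right_smult_vec v a + right_smult_vec w a" for a
      using that by (intro eq_vecI) (auto simp: lw_def distrib_right)
    then show ?thesis using that Y H
      by (auto simp: lw_def mult_add_distrib_mat_vec[of _ n n])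
  qed
  show "right_smult_vec v a \<in> lw d" if "v \<in> lw d" for v a
  proof -
    have v: "v \<in> carrier_vec n" using that by (rule lw_carrier)
    have "right_smult_vec (right_smult_vec v (of_real r)) a = right_smult_vec (right_smult_vec v a) (of_real r)" for r
      using v by (intro eq_vecI) (auto simp: mult.assoc of_real_quat_commute)
    then show ?thesis using that v Y H
      by (auto simp: lw_def mult_mat_vec_right_smult[of _ n n] simp del: of_real_diff)
  qed
qed

text \<open>The strings span by \<open>span_lowest_weight\<close>, so agreement on them suffices.
  The number of rows is left open: with one row this tests a functional.\<close>

lemma mat_eq_on_lw:
  assumes P: "P \<in> carrier_mat m n" and Q: "Q \<in> carrier_mat m n"
    and eq: "\<And>d l v. v \<in> lw d \<Longrightarrow> l < d \<Longrightarrow> P *\<^sub>v (X ^\<^sub>m l *\<^sub>v v) = Q *\<^sub>v (X ^\<^sub>m l *\<^sub>v v)"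
  shows "P = Q"
proof -
  let ?S = "{f. P *\<^sub>v vec n f = Q *\<^sub>v vec n f}"
  have vec_add: "vec n (f + g) = vec n f + vec n g" and vec_0: "vec n (0 :: nat \<Rightarrow> quat) = 0\<^sub>v n"
    and vec_scale: "vec n (r *\<^sub>R f) = right_smult_vec (vec n f) (of_real r)" for f g :: "nat \<Rightarrow> quat" and r
    by (rule eq_vecI; simp add: of_real_def)+
  have "subspace ?S"
  proof (rule subspaceI)
    show "0 \<in> ?S" using P Q by (auto simp: vec_0 intro!: eq_vecI)
    show "f + g \<in> ?S" if "f \<in> ?S" "g \<in> ?S" for f g
      using that P Q by (simp add: vec_add mult_add_distrib_mat_vec[of _ m n])
    show "r *\<^sub>R f \<in> ?S" if "f \<in> ?S" for r f
      using that P Q by (simp add: vec_scale mult_mat_vec_right_smult[of _ m n])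
  qed
  moreover have "{(act n X ^^ l) u |l u d. V.lowest_weight d u} \<subseteq> ?S"
  proof safe
    fix l u d assume u: "V.lowest_weight d u"
    have "vec n (act n H u) = vec n ((1 - real d) *\<^sub>R u)" "vec n (act n Y u) = vec n 0"
      using u by (simp_all add: V.lowest_weight_def)
    then have lw: "vec n u \<in> lw d"
      unfolding vec_act[OF H] vec_act[OF Y] vec_0 vec_scale by (simp add: lw_def)
    show "P *\<^sub>v vec n ((act n X ^^ l) u) = Q *\<^sub>v vec n ((act n X ^^ l) u)"
    proof (cases "l < d")
      case True
      then show ?thesis unfolding vec_act_pow[OF X] by (rule eq[OF lw])
    next
      case False
      then have "X ^\<^sub>m l *\<^sub>v vec n u = 0\<^sub>v n" using lw by (intro lw_X_pow_eq_0) auto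
      then show ?thesis unfolding vec_act_pow[OF X] using P Q by (simp add: mult_mat_vec_zero[of _ m n])
    qed
  qed
  ultimately have S: "f \<in> ?S" for f
    using V.span_lowest_weight[of f] span_minimal by blast
  have "P *\<^sub>v v = Q *\<^sub>v v" if "v \<in> carrier_vec n" for v
    using S[of "of_vec v"] that by simp
  then have "P $$ (i, j) = Q $$ (i, j)" if "i < m" "j < n" for i j
  proof -
    have "(A *\<^sub>v unit_vec n j) $ i = A $$ (i, j)" if "A \<in> carrier_mat m n" for A :: "quat mat"
      using that \<open>i < m\<close> \<open>j < n\<close>
      by (auto simp: scalar_prod_def unit_vec_def if_distrib[of "\<lambda>x. _ * x"] cong: if_cong)
    then show ?thesis using P Q \<open>\<And>v. v \<in> carrier_vec n \<Longrightarrow> P *\<^sub>v v = Q *\<^sub>v v\<close>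
      by (metis unit_vec_carrier)
  qed
  then show ?thesis using P Q by (intro eq_matI) auto
qed

section \<open>Irreducible submodules and the spaces of the diagram\<close>

lemma submodule_iff:
  assumes W: "W \<subseteq> carrier_vec n"
  shows "submodule n (sl2_span X H Y) W \<longleftrightarrow> V.invariant (of_vec ` W)"
proof -
  have mem: "v \<in> W \<longleftrightarrow> of_vec v \<in> of_vec ` W" if "v \<in> carrier_vec n" for v
    using that W of_vec_inject[of v n] by blast
  have XHY: "X \<in> sl2_span X H Y" "H \<in> sl2_span X H Y" "Y \<in> sl2_span X H Y"
  proof -
    have "of_real 1 \<cdot>\<^sub>m X + of_real 0 \<cdot>\<^sub>m H + of_real 0 \<cdot>\<^sub>m Y = X"
      "of_real 0 \<cdot>\<^sub>m X + of_real 1 \<cdot>\<^sub>m H + of_real 0 \<cdot>\<^sub>m Y = H"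
      "of_real 0 \<cdot>\<^sub>m X + of_real 0 \<cdot>\<^sub>m H + of_real 1 \<cdot>\<^sub>m Y = Y"
      using X H Y by (auto intro!: eq_matI)
    then show "X \<in> sl2_span X H Y" "H \<in> sl2_span X H Y" "Y \<in> sl2_span X H Y"
      unfolding sl2_span_def mem_Collect_eq by metis+
  qed
  have span: "of_vec (A *\<^sub>v v) \<in> of_vec ` W"
    if "A \<in> sl2_span X H Y" "v \<in> W" "V.invariant (of_vec ` W)" for A v
  proof -
    obtain a b c where A: "A = of_real a \<cdot>\<^sub>m X + of_real b \<cdot>\<^sub>m H + of_real c \<cdot>\<^sub>m Y"
      using \<open>A \<in> sl2_span X H Y\<close> unfolding sl2_span_def by blast
    have v: "v \<in> carrier_vec n" using that W by blast
    have Ac: "A \<in> carrier_mat n n" using A X H Y by auto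
    have "act n A f = a *\<^sub>R act n X f + b *\<^sub>R act n H f + c *\<^sub>R act n Y f" for f
      unfolding A using X H Y
      by (auto simp: act_def fun_eq_iff distrib_right sum.distrib scaleR_sum_right of_real_def)
    then have "of_vec (A *\<^sub>v v) = a *\<^sub>R act n X (of_vec v) + b *\<^sub>R act n H (of_vec v) + c *\<^sub>R act n Y (of_vec v)"
      using of_vec_mult[OF Ac v] by simp
    moreover have "of_vec v \<in> of_vec ` W" using that by blast
    ultimately show ?thesis using that(3)
      by (auto simp: V.invariant_def intro!: subspace_add subspace_scale)
  qed
  show ?thesis
  proof
    assume S: "submodule n (sl2_span X H Y) W"
    show "V.invariant (of_vec ` W)"
      unfolding V.invariant_def
    proof (intro conjI ballI)
      show "subspace (of_vec ` W)" using S W by (simp add: submodule_def right_subspace_of_vec)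
      fix w assume "w \<in> of_vec ` W"
      then obtain v where v: "w = of_vec v" "v \<in> W" by blast
      then have "v \<in> carrier_vec n" using W by blast
      then have "act n A w = of_vec (A *\<^sub>v v)" if "A \<in> carrier_mat n n" for A
        using that v by (simp add: of_vec_mult)
      moreover have "A *\<^sub>v v \<in> W" if "A \<in> sl2_span X H Y" for A
        using S v that by (simp add: submodule_def)
      ultimately show "act n X w \<in> of_vec ` W" "act n H w \<in> of_vec ` W" "act n Y w \<in> of_vec ` W"
        using XHY X H Y by blast+
    qed
  next
    assume I: "V.invariant (of_vec ` W)"
    have "A *\<^sub>v v \<in> W" if "A \<in> sl2_span X H Y" "v \<in> W" for A v
    proof -
      have "A \<in> carrier_mat n n" using that X H Y by (auto simp: sl2_span_def)
      then have "A *\<^sub>v v \<in> carrier_vec n" using that W by (intro mult_mat_vec_carrier) auto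
      then show ?thesis using mem span[OF that I] by blast
    qed
    then show "submodule n (sl2_span X H Y) W"
      using I W by (simp add: submodule_def right_subspace_of_vec V.invariant_def)
  qed
qed

definition string_module :: "nat \<Rightarrow> quat vec \<Rightarrow> quat vec set" where
  "string_module d v = {u \<in> carrier_vec n. of_vec u \<in> V.string_space d (of_vec v)}"

lemma of_vec_string_module:
  assumes "v \<in> carrier_vec n"
  shows "of_vec ` string_module d v = V.string_space d (of_vec v)"
proof
  show "V.string_space d (of_vec v) \<subseteq> of_vec ` string_module d v"
  proof
    fix f assume f: "f \<in> V.string_space d (of_vec v)"
    then obtain c where c: "f = (\<Sum>l<d. c l *\<^sub>R (act n X ^^ l) (of_vec v))"
      by (auto simp: V.string_space_def)
    have "(act n X ^^ l) (of_vec v) i = 0" if "i \<ge> n" for i l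
      unfolding of_vec_pow_mat[OF X assms, symmetric]
      using that carrier_vecD[OF pow_vec_carrier[OF assms, of l]]
      by (simp only: of_vec_def not_less[symmetric] if_False)
    then have "f i = 0" if "i \<ge> n" for i using that by (simp add: c sum_fun_apply)
    then have eq: "f = of_vec (vec n f)" by (auto simp: of_vec_def fun_eq_iff)
    then have "vec n f \<in> string_module d v" using f unfolding string_module_def by simp
    with eq show "f \<in> of_vec ` string_module d v" by (rule image_eqI)
  qed
qed (auto simp: string_module_def)

lemma string_module_right_dim:
  assumes v: "v \<in> lw d" "v \<noteq> 0\<^sub>v n"
  shows "right_dim \<real> n (string_module d v) = d"
proof -
  let ?W = "string_module d v" and ?vs = "map (\<lambda>l. X ^\<^sub>m l *\<^sub>v v) [0..<d]"
  have vc: "v \<in> carrier_vec n" using v(1) by (rule lw_carrier)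
  have lw: "V.lowest_weight d (of_vec v)" "of_vec v \<noteq> 0"
    using v vc by (simp_all add: lw_iff of_vec_eq_0_iff)
  have W: "right_subspace \<real> n ?W"
    using V.string_space_subspace[of d "of_vec v"] vc
    by (subst right_subspace_of_vec) (auto simp: of_vec_string_module, auto simp: string_module_def)
  have vs: "set ?vs \<subseteq> carrier_vec n" using vc by auto
  have comb: "of_vec (mat_of_cols n ?vs *\<^sub>v c) = (\<Sum>l<d. r l *\<^sub>R (act n X ^^ l) (of_vec v))"
    if "c \<in> carrier_vec d" "\<And>i. i < d \<Longrightarrow> c $ i = of_real (r i)" for c r
    using of_vec_mat_of_cols[OF vs, of c r] that by (simp add: of_vec_pow_mat[OF X vc])
  have "right_basis \<real> n ?vs ?W"
    unfolding right_basis_iff[OF division_subring_Reals W]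
  proof (intro conjI ballI)
    show "right_indep \<real> n ?vs"
      unfolding right_indep_def
    proof (intro conjI ballI impI vs)
      fix c assume c: "c \<in> carrier_vec (length ?vs)" "\<forall>i<length ?vs. c $ i \<in> \<real>"
        "mat_of_cols n ?vs *\<^sub>v c = 0\<^sub>v n"
      define r where "r i = Rq (c $ i)" for i
      have r: "c $ i = of_real (r i)" if "i < d" for i
        using c(2) that by (auto simp: r_def elim!: Reals_cases)
      have "(\<Sum>l<d. r l *\<^sub>R (act n X ^^ l) (of_vec v)) = 0"
        using comb[of c r] c r by simp
      then have "r l = 0" if "l < d" for l using V.string_combination_eq_0[OF lw] that by blast
      then show "c = 0\<^sub>v (length ?vs)" using r c by (intro eq_vecI) auto
    qed
    show "set ?vs \<subseteq> ?W"
      using V.string_space_base[of _ d "of_vec v"] vc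
      by (auto simp: string_module_def of_vec_pow_mat[OF X vc])
    fix w assume w: "w \<in> ?W"
    then obtain r where r: "of_vec w = (\<Sum>l<d. r l *\<^sub>R (act n X ^^ l) (of_vec v))"
      by (auto simp: string_module_def V.string_space_def)
    define c where "c = vec d (\<lambda>i. of_real (r i) :: quat)"
    have "of_vec (mat_of_cols n ?vs *\<^sub>v c) = of_vec w"
      unfolding r by (rule comb) (auto simp: c_def)
    then have "mat_of_cols n ?vs *\<^sub>v c = w"
      using w by (intro of_vec_inject[of _ n]) (auto simp: string_module_def)
    then show "\<exists>c\<in>carrier_vec (length ?vs). (\<forall>i<length ?vs. c $ i \<in> \<real>) \<and> mat_of_cols n ?vs *\<^sub>v c = w"
      by (intro bexI[of _ c]) (auto simp: c_def)
  qed
  from right_dim_eq[OF division_subring_Reals W this] show ?thesis by simp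
qed

lemma string_module_irreducible:
  assumes v: "v \<in> lw d" "v \<noteq> 0\<^sub>v n"
  shows "irreducible_submodule n (sl2_span X H Y) (string_module d v)"
    and "v \<in> string_module d v"
proof -
  have vc: "v \<in> carrier_vec n" using v(1) by (rule lw_carrier)
  have lw: "V.lowest_weight d (of_vec v)" "of_vec v \<noteq> 0"
    using v vc by (simp_all add: lw_iff of_vec_eq_0_iff)
  have sub: "string_module d v \<subseteq> carrier_vec n" by (auto simp: string_module_def)
  show vW: "v \<in> string_module d v"
    using V.lowest_weight_x_pow(1)[OF lw] V.string_space_base[of 0 d "of_vec v"] vc
    by (simp add: string_module_def)
  show "irreducible_submodule n (sl2_span X H Y) (string_module d v)"
    unfolding irreducible_submodule_def
  proof (intro conjI allI impI)
    show "submodule n (sl2_span X H Y) (string_module d v)"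
      using V.string_space_invariant[OF lw(1)] by (simp add: submodule_iff[OF sub] of_vec_string_module[OF vc])
    show "string_module d v \<noteq> {0\<^sub>v n}" using vW v(2) by blast
    fix U assume U: "submodule n (sl2_span X H Y) U \<and> U \<subseteq> string_module d v"
    then have Uc: "U \<subseteq> carrier_vec n" using sub by blast
    show "U = {0\<^sub>v n} \<or> U = string_module d v"
    proof (cases "U \<subseteq> {0\<^sub>v n}")
      case True
      then show ?thesis using U by (auto simp: submodule_def right_subspace_def)
    next
      case False
      then obtain u where u: "u \<in> U" "u \<noteq> 0\<^sub>v n" by blast
      have "of_vec ` U = of_vec ` string_module d v"
        unfolding of_vec_string_module[OF vc]
      proof (rule V.string_space_irreducible[OF lw(1)])
        show "V.invariant (of_vec ` U)" using U submodule_iff[OF Uc] by blast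
        show "of_vec ` U \<subseteq> V.string_space d (of_vec v)"
          unfolding of_vec_string_module[OF vc, symmetric] using U by blast
        show "of_vec u \<in> of_vec ` U" "of_vec u \<noteq> 0" using u Uc of_vec_eq_0_iff[of u n] by auto
      qed
      moreover have "inj_on of_vec (carrier_vec n)" by (rule inj_onI) (rule of_vec_inject)
      ultimately show ?thesis using inj_on_image_eq_iff Uc sub by blast
    qed
  qed
qed

text \<open>An irreducible module contains a lowest weight vector, and the string of that vector is
  a nonzero submodule.\<close>

lemma irreducible_submodule_string:
  assumes "irreducible_submodule n (sl2_span X H Y) W"
  obtains d v where "v \<in> lw d" "v \<noteq> 0\<^sub>v n" "W = string_module d v"
proof -
  have sm: "submodule n (sl2_span X H Y) W" and irr: "\<And>U. submodule n (sl2_span X H Y) U \<Longrightarrow> U \<subseteq> W \<Longrightarrow> U = {0\<^sub>v n} \<or> U = W"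
    and nz: "W \<noteq> {0\<^sub>v n}"
    using assms by (auto simp: irreducible_submodule_def)
  have Wc: "W \<subseteq> carrier_vec n" "0\<^sub>v n \<in> W" using sm by (auto simp: submodule_def right_subspace_def)
  then obtain w where w: "w \<in> W" "w \<noteq> 0\<^sub>v n" using nz by blast
  have inv: "V.invariant (of_vec ` W)" using sm submodule_iff[OF Wc(1)] by blast
  have "of_vec w \<in> of_vec ` W" "of_vec w \<noteq> 0" using w Wc of_vec_eq_0_iff[of w n] by auto
  then obtain d f where f: "f \<in> of_vec ` W" "f \<noteq> 0" "V.lowest_weight d f"
    using V.invariant_lowest_weight[OF inv] by metis
  then obtain v where v: "v \<in> W" "f = of_vec v" by blast
  have vc: "v \<in> carrier_vec n" using v Wc by blast
  have lw: "v \<in> lw d" "v \<noteq> 0\<^sub>v n" using f v vc by (simp_all add: lw_iff of_vec_eq_0_iff)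
  have "V.string_space d (of_vec v) \<subseteq> of_vec ` W"
    using inv f(1) v V.invariant_x_pow[OF inv] by (intro V.string_space_subset) (auto simp: V.invariant_def)
  then have "string_module d v \<subseteq> W"
    using Wc of_vec_inject[of _ n] unfolding string_module_def by blast
  then have "string_module d v = {0\<^sub>v n} \<or> string_module d v = W"
    using string_module_irreducible(1)[OF lw] by (intro irr) (simp_all add: irreducible_submodule_def)
  then show ?thesis using string_module_irreducible(2)[OF lw] lw that[of v d] by blast
qed

text \<open>All irreducible modules of dimension \<open>d\<close> lie in one eigenspace of the
  Casimir operator, which is a real subspace and so contains their sum; on the kernel of
  \<open>Y\<close> this eigenvalue pins down the weight. Conversely a nonzero vector of
  \<open>lw d\<close> lies in its own string module.\<close>

lemma lowest_eq:
  assumes "d > 0"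
  shows "lowest n X H Y d = lw d"
proof
  let ?C = "{W. irreducible_submodule n (sl2_span X H Y) W \<and> right_dim \<real> n W = d}"
  let ?S = "{u \<in> carrier_vec n. V.casimir (of_vec u) = ((real d)\<^sup>2 - 1) *\<^sub>R of_vec u}"
  have "W \<subseteq> ?S" if W: "W \<in> ?C" for W
  proof -
    obtain e v where v: "v \<in> lw e" "v \<noteq> 0\<^sub>v n" "W = string_module e v"
      using W irreducible_submodule_string by blast
    have "e = d" using string_module_right_dim[OF v(1,2)] v(3) W by simp
    have lw: "V.lowest_weight d (of_vec v)" using v \<open>e = d\<close> lw_carrier[OF v(1)] by (simp add: lw_iff)
    have "V.string_space d (of_vec v) \<subseteq> {f. V.casimir f = ((real d)\<^sup>2 - 1) *\<^sub>R f}"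
      using V.casimir_lowest_weight[OF lw] by (intro V.string_space_subset V.subspace_casimir) auto
    then show ?thesis using v(3) \<open>e = d\<close> by (auto simp: string_module_def)
  qed
  moreover have "right_subspace \<real> n ?S"
  proof -
    have 0: "V.casimir 0 = ((real d)\<^sup>2 - 1) *\<^sub>R 0"
      using subspace_0[OF V.subspace_casimir] by blast
    have add: "V.casimir (f + g) = ((real d)\<^sup>2 - 1) *\<^sub>R (f + g)"
      if "V.casimir f = ((real d)\<^sup>2 - 1) *\<^sub>R f" "V.casimir g = ((real d)\<^sup>2 - 1) *\<^sub>R g" for f g
      using subspace_add[OF V.subspace_casimir] that by blast
    have scale: "V.casimir (r *\<^sub>R f) = ((real d)\<^sup>2 - 1) *\<^sub>R (r *\<^sub>R f)"
      if "V.casimir f = ((real d)\<^sup>2 - 1) *\<^sub>R f" for f r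
      using subspace_scale[OF V.subspace_casimir] that by blast
    show ?thesis
      unfolding right_subspace_def
    proof (intro conjI ballI)
      show "0\<^sub>v n \<in> ?S" using 0 by simp
      show "v + w \<in> ?S" if "v \<in> ?S" "w \<in> ?S" for v w
        using that add[of "of_vec v" "of_vec w"] of_vec_simps(2)[of v n w] by simp
      show "right_smult_vec v a \<in> ?S" if v: "v \<in> ?S" and "a \<in> \<real>" for v a
      proof -
        obtain r where "a = of_real r" using \<open>a \<in> \<real>\<close> by (auto elim: Reals_cases)
        then show ?thesis using v scale[of "of_vec v" r] by simp
      qed
    qed blast
  qed
  ultimately have sub: "isotypic n X H Y d \<subseteq> ?S"
    unfolding isotypic_def by (intro hull_right_subspace_subset)
  show "lowest n X H Y d \<subseteq> lw d"
  proof
    fix u assume "u \<in> lowest n X H Y d"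
    then have u: "u \<in> ?S" "Y *\<^sub>v u = 0\<^sub>v n" using sub by (auto simp: lowest_def)
    then have "act n Y (of_vec u) = 0" using of_vec_mult[OF Y, of u] by simp
    then have "V.lowest_weight d (of_vec u)" using u V.casimir_ker_y by blast
    then show "u \<in> lw d" using u by (simp add: lw_iff)
  qed
  show "lw d \<subseteq> lowest n X H Y d"
  proof
    fix v assume v: "v \<in> lw d"
    have "v \<in> isotypic n X H Y d"
    proof (cases "v = 0\<^sub>v n")
      case True
      then show ?thesis unfolding isotypic_def hull_def by (auto simp: right_subspace_def)
    next
      case False
      then have "v \<in> \<Union>?C"
        using string_module_irreducible[OF v] string_module_right_dim[OF v] by blast
      then show ?thesis unfolding isotypic_def by (rule hull_inc)
    qed
    then show "v \<in> lowest n X H Y d" using v by (simp add: lowest_def lw_def)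
  qed
qed

text \<open>A nonzero lowest weight vector has positive index, so there is no irreducible module of
  dimension 0, and 0 is never a part of the diagram.\<close>

lemma lowest_0: "lowest n X H Y 0 = {0\<^sub>v n}"
proof -
  let ?C = "{W. irreducible_submodule n (sl2_span X H Y) W \<and> right_dim \<real> n W = 0}"
  have "?C = {}"
  proof (rule ccontr)
    assume "?C \<noteq> {}"
    then obtain W where W: "irreducible_submodule n (sl2_span X H Y) W" "right_dim \<real> n W = 0" by blast
    then obtain e v where v: "v \<in> lw e" "v \<noteq> 0\<^sub>v n" "W = string_module e v"
      using irreducible_submodule_string by blast
    have "e = 0" using string_module_right_dim[OF v(1,2)] v(3) W by simp
    have "v \<in> carrier_vec n" using lw_carrier v(1) .
    then have "V.lowest_weight e (of_vec v)" "of_vec v \<noteq> 0"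
      using v by (simp_all add: lw_iff of_vec_eq_0_iff)
    then show False using V.lowest_weight_x_pow(1) \<open>e = 0\<close> by blast
  qed
  then have "isotypic n X H Y 0 \<subseteq> {0\<^sub>v n}"
    unfolding isotypic_def by (intro hull_right_subspace_subset right_subspace_zero) blast
  moreover have "0\<^sub>v n \<in> isotypic n X H Y 0"
    unfolding isotypic_def hull_def by (auto simp: right_subspace_def)
  ultimately have "isotypic n X H Y 0 = {0\<^sub>v n}" by blast
  then show ?thesis using Y by (auto simp: lowest_def intro!: eq_vecI)
qed

end


section \<open>Hermitian and skew-Hermitian forms\<close>

text \<open>The sign treats odd parts (Hermitian) and even parts (skew-Hermitian) together.
  Linearity is postulated in the right argument; the rules for the left one follow by
  symmetry.\<close>

locale epsilon_hermitian =
  fixes n :: nat and L :: "quat vec set" and B :: "quat vec \<Rightarrow> quat vec \<Rightarrow> quat" and \<epsilon> :: real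
  assumes L: "right_subspace UNIV n L"
    and eps: "\<epsilon> = 1 \<or> \<epsilon> = - 1"
    and add_right: "u \<in> L \<Longrightarrow> v \<in> L \<Longrightarrow> w \<in> L \<Longrightarrow> B u (v + w) = B u v + B u w"
    and smult_right: "u \<in> L \<Longrightarrow> v \<in> L \<Longrightarrow> B u (right_smult_vec v a) = B u v * a"
    and symmetry: "u \<in> L \<Longrightarrow> v \<in> L \<Longrightarrow> B v u = \<epsilon> *\<^sub>R qcnj (B u v)"
    and nondegenerate: "v \<in> L \<Longrightarrow> (\<And>u. u \<in> L \<Longrightarrow> B u v = 0) \<Longrightarrow> v = 0\<^sub>v n"
begin

lemma L_carrier: "v \<in> L \<Longrightarrow> v \<in> carrier_vec n"
  and L_add: "v \<in> L \<Longrightarrow> w \<in> L \<Longrightarrow> v + w \<in> L"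
  and L_smult: "v \<in> L \<Longrightarrow> right_smult_vec v a \<in> L"
  and L_zero: "0\<^sub>v n \<in> L"
  using L by (auto simp: right_subspace_def)

lemma add_left:
  assumes "u \<in> L" "v \<in> L" "w \<in> L"
  shows "B (u + v) w = B u w + B v w"
proof -
  have "B (u + v) w = \<epsilon> *\<^sub>R qcnj (B w u + B w v)"
    using assms by (simp add: symmetry[of w "u + v"] L_add add_right)
  also have "\<dots> = \<epsilon> *\<^sub>R qcnj (B w u) + \<epsilon> *\<^sub>R qcnj (B w v)" by (simp add: scaleR_add_right)
  also have "\<dots> = B u w + B v w" using assms by (simp only: symmetry[of w u] symmetry[of w v])
  finally show ?thesis .
qed

lemma smult_left:
  assumes "u \<in> L" "w \<in> L"
  shows "B (right_smult_vec u a) w = qcnj a * B u w"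
proof -
  have "B (right_smult_vec u a) w = \<epsilon> *\<^sub>R qcnj (B w u * a)"
    using assms by (simp add: symmetry[of w "right_smult_vec u a"] L_smult smult_right)
  also have "\<dots> = qcnj a * (\<epsilon> *\<^sub>R qcnj (B w u))" by (simp add: qcnj_mult)
  also have "\<epsilon> *\<^sub>R qcnj (B w u) = B u w" using assms by (simp only: symmetry[of w u])
  finally show ?thesis .
qed

lemma zero_right: "u \<in> L \<Longrightarrow> B u (0\<^sub>v n) = 0"
proof -
  assume u: "u \<in> L"
  show ?thesis using smult_right[OF u L_zero, of 0] by simp
qed

lemma orthogonal_sym: "u \<in> L \<Longrightarrow> v \<in> L \<Longrightarrow> B u v = 0 \<Longrightarrow> B v u = 0"
  by (subst symmetry[of u v]) simp_all

lemma combination_in_L: "set vs \<subseteq> L \<Longrightarrow> c \<in> carrier_vec (length vs) \<Longrightarrow> mat_of_cols n vs *\<^sub>v c \<in> L"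
  using right_subspace_mat_of_cols[OF L] by simp

lemma combination_right:
  assumes "u \<in> L" "set vs \<subseteq> L" "c \<in> carrier_vec (length vs)"
  shows "B u (mat_of_cols n vs *\<^sub>v c) = (\<Sum>i<length vs. B u (vs ! i) * c $ i)"
  using assms(2,3)
proof (induction vs arbitrary: c rule: rev_induct)
  case Nil
  have "mat_of_cols n [] *\<^sub>v c = 0\<^sub>v n" using Nil by (intro eq_vecI) (auto simp: scalar_prod_def)
  then show ?case using zero_right[OF assms(1)] by simp
next
  case (snoc w vs)
  define c1 where "c1 = vec (length vs) (\<lambda>i. c $ i)"
  have vs: "set vs \<subseteq> L" "w \<in> L" using snoc.prems by auto
  then have vs': "set vs \<subseteq> carrier_vec n" "w \<in> carrier_vec n" using L_carrier by auto
  have c1: "c1 \<in> carrier_vec (length vs)" by (simp add: c1_def)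
  have "mat_of_cols n (vs @ [w]) *\<^sub>v c = mat_of_cols n vs *\<^sub>v c1 + right_smult_vec w (c $ length vs)"
    unfolding c1_def using vs' snoc.prems by (intro mat_of_cols_snoc_mult) auto
  then have "B u (mat_of_cols n (vs @ [w]) *\<^sub>v c) =
      B u (mat_of_cols n vs *\<^sub>v c1) + B u w * c $ length vs"
    using assms(1) vs c1 by (simp add: add_right smult_right combination_in_L L_smult)
  also have "B u (mat_of_cols n vs *\<^sub>v c1) = (\<Sum>i<length vs. B u (vs ! i) * c $ i)"
    unfolding snoc.IH[OF vs(1) c1] by (intro sum.cong) (auto simp: c1_def)
  finally show ?case by (simp add: nth_append)
qed

text \<open>Everything except the distinctness depends on the set of basis vectors only, so that such a
  basis may be reordered freely.\<close>

definition orthogonal_list :: "quat vec list \<Rightarrow> bool" where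
  "orthogonal_list vs \<longleftrightarrow> distinct vs \<and> set vs \<subseteq> L \<and> (\<forall>v\<in>set vs. B v v \<noteq> 0) \<and>
     (\<forall>v\<in>set vs. \<forall>w\<in>set vs. v \<noteq> w \<longrightarrow> B v w = 0)"

definition orthogonal_basis :: "quat vec list \<Rightarrow> bool" where
  "orthogonal_basis vs \<longleftrightarrow>
     orthogonal_list vs \<and> (\<forall>u\<in>L. (\<forall>v\<in>set vs. B v u = 0) \<longrightarrow> u = 0\<^sub>v n)"

lemma orthogonal_basisD:
  assumes "orthogonal_basis vs"
  shows "orthogonal_list vs" "set vs \<subseteq> L"
  using assms by (simp_all add: orthogonal_basis_def orthogonal_list_def)

lemma orthogonal_coefficient:
  assumes vs: "orthogonal_list vs" and c: "c \<in> carrier_vec (length vs)" and i: "i < length vs"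
  shows "B (vs ! i) (mat_of_cols n vs *\<^sub>v c) = B (vs ! i) (vs ! i) * c $ i"
proof -
  have "B (vs ! i) (mat_of_cols n vs *\<^sub>v c) = (\<Sum>j<length vs. B (vs ! i) (vs ! j) * c $ j)"
    using vs c i by (intro combination_right) (auto simp: orthogonal_list_def)
  also have "\<dots> = (\<Sum>j<length vs. if j = i then B (vs ! i) (vs ! i) * c $ i else 0)"
    using vs i by (intro sum.cong) (auto simp: orthogonal_list_def nth_eq_iff_index_eq)
  finally show ?thesis using i by simp
qed

lemma orthogonal_list_indep:
  assumes vs: "orthogonal_list vs"
  shows "right_indep UNIV n vs"
  unfolding right_indep_def
proof (intro conjI ballI impI)
  show "set vs \<subseteq> carrier_vec n" using vs L_carrier by (auto simp: orthogonal_list_def)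
  fix c assume c: "c \<in> carrier_vec (length vs)" "mat_of_cols n vs *\<^sub>v c = 0\<^sub>v n"
  have "c $ i = 0" if i: "i < length vs" for i
  proof -
    have "vs ! i \<in> L" "B (vs ! i) (vs ! i) \<noteq> 0" using vs i by (auto simp: orthogonal_list_def)
    then show ?thesis using orthogonal_coefficient[OF vs c(1) i] c(2) zero_right by auto
  qed
  then show "c = 0\<^sub>v (length vs)" using c(1) by (intro eq_vecI) auto
qed

text \<open>Gram-Schmidt. The inverse stands on the left of \<open>B (vs ! i) v\<close> because
  coefficients multiply the vectors from the right.\<close>

lemma orthogonal_projection:
  assumes vs: "orthogonal_list vs" and v: "v \<in> L"
  defines "c \<equiv> vec (length vs) (\<lambda>i. - (inverse (B (vs ! i) (vs ! i)) * B (vs ! i) v))"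
  shows "v + mat_of_cols n vs *\<^sub>v c \<in> L" "w \<in> set vs \<Longrightarrow> B w (v + mat_of_cols n vs *\<^sub>v c) = 0"
proof -
  have c: "c \<in> carrier_vec (length vs)" by (simp add: c_def)
  have M: "mat_of_cols n vs *\<^sub>v c \<in> L" using vs c by (intro combination_in_L) (auto simp: orthogonal_list_def)
  then show "v + mat_of_cols n vs *\<^sub>v c \<in> L" using v by (intro L_add)
  assume "w \<in> set vs"
  then obtain i where i: "i < length vs" "w = vs ! i" by (auto simp: in_set_conv_nth)
  then have nz: "B (vs ! i) (vs ! i) \<noteq> 0" "vs ! i \<in> L" using vs by (auto simp: orthogonal_list_def)
  have "B w (v + mat_of_cols n vs *\<^sub>v c) = B w v + B w w * c $ i"
    using i nz v M orthogonal_coefficient[OF vs c i(1)] by (simp add: add_right)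
  also have "B w w * c $ i = - (B w w * inverse (B w w) * B w v)" using i by (simp add: c_def mult.assoc)
  finally show "B w (v + mat_of_cols n vs *\<^sub>v c) = 0" using nz i by simp
qed

text \<open>After the Gram-Schmidt correction \<open>v\<close> is orthogonal to the whole list,
  hence 0 by completeness; so \<open>v\<close> is a combination of the list.\<close>

lemma orthogonal_basis_right_basis:
  assumes vs: "orthogonal_basis vs"
  shows "right_basis UNIV n vs L"
  unfolding right_basis_iff[OF division_subring_UNIV L]
proof (intro conjI ballI)
  note ol = orthogonal_basisD(1)[OF vs]
  show "right_indep UNIV n vs" by (rule orthogonal_list_indep[OF ol])
  show sub: "set vs \<subseteq> L" by (rule orthogonal_basisD(2)[OF vs])
  fix v assume v: "v \<in> L"
  define c where "c = vec (length vs) (\<lambda>i. - (inverse (B (vs ! i) (vs ! i)) * B (vs ! i) v))"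
  have "v + mat_of_cols n vs *\<^sub>v c = 0\<^sub>v n"
    using vs orthogonal_projection[OF ol v] unfolding orthogonal_basis_def c_def by blast
  then have "(v + mat_of_cols n vs *\<^sub>v c) $ k = 0" if "k < n" for k using that by simp
  then have eq: "v $ k + (mat_of_cols n vs *\<^sub>v c) $ k = 0" if "k < n" for k using that L_carrier[OF v] by simp
  have "mat_of_cols n vs *\<^sub>v (- c) = v"
  proof (rule eq_vecI)
    fix k assume "k < dim_vec v"
    then have k: "k < n" using L_carrier[OF v] by simp
    have "(mat_of_cols n vs *\<^sub>v (- c)) $ k = - ((mat_of_cols n vs *\<^sub>v c) $ k)"
      using k by (simp add: scalar_prod_def c_def sum_negf)
    moreover have "v $ k = - ((mat_of_cols n vs *\<^sub>v c) $ k)"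
      using eq[OF k] by (simp only: eq_neg_iff_add_eq_0)
    ultimately show "(mat_of_cols n vs *\<^sub>v (- c)) $ k = v $ k" by metis
  qed (use L_carrier[OF v] in simp)
  then show "\<exists>c\<in>carrier_vec (length vs). (\<forall>i<length vs. c $ i \<in> UNIV) \<and> mat_of_cols n vs *\<^sub>v c = v"
    by (intro bexI[of _ "- c"]) (auto simp: c_def)
qed

text \<open>Over the quaternions this holds for skew-Hermitian forms too, since the scalar
  \<open>a\<close> may rotate the real part of \<open>B u w\<close> into an imaginary one.\<close>

lemma polarization:
  assumes S: "S \<subseteq> L" and S': "\<And>u w a. u \<in> S \<Longrightarrow> w \<in> S \<Longrightarrow> u + right_smult_vec w a \<in> S"
    and isotropic: "\<And>u. u \<in> S \<Longrightarrow> B u u = 0" and uw: "u \<in> S" "w \<in> S"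
  shows "B u w = 0"
proof -
  have L': "u \<in> L" "w \<in> L" using S uw by auto
  have eq: "B u w * a + \<epsilon> *\<^sub>R qcnj (B u w * a) = 0" for a
  proof -
    have "B (u + right_smult_vec w a) (u + right_smult_vec w a) =
        B u u + B u w * a + (qcnj a * B w u + qcnj a * B w w * a)"
      using L' by (simp add: add_left add_right smult_left smult_right L_add L_smult mult.assoc distrib_right)
    then show ?thesis
      using isotropic[OF S'[OF uw]] isotropic[OF uw(1)] isotropic[OF uw(2)] symmetry[OF L']
      by (simp add: qcnj_mult)
  qed
  obtain a b c d where x: "B u w = Quat a b c d" by (cases "B u w")
  \<comment> \<open>For \<epsilon> = 1 the equation kills the real part of \<open>B u w * a\<close>,
    for \<epsilon> = - 1 its imaginary part. Letting \<open>a\<close> run through the four units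
    kills every component of \<open>B u w\<close>.\<close>
  from eps show ?thesis
    using eq[of 1] eq[of "Quat 0 1 0 0"] eq[of "Quat 0 0 1 0"] eq[of "Quat 0 0 0 1"]
    unfolding x by (auto simp: quat_ops qcnj_def)
qed

text \<open>An orthogonal list of maximal length is a basis: on its orthogonal complement the form is
  isotropic, hence zero by polarization.\<close>

lemma orthogonal_basis_exists:
  assumes normal: "\<And>v. v \<in> L \<Longrightarrow> B v v \<noteq> 0 \<Longrightarrow> \<exists>a. a \<noteq> 0 \<and> qcnj a * B v v * a \<in> N" and N: "0 \<notin> N"
  obtains vs where "orthogonal_basis vs" "\<And>v. v \<in> set vs \<Longrightarrow> B v v \<in> N"
proof -
  let ?P = "\<lambda>vs. orthogonal_list vs \<and> (\<forall>v\<in>set vs. B v v \<in> N)"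
  have "?P []" by (simp add: orthogonal_list_def)
  moreover have "length vs < Suc n" if "?P vs" for vs
    using that orthogonal_list_indep right_indep_length_le_dim by (simp add: less_Suc_eq_le)
  ultimately obtain vs where vs: "?P vs" and max: "\<And>us. ?P us \<Longrightarrow> length us \<le> length vs"
    using ex_has_greatest_nat[of ?P "[]" length "Suc n"] by blast
  have sub: "set vs \<subseteq> L" using vs by (simp add: orthogonal_list_def)
  define S where "S = {u \<in> L. \<forall>v\<in>set vs. B v u = 0}"
  have iso: "B u u = 0" if u: "u \<in> S" for u
  proof (rule ccontr)
    assume nz: "B u u \<noteq> 0"
    have uL: "u \<in> L" using u by (simp add: S_def)
    obtain a where a: "a \<noteq> 0" "qcnj a * B u u * a \<in> N" using normal[OF uL nz] by blast
    define w where "w = right_smult_vec u a"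
    have w: "w \<in> L" "B w w \<in> N" using uL a by (simp_all add: w_def L_smult smult_left smult_right mult.assoc)
    have vw: "B v w = 0" "B w v = 0" if "v \<in> set vs" for v
    proof -
      have "v \<in> L" using that sub by blast
      then show "B v w = 0" using u that by (simp add: w_def S_def smult_right)
      then show "B w v = 0" using \<open>v \<in> L\<close> w(1) orthogonal_sym by blast
    qed
    have "B w w \<noteq> 0" using w(2) N by metis
    then have "w \<notin> set vs" using vw by blast
    then have "orthogonal_list (vs @ [w])"
      using conjunct1[OF vs] vw w(1) \<open>B w w \<noteq> 0\<close> unfolding orthogonal_list_def by simp
    then have "?P (vs @ [w])" using vs w(2) by simp
    then show False using max[of "vs @ [w]"] by simp
  qed
  have closed: "u + right_smult_vec w a \<in> S" if "u \<in> S" "w \<in> S" for u w a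
  proof -
    have L': "u \<in> L" "w \<in> L" using that by (simp_all add: S_def)
    have "B v (u + right_smult_vec w a) = 0" if v: "v \<in> set vs" for v
    proof -
      have "v \<in> L" "B v u = 0" "B v w = 0" using v sub \<open>u \<in> S\<close> \<open>w \<in> S\<close> by (auto simp: S_def)
      then show ?thesis using L' by (simp add: add_right smult_right L_smult)
    qed
    then show ?thesis using L' by (simp add: S_def L_add L_smult)
  qed
  have SS: "B u w = 0" if "u \<in> S" "w \<in> S" for u w
    by (rule polarization[OF _ closed iso that]) (auto simp: S_def)
  have "u = 0\<^sub>v n" if u: "u \<in> S" for u
  proof (rule nondegenerate)
    show uL: "u \<in> L" using u by (simp add: S_def)
    fix v assume v: "v \<in> L"
    \<comment> \<open>Against \<open>u\<close> only \<open>v\<close> modulo the span of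
      \<open>vs\<close> matters, and the corrected \<open>v\<close> lies in \<open>S\<close>, where
      the form vanishes.\<close>
    define c where "c = vec (length vs) (\<lambda>i. - (inverse (B (vs ! i) (vs ! i)) * B (vs ! i) v))"
    have vS: "v + mat_of_cols n vs *\<^sub>v c \<in> S"
      using orthogonal_projection[of vs v] vs v unfolding S_def c_def by blast
    have c: "c \<in> carrier_vec (length vs)" by (simp add: c_def)
    have uv: "B u (vs ! i) = 0" if "i < length vs" for i
      using that u uL sub by (intro orthogonal_sym[of "vs ! i" u]) (auto simp: S_def)
    have "B u (mat_of_cols n vs *\<^sub>v c) = 0"
      unfolding combination_right[OF uL sub c] by (intro sum.neutral) (simp add: uv)
    moreover have "B u (v + mat_of_cols n vs *\<^sub>v c) = 0" using SS u vS by blast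
    ultimately have "B u v = 0"
      using add_right[OF uL v combination_in_L[OF sub c]] by simp
    then show "B v u = 0" using uL v orthogonal_sym by blast
  qed
  then have "orthogonal_basis vs"
    using vs unfolding orthogonal_basis_def S_def by blast
  then show ?thesis using that vs by blast
qed

lemma combination_self:
  assumes vs: "orthogonal_list vs" and c: "c \<in> carrier_vec (length vs)"
  shows "B (mat_of_cols n vs *\<^sub>v c) (mat_of_cols n vs *\<^sub>v c) =
    (\<Sum>i<length vs. qcnj (c $ i) * B (vs ! i) (vs ! i) * c $ i)"
proof -
  let ?v = "mat_of_cols n vs *\<^sub>v c"
  have sub: "set vs \<subseteq> L" using vs by (simp add: orthogonal_list_def)
  have vL: "?v \<in> L" using sub c by (rule combination_in_L)
  have "B ?v (vs ! i) * c $ i = qcnj (c $ i) * B (vs ! i) (vs ! i) * c $ i" if i: "i < length vs" for i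
  proof -
    have viL: "vs ! i \<in> L" using sub i by auto
    have "B ?v (vs ! i) = \<epsilon> *\<^sub>R qcnj (B (vs ! i) ?v)" by (rule symmetry[OF viL vL])
    also have "\<dots> = qcnj (c $ i) * (\<epsilon> *\<^sub>R qcnj (B (vs ! i) (vs ! i)))"
      unfolding orthogonal_coefficient[OF vs c i] by (simp add: qcnj_mult)
    also have "\<epsilon> *\<^sub>R qcnj (B (vs ! i) (vs ! i)) = B (vs ! i) (vs ! i)"
      by (rule symmetry[OF viL viL, symmetric])
    finally show ?thesis by simp
  qed
  then show ?thesis unfolding combination_right[OF vL sub c] by (intro sum.cong) auto
qed

end

section \<open>Signature and orthogonal bases\<close>

lemma Rq_qcnj_mult_self: "Rq (qcnj x * of_real s * x) = s * (norm x)\<^sup>2"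
proof -
  have "qcnj x * of_real s * x = of_real s * (qcnj x * x)"
    by (simp only: of_real_quat_commute[of s] mult.assoc)
  then show ?thesis unfolding qcnj_mult_self of_real_mult[symmetric] by (simp only: Rq_simps)
qed

text \<open>Sylvester's law of inertia: a positive definite subspace of dimension above
  \<open>length ps\<close> would contain a nonzero vector orthogonal to \<open>ps\<close>, and there
  the form is at most 0.\<close>

lemma (in epsilon_hermitian) positive_index_eq:
  assumes b: "orthogonal_basis (ps @ ns)"
    and ps: "\<And>v. v \<in> set ps \<Longrightarrow> B v v = 1" and ns: "\<And>v. v \<in> set ns \<Longrightarrow> B v v = - 1"
  shows "positive_index n L B = length ps"
proof -
  let ?D = "{right_dim UNIV n W | W. right_subspace UNIV n W \<and> W \<subseteq> L \<and> (\<forall>v\<in>W. v \<noteq> 0\<^sub>v n \<longrightarrow> Rq (B v v) > 0)}"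
  let ?vs = "ps @ ns"
  note ol = orthogonal_basisD(1)[OF b] and rb = orthogonal_basis_right_basis[OF b]
  have olp: "orthogonal_list ps" using ol by (auto simp: orthogonal_list_def)
  have psL: "set ps \<subseteq> L" using olp by (simp add: orthogonal_list_def)
  have le: "right_dim UNIV n W \<le> length ps"
    if W: "right_subspace UNIV n W" "W \<subseteq> L" and pos: "\<And>v. v \<in> W \<Longrightarrow> v \<noteq> 0\<^sub>v n \<Longrightarrow> Rq (B v v) > 0" for W
  proof (rule ccontr)
    assume gt: "\<not> ?thesis"
    obtain ws where ws: "right_basis UNIV n ws W" "right_dim UNIV n W = length ws"
      using right_basis_exists[OF W(1)] by metis
    have wsi: "right_indep UNIV n ws" "set ws \<subseteq> W" using ws(1) by (auto simp: right_basis_iff[OF _ W(1)])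
    \<comment> \<open>A kernel vector of \<open>A\<close> gives a vector of \<open>W\<close>
      orthogonal to \<open>ps\<close>, whose expansion therefore involves only
      \<open>ns\<close>.\<close>
    define A where "A = mat (length ps) (length ws) (\<lambda>(i, j). B (ps ! i) (ws ! j))"
    have A: "A \<in> carrier_mat (length ps) (length ws)" by (simp add: A_def)
    obtain x where x: "x \<in> carrier_vec (length ws)" "x \<noteq> 0\<^sub>v (length ws)" "A *\<^sub>v x = 0\<^sub>v (length ps)"
      using wide_mat_kernel[OF division_subring_UNIV A] gt ws(2) by (metis UNIV_I not_le)
    define w where "w = mat_of_cols n ws *\<^sub>v x"
    have "w \<noteq> 0\<^sub>v n" using wsi(1) x(1,2) by (auto simp: right_indep_def w_def)
    have wW: "w \<in> W" unfolding w_def using W(1) wsi(2) x(1) by (intro right_subspace_mat_of_cols) auto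
    then have wL: "w \<in> L" using W(2) by blast
    obtain c where c: "c \<in> carrier_vec (length ?vs)" "mat_of_cols n ?vs *\<^sub>v c = w"
      using rb wL unfolding right_basis_iff[OF division_subring_UNIV L] by blast
    have "c $ i = 0" if i: "i < length ps" for i
    proof -
      have "B (ps ! i) w = (\<Sum>j<length ws. B (ps ! i) (ws ! j) * x $ j)"
        unfolding w_def using psL i wsi W(2) x(1) by (intro combination_right) auto
      also have "\<dots> = (A *\<^sub>v x) $ i"
        using i x(1) by (auto simp: A_def scalar_prod_def atLeast0LessThan intro!: sum.cong)
      finally have "B (ps ! i) w = 0" using x(3) i by simp
      moreover have "B (?vs ! i) w = B (?vs ! i) (?vs ! i) * c $ i"
        using orthogonal_coefficient[OF ol c(1), of i] i c(2) by simp
      moreover have "B (?vs ! i) (?vs ! i) = 1" using ps i by (simp add: nth_append)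
      ultimately show ?thesis using i by (simp add: nth_append)
    qed
    moreover have "B (?vs ! i) (?vs ! i) = of_real (- 1)" if "i < length ?vs" "\<not> i < length ps" for i
      using ns that by (auto simp: nth_append)
    ultimately have "Rq (qcnj (c $ i) * B (?vs ! i) (?vs ! i) * c $ i) \<le> 0" if "i < length ?vs" for i
      using that Rq_qcnj_mult_self[of "c $ i" "- 1"] by (cases "i < length ps") auto
    then have "Rq (B w w) \<le> 0"
      unfolding c(2)[symmetric] combination_self[OF ol c(1)] Rq_sum by (intro sum_nonpos) auto
    then show False using pos[OF wW \<open>w \<noteq> 0\<^sub>v n\<close>] by simp
  qed
  \<comment> \<open>The span of \<open>ps\<close> attains the bound.\<close>
  define W where "W = {mat_of_cols n ps *\<^sub>v c | c. c \<in> carrier_vec (length ps)}"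
  have zero: "mat_of_cols n ps *\<^sub>v 0\<^sub>v (length ps) = 0\<^sub>v n" by (rule eq_vecI) auto
  have W: "right_subspace UNIV n W"
    unfolding right_subspace_def
  proof (intro conjI ballI)
    show "W \<subseteq> carrier_vec n" by (auto simp: W_def)
    show "0\<^sub>v n \<in> W"
      unfolding W_def
      by (intro CollectI exI[of _ "0\<^sub>v (length ps)"] conjI zero[symmetric] zero_carrier_vec)
    fix v assume "v \<in> W"
    then obtain c where c: "v = mat_of_cols n ps *\<^sub>v c" "c \<in> carrier_vec (length ps)" by (auto simp: W_def)
    show "v + w \<in> W" if "w \<in> W" for w
    proof -
      obtain e where e: "w = mat_of_cols n ps *\<^sub>v e" "e \<in> carrier_vec (length ps)"
        using \<open>w \<in> W\<close> by (auto simp: W_def)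
      have "v + w = mat_of_cols n ps *\<^sub>v (c + e)"
        using c e by (simp add: mult_add_distrib_mat_vec[of _ n "length ps"])
      then show ?thesis unfolding W_def using c(2) e(2) by (intro CollectI exI[of _ "c + e"]) simp
    qed
    fix a
    have "right_smult_vec v a = mat_of_cols n ps *\<^sub>v right_smult_vec c a"
      using c by (intro eq_vecI) (auto simp: scalar_prod_def sum_distrib_right mult.assoc)
    then show "right_smult_vec v a \<in> W"
      unfolding W_def using c(2) by (intro CollectI exI[of _ "right_smult_vec c a"]) simp
  qed
  have "mat_of_cols n ps *\<^sub>v unit_vec (length ps) i \<in> W" for i by (auto simp: W_def)
  then have psW: "set ps \<subseteq> W"
    using mat_of_cols_mult_unit[of _ ps n] psL L_carrier
    by (metis in_set_conv_nth subset_iff)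
  have "right_basis UNIV n ps W"
    unfolding right_basis_iff[OF division_subring_UNIV W]
    using orthogonal_list_indep[OF olp] psW by (auto simp: W_def)
  then have dim: "right_dim UNIV n W = length ps" using right_dim_eq[OF _ W] by simp
  have "Rq (B v v) > 0" if "v \<in> W" "v \<noteq> 0\<^sub>v n" for v
  proof -
    obtain c where c: "v = mat_of_cols n ps *\<^sub>v c" "c \<in> carrier_vec (length ps)"
      using \<open>v \<in> W\<close> by (auto simp: W_def)
    have "\<exists>i<length ps. c $ i \<noteq> 0"
    proof (rule ccontr)
      assume "\<not> ?thesis"
      then have "c = 0\<^sub>v (length ps)" using c(2) by (intro eq_vecI) auto
      then show False using zero c(1) that(2) by simp
    qed
    then obtain i where i: "i < length ps" "c $ i \<noteq> 0" by blast
    have "Rq (B v v) = (\<Sum>i<length ps. Rq (qcnj (c $ i) * of_real 1 * c $ i))"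
      unfolding c(1) combination_self[OF olp c(2)] Rq_sum using ps by (intro sum.cong) auto
    also have "\<dots> = (\<Sum>i<length ps. (norm (c $ i))\<^sup>2)" by (simp only: Rq_qcnj_mult_self mult_1)
    also have "\<dots> > 0" using i by (intro sum_pos2[of _ i]) auto
    finally show ?thesis .
  qed
  moreover have "W \<subseteq> L" unfolding W_def using combination_in_L[OF psL] by blast
  ultimately have mem: "length ps \<in> ?D" using W dim by (intro CollectI exI[of _ W]) simp
  have ub: "k \<le> length ps" if "k \<in> ?D" for k using that le by blast
  have "?D \<subseteq> {..length ps}" using ub by blast
  then have fin: "finite ?D" by (rule finite_subset) simp
  show ?thesis unfolding positive_index_def by (rule Max_eqI[OF fin ub mem])
qed

text \<open>Negating the form exchanges the roles of \<open>ps\<close> and \<open>ns\<close>, and an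
  orthogonal basis may be reordered.\<close>

lemma (in epsilon_hermitian) negative_index_eq:
  assumes b: "orthogonal_basis (ps @ ns)"
    and ps: "\<And>v. v \<in> set ps \<Longrightarrow> B v v = 1" and ns: "\<And>v. v \<in> set ns \<Longrightarrow> B v v = - 1"
  shows "negative_index n L B = length ns"
proof -
  interpret neg: epsilon_hermitian n L "\<lambda>v u. - B v u" \<epsilon>
  proof (rule epsilon_hermitian.intro[OF L eps])
    show "- B u (v + w) = - B u v + - B u w" if "u \<in> L" "v \<in> L" "w \<in> L" for u v w
      using add_right[OF that] by simp
    show "- B u (right_smult_vec v a) = - B u v * a" if "u \<in> L" "v \<in> L" for u v a
      using smult_right[OF that] by simp
    show "- B v u = \<epsilon> *\<^sub>R qcnj (- B u v)" if "u \<in> L" "v \<in> L" for u v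
      using symmetry[OF that] by simp
    show "v = 0\<^sub>v n" if "v \<in> L" "\<And>u. u \<in> L \<Longrightarrow> - B u v = 0" for v
      using that by (intro nondegenerate) auto
  qed
  have "neg.orthogonal_basis (ns @ ps)"
  proof -
    have "distinct (ns @ ps)" using orthogonal_basisD(1)[OF b] by (auto simp: orthogonal_list_def)
    moreover have "set (ns @ ps) = set (ps @ ns)" by auto
    ultimately show ?thesis
      using b unfolding orthogonal_basis_def neg.orthogonal_basis_def orthogonal_list_def
        neg.orthogonal_list_def neg_equal_0_iff_equal by metis
  qed
  then show ?thesis unfolding negative_index_def
    using ps ns by (intro neg.positive_index_eq) auto
qed


section \<open>The invariant form on the lowest weight spaces\<close>

lemma mult_mat_assoc:
  "dim_col A = dim_row B \<Longrightarrow> dim_col B = dim_row C \<Longrightarrow> A * B * C = A * (B * (C :: 'a :: semiring_0 mat))"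
  by (rule assoc_mult_mat[of _ "dim_row A" "dim_col A" _ "dim_col B" _ "dim_col C"]) auto

lemma mat_star_dim [simp]: "dim_row (mat_star A) = dim_col A" "dim_col (mat_star A) = dim_row A"
  by (simp_all add: mat_star_def)

lemma mat_star_index [simp]: "i < dim_col A \<Longrightarrow> j < dim_row A \<Longrightarrow> mat_star A $$ (i, j) = qcnj (A $$ (j, i))"
  by (simp add: mat_star_def)

lemma mat_star_mat_star [simp]: "mat_star (mat_star A) = A"
  by (rule eq_matI) auto

lemma mat_star_mult: "dim_col A = dim_row B \<Longrightarrow> mat_star (A * B) = mat_star B * mat_star A"
  by (rule eq_matI) (auto simp: scalar_prod_def qcnj_sum qcnj_mult intro!: sum.cong)

lemma I_pq_carrier [simp]: "I_pq p q \<in> carrier_mat (p + q) (p + q)"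
  and I_pq_dim [simp]: "dim_row (I_pq p q) = p + q" "dim_col (I_pq p q) = p + q"
  and I_pq_index: "i < p + q \<Longrightarrow> j < p + q \<Longrightarrow>
    I_pq p q $$ (i, j) = (if i = j then (if i < p then 1 else - 1) else 0)"
  by (simp_all add: I_pq_def)

lemma I_pq_mult_vec:
  assumes "w \<in> carrier_vec (p + q)" "i < p + q"
  shows "(I_pq p q *\<^sub>v w) $ i = (if i < p then w $ i else - w $ i)"
proof -
  have "(I_pq p q *\<^sub>v w) $ i = (\<Sum>j = 0..<p + q. I_pq p q $$ (i, j) * w $ j)"
    using assms by (simp add: scalar_prod_def)
  also have "\<dots> = (\<Sum>j = 0..<p + q. if j = i then (if i < p then w $ i else - w $ i) else 0)"
    using assms by (intro sum.cong) (auto simp: I_pq_index)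
  finally show ?thesis using assms by simp
qed

lemma I_pq_square: "I_pq p q * I_pq p q = 1\<^sub>m (p + q)"
proof (rule eq_matI)
  fix i j assume "i < dim_row (1\<^sub>m (p + q) :: quat mat)" "j < dim_col (1\<^sub>m (p + q) :: quat mat)"
  then have ij: "i < p + q" "j < p + q" by auto
  have "(I_pq p q * I_pq p q) $$ (i, j) = (I_pq p q *\<^sub>v col (I_pq p q) j) $ i"
    using ij by simp
  also have "\<dots> = (if i < p then I_pq p q $$ (i, j) else - I_pq p q $$ (i, j))"
    using ij by (subst I_pq_mult_vec) (auto simp del: index_mult_mat_vec)
  finally show "(I_pq p q * I_pq p q) $$ (i, j) = 1\<^sub>m (p + q) $$ (i, j)"
    using ij by (auto simp: I_pq_index)
qed auto

lemma form_pq_expand: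
  assumes "v \<in> carrier_vec (p + q)" "w \<in> carrier_vec (p + q)"
  shows "form_pq p q v w = (\<Sum>i<p + q. qcnj (v $ i) * (if i < p then w $ i else - w $ i))"
  using assms
  by (auto simp: form_pq_def scalar_prod_def atLeast0LessThan I_pq_mult_vec simp del: index_mult_mat_vec
      intro!: sum.cong)

lemma form_pq_add_right:
  assumes "u \<in> carrier_vec (p + q)" "v \<in> carrier_vec (p + q)" "w \<in> carrier_vec (p + q)"
  shows "form_pq p q u (v + w) = form_pq p q u v + form_pq p q u w"
  using assms
  by (simp add: form_pq_expand sum.distrib[symmetric]) (intro sum.cong; simp add: distrib_left algebra_simps)

lemma form_pq_smult_right:
  assumes "u \<in> carrier_vec (p + q)" "v \<in> carrier_vec (p + q)"
  shows "form_pq p q u (right_smult_vec v a) = form_pq p q u v * a"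
  using assms
  by (simp add: form_pq_expand sum_distrib_right) (intro sum.cong; simp add: mult.assoc)

lemma form_pq_sym:
  assumes "u \<in> carrier_vec (p + q)" "v \<in> carrier_vec (p + q)"
  shows "form_pq p q v u = qcnj (form_pq p q u v)"
  using assms by (simp add: form_pq_expand qcnj_sum) (intro sum.cong; simp add: qcnj_mult)

lemma form_pq_smult_left:
  assumes "u \<in> carrier_vec (p + q)" "v \<in> carrier_vec (p + q)"
  shows "form_pq p q (right_smult_vec u a) v = qcnj a * form_pq p q u v"
  using assms
  by (simp add: form_pq_expand sum_distrib_left) (intro sum.cong; simp add: qcnj_mult mult.assoc)

lemma form_pq_zero [simp]:
  "v \<in> carrier_vec (p + q) \<Longrightarrow> form_pq p q v (0\<^sub>v (p + q)) = 0"
  "v \<in> carrier_vec (p + q) \<Longrightarrow> form_pq p q (0\<^sub>v (p + q)) v = 0"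
  by (simp_all add: form_pq_expand sum.neutral)

lemma minus_one_pow_square: "(- 1) ^ k * (- 1) ^ k = (1 :: 'a :: ring_1)"
  by (induction k) auto

lemma form_pq_nondegenerate:
  assumes v: "v \<in> carrier_vec (p + q)" and 0: "\<And>w. w \<in> carrier_vec (p + q) \<Longrightarrow> form_pq p q v w = 0"
  shows "v = 0\<^sub>v (p + q)"
proof (rule eq_vecI)
  fix i assume "i < dim_vec (0\<^sub>v (p + q) :: quat vec)"
  then have i: "i < p + q" by simp
  have "form_pq p q v (unit_vec (p + q) i) =
      (\<Sum>j<p + q. if j = i then (if i < p then qcnj (v $ i) else - qcnj (v $ i)) else 0)"
    unfolding form_pq_expand[OF v unit_vec_carrier] by (intro sum.cong) (auto simp: unit_vec_def)
  then have "(if i < p then qcnj (v $ i) else - qcnj (v $ i)) = 0"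
    using 0[of "unit_vec (p + q) i"] i by simp
  then show "v $ i = 0\<^sub>v (p + q) $ i" using i by (simp split: if_splits)
qed (use v in simp)

lemma gram_index:
  assumes "M \<in> carrier_mat (p + q) a" "N \<in> carrier_mat (p + q) b" "i < a" "j < b"
  shows "(mat_star M * (I_pq p q * N)) $$ (i, j) = form_pq p q (col M i) (col N j)"
proof -
  have "(mat_star M * (I_pq p q * N)) $$ (i, j) = row (mat_star M) i \<bullet> col (I_pq p q * N) j"
    using assms by (intro index_mult_mat(1)) auto
  also have "row (mat_star M) i = map_vec qcnj (col M i)"
    using assms by (intro eq_vecI) auto
  also have "col (I_pq p q * N) j = I_pq p q *\<^sub>v col N j"
    using assms by (intro col_mult2) auto
  finally show ?thesis by (simp add: form_pq_def)
qed

locale sp_triple = sl2_matrices "p + q" X H Y for p q :: nat and X H Y :: "quat mat" +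
  assumes skew_X: "v \<in> carrier_vec (p + q) \<Longrightarrow> w \<in> carrier_vec (p + q) \<Longrightarrow>
      form_pq p q (X *\<^sub>v v) w = - form_pq p q v (X *\<^sub>v w)"
    and skew_H: "v \<in> carrier_vec (p + q) \<Longrightarrow> w \<in> carrier_vec (p + q) \<Longrightarrow>
      form_pq p q (H *\<^sub>v v) w = - form_pq p q v (H *\<^sub>v w)"
begin

abbreviation "N \<equiv> p + q"

lemma X_pow_carrier [simp]: "X ^\<^sub>m k \<in> carrier_mat N N"
  using X by simp

lemma X_pow_Suc_vec:
  assumes "v \<in> carrier_vec N"
  shows "X ^\<^sub>m Suc k *\<^sub>v v = X *\<^sub>v (X ^\<^sub>m k *\<^sub>v v)" "X ^\<^sub>m Suc k *\<^sub>v v = X ^\<^sub>m k *\<^sub>v (X *\<^sub>v v)"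
proof -
  show "X ^\<^sub>m Suc k *\<^sub>v v = X *\<^sub>v (X ^\<^sub>m k *\<^sub>v v)"
    unfolding pow_mat_Suc_left[OF X] using X assms X_pow_carrier[of k] by (intro assoc_mult_mat_vec) auto
  show "X ^\<^sub>m Suc k *\<^sub>v v = X ^\<^sub>m k *\<^sub>v (X *\<^sub>v v)"
    using X assms X_pow_carrier[of k] unfolding pow_mat.simps by (intro assoc_mult_mat_vec) auto
qed

lemma X_pow_add: "X ^\<^sub>m a * X ^\<^sub>m b = X ^\<^sub>m (a + b)"
proof (induction a)
  case 0
  then show ?case using X left_mult_one_mat[OF X_pow_carrier[of b]] by auto
next
  case (Suc a)
  then show ?case
    using X by (simp del: pow_mat.simps add: pow_mat_Suc_left mult_mat_assoc)
qed

lemma X_pow_add_vec: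
  assumes "v \<in> carrier_vec N"
  shows "X ^\<^sub>m a *\<^sub>v (X ^\<^sub>m b *\<^sub>v v) = X ^\<^sub>m (a + b) *\<^sub>v v"
  using assoc_mult_mat_vec[OF X_pow_carrier X_pow_carrier assms, of a b] by (simp add: X_pow_add)

lemma skew_X_pow:
  assumes "v \<in> carrier_vec N" "w \<in> carrier_vec N"
  shows "form_pq p q (X ^\<^sub>m k *\<^sub>v v) w = (- 1) ^ k * form_pq p q v (X ^\<^sub>m k *\<^sub>v w)"
  using assms
proof (induction k arbitrary: w)
  case 0
  then show ?case using X by simp
next
  case (Suc k)
  have Xw: "X *\<^sub>v w \<in> carrier_vec N" using X Suc.prems by simp
  show ?case
    using Suc.IH[OF Suc.prems(1) Xw] Suc.prems Xw
    by (simp add: X_pow_Suc_vec(1)[OF Suc.prems(1)] X_pow_Suc_vec(2)[OF Suc.prems(2)] skew_X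
        del: pow_mat.simps)
qed

text \<open>These two commutations drive the weight argument. Since the identity qualifies as well,
  the same lemma yields the duality of the bases and the splitting of centralizer elements.\<close>

definition commuting :: "quat mat \<Rightarrow> bool" where
  "commuting g \<longleftrightarrow> g \<in> carrier_mat N N \<and> g * X = X * g \<and> g * H = H * g"

lemma commuting_one: "commuting (1\<^sub>m N)"
  using X H by (simp add: commuting_def)

lemma commuting_X_pow:
  assumes "commuting g"
  shows "g * X ^\<^sub>m k = X ^\<^sub>m k * g"
proof (induction k)
  case 0
  then show ?case using assms X by (auto simp: commuting_def)
next
  case (Suc k)
  have g: "g \<in> carrier_mat N N" "g * X = X * g" using assms by (auto simp: commuting_def)
  have "g * X ^\<^sub>m Suc k = g * X ^\<^sub>m k * X" using g X by (simp add: mult_mat_assoc)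
  also have "\<dots> = X ^\<^sub>m k * (g * X)" unfolding Suc using g X by (simp add: mult_mat_assoc)
  also have "\<dots> = X ^\<^sub>m Suc k * g" unfolding g(2) using g X by (simp add: mult_mat_assoc)
  finally show ?case .
qed

text \<open>Weight argument: \<open>H\<close> acts with weight \<open>1 - d\<close> on the left entry and with weight
  \<open>2 k + 1 - e\<close> on the right entry, and these have to be opposite.\<close>

lemma form_lw_eq_0:
  assumes v: "v \<in> lw d" and w: "w \<in> lw e" and g: "commuting g" and ne: "\<not> (d = e \<and> Suc k = d)"
  shows "form_pq p q v (g *\<^sub>v (X ^\<^sub>m k *\<^sub>v w)) = 0"
proof (rule ccontr)
  let ?a = "form_pq p q v (g *\<^sub>v (X ^\<^sub>m k *\<^sub>v w))"
  assume nz: "?a \<noteq> 0"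
  have g': "g \<in> carrier_mat N N" "g * H = H * g" using g by (auto simp: commuting_def)
  have vc: "v \<in> carrier_vec N" "w \<in> carrier_vec N" using v w by (auto intro: lw_carrier)
  have Xw: "X ^\<^sub>m k *\<^sub>v w \<in> carrier_vec N" using vc by simp
  have gXw: "g *\<^sub>v (X ^\<^sub>m k *\<^sub>v w) \<in> carrier_vec N"
    by (rule mult_mat_vec_carrier[OF g'(1) Xw])

  have "H *\<^sub>v (g *\<^sub>v (X ^\<^sub>m k *\<^sub>v w)) = g *\<^sub>v (H *\<^sub>v (X ^\<^sub>m k *\<^sub>v w))"
    using assoc_mult_mat_vec[OF H g'(1) Xw] assoc_mult_mat_vec[OF g'(1) H Xw] g'(2) by metis
  also have "\<dots> = right_smult_vec (g *\<^sub>v (X ^\<^sub>m k *\<^sub>v w)) (of_real (2 * real k + 1 - real e))"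
    unfolding lw_H[OF w] by (rule mult_mat_vec_right_smult[OF g'(1) Xw])
  finally have Hg: "H *\<^sub>v (g *\<^sub>v (X ^\<^sub>m k *\<^sub>v w)) =
      right_smult_vec (g *\<^sub>v (X ^\<^sub>m k *\<^sub>v w)) (of_real (2 * real k + 1 - real e))" .
  have Hv: "H *\<^sub>v v = right_smult_vec v (of_real (1 - real d))" using v by (simp add: lw_def)
  have "(1 - real d) *\<^sub>R ?a = form_pq p q (H *\<^sub>v v) (g *\<^sub>v (X ^\<^sub>m k *\<^sub>v w))"
    unfolding Hv form_pq_smult_left[OF vc(1) gXw] qcnj_of_real by (rule scaleR_conv_of_real)
  also have "\<dots> = - (?a * of_real (2 * real k + 1 - real e))"
    unfolding skew_H[OF vc(1) gXw] Hg form_pq_smult_right[OF vc(1) gXw] ..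
  also have "\<dots> = - ((2 * real k + 1 - real e) *\<^sub>R ?a)"
    by (simp only: of_real_quat_commute[symmetric] scaleR_conv_of_real)
  finally have "((1 - real d) + (2 * real k + 1 - real e)) *\<^sub>R ?a = 0"
    by (simp only: scaleR_add_left) simp
  then have "real (2 * k + 2) = real (d + e)" using nz by simp
  then have sum: "2 * k + 2 = d + e" by linarith
  \<comment> \<open>With \<open>k < e\<close> and \<open>k < d\<close>, the equation
    \<open>2 * k + 2 = d + e\<close> leaves only \<open>d = e = k + 1\<close>. If
    \<open>k \<ge> d\<close>, then \<open>X^k\<close> kills \<open>v\<close> once it is moved to the
    left argument.\<close>
  have "k < e"
  proof (rule ccontr)
    assume "\<not> k < e"
    then have "X ^\<^sub>m k *\<^sub>v w = 0\<^sub>v N" using w by (intro lw_X_pow_eq_0) auto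
    then have "g *\<^sub>v (X ^\<^sub>m k *\<^sub>v w) = 0\<^sub>v N" using g' by (auto intro!: eq_vecI)
    then show False using nz vc by simp
  qed
  moreover have "k < d"
  proof (rule ccontr)
    assume "\<not> k < d"
    then have 0: "X ^\<^sub>m k *\<^sub>v v = 0\<^sub>v N" using v by (intro lw_X_pow_eq_0) auto
    have "g *\<^sub>v (X ^\<^sub>m k *\<^sub>v w) = X ^\<^sub>m k *\<^sub>v (g *\<^sub>v w)"
      using assoc_mult_mat_vec[OF X_pow_carrier g'(1) vc(2), of k]
        assoc_mult_mat_vec[OF g'(1) X_pow_carrier vc(2), of k] commuting_X_pow[OF g, of k] by metis
    moreover have gw: "g *\<^sub>v w \<in> carrier_vec N" using g' vc by (intro mult_mat_vec_carrier)
    ultimately have "(- 1) ^ k * ?a = form_pq p q (X ^\<^sub>m k *\<^sub>v v) (g *\<^sub>v w)"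
      using skew_X_pow[OF vc(1) gw, of k] by simp
    also have "\<dots> = 0" unfolding 0 using gw by simp
    finally show False using nz by simp
  qed
  ultimately show False using sum ne by linarith
qed

text \<open>By weights, \<open>z = X^(d-1) v\<close> is orthogonal to every string vector except
  possibly those in \<open>lw d\<close> itself, where the hypothesis applies. So
  \<open>z = 0\<close>, and \<open>X^(d-1)\<close> is injective on \<open>lw d\<close>.\<close>

lemma form_d_nondegenerate:
  assumes v: "v \<in> lw d" and d: "d > 0" and 0: "\<And>u. u \<in> lw d \<Longrightarrow> form_d p q X d u v = 0"
  shows "v = 0\<^sub>v N"
proof -
  have vc: "v \<in> carrier_vec N" using v by (rule lw_carrier)
  define z where "z = X ^\<^sub>m (d - 1) *\<^sub>v v"
  have z: "z \<in> carrier_vec N" using vc by (simp add: z_def)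
  \<comment> \<open>The functional \<open>form_pq p q z\<close> as a matrix with one row, to which
    \<open>mat_eq_on_lw\<close> applies.\<close>
  define P where "P = mat 1 N (\<lambda>(_, j). if j < p then qcnj (z $ j) else - qcnj (z $ j))"
  have P: "P \<in> carrier_mat 1 N" by (simp add: P_def)
  have Pw: "P *\<^sub>v w = vec 1 (\<lambda>_. form_pq p q z w)" if "w \<in> carrier_vec N" for w
    using that z
    by (intro eq_vecI) (auto simp: P_def scalar_prod_def form_pq_expand atLeast0LessThan intro!: sum.cong)
  have "P = 0\<^sub>m 1 N"
  proof (rule mat_eq_on_lw[OF P])
    fix e l u assume u: "u \<in> lw e" and l: "l < e"
    have uc: "u \<in> carrier_vec N" using u by (rule lw_carrier)
    have "form_pq p q z (X ^\<^sub>m l *\<^sub>v u) = (- 1) ^ (d - 1) * form_pq p q v (X ^\<^sub>m (d - 1 + l) *\<^sub>v u)"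
      unfolding z_def using vc uc by (simp add: skew_X_pow X_pow_add_vec)
    also have "form_pq p q v (X ^\<^sub>m (d - 1 + l) *\<^sub>v u) = 0"
    proof (cases "d = e \<and> l = 0")
      case True
      have "form_pq p q v (X ^\<^sub>m (d - 1) *\<^sub>v u) = (- 1) ^ (d - 1) * ((- 1) ^ (d - 1) * form_pq p q v (X ^\<^sub>m (d - 1) *\<^sub>v u))"
        unfolding mult.assoc[symmetric] minus_one_pow_square by simp
      also have "\<dots> = (- 1) ^ (d - 1) * form_pq p q z u"
        unfolding z_def using vc uc by (simp add: skew_X_pow)
      also have "form_pq p q z u = qcnj (form_pq p q u z)" by (rule form_pq_sym[OF uc z])
      also have "form_pq p q u z = 0" using 0[of u] u True by (simp add: form_d_def z_def)
      finally show ?thesis using True by simp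
    next
      case False
      then show ?thesis
        using form_lw_eq_0[OF v u commuting_one, of "d - 1 + l"] d uc
        by (auto simp del: pow_mat.simps)
    qed
    finally have "form_pq p q z (X ^\<^sub>m l *\<^sub>v u) = 0" by simp
    then show "P *\<^sub>v (X ^\<^sub>m l *\<^sub>v u) = 0\<^sub>m 1 N *\<^sub>v (X ^\<^sub>m l *\<^sub>v u)"
    proof -
      have "0\<^sub>m 1 N *\<^sub>v x = (0\<^sub>v 1 :: quat vec)" if "x \<in> carrier_vec N" for x
        using that by (intro eq_vecI) (auto simp: scalar_prod_def)
      moreover have "vec 1 (\<lambda>_. 0) = (0\<^sub>v 1 :: quat vec)" by (rule eq_vecI) auto
      ultimately show ?thesis
        using uc \<open>form_pq p q z (X ^\<^sub>m l *\<^sub>v u) = 0\<close> by (simp add: Pw)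
    qed
  qed simp
  then have "form_pq p q z w = 0" if "w \<in> carrier_vec N" for w
    using arg_cong[OF Pw[OF that], of "\<lambda>v. v $ 0"] that by (simp add: scalar_prod_def)
  then have "z = 0\<^sub>v N" by (rule form_pq_nondegenerate[OF z])
  then show ?thesis using lw_X_pow_inj[OF v, of "d - 1"] d unfolding z_def by simp
qed

text \<open>Moving \<open>X^(d-1)\<close> across the invariant form costs the sign
  \<open>(- 1)^(d-1)\<close>, which is 1 exactly for odd \<open>d\<close>.\<close>

lemma epsilon_hermitian_lw:
  assumes d: "d > 0"
  shows "epsilon_hermitian N (lw d) (form_d p q X d) (if odd d then 1 else - 1)"
proof (rule epsilon_hermitian.intro)
  show "right_subspace UNIV N (lw d)" by (rule lw_right_subspace)
  show "form_d p q X d u (v + w) = form_d p q X d u v + form_d p q X d u w"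
    if "u \<in> lw d" "v \<in> lw d" "w \<in> lw d" for u v w
    using that[THEN lw_carrier]
    by (simp add: form_d_def mult_add_distrib_mat_vec[of _ N N] form_pq_add_right)
  show "form_d p q X d u (right_smult_vec v a) = form_d p q X d u v * a"
    if "u \<in> lw d" "v \<in> lw d" for u v a
  proof -
    have "X ^\<^sub>m (d - 1) *\<^sub>v right_smult_vec v a = right_smult_vec (X ^\<^sub>m (d - 1) *\<^sub>v v) a"
      by (rule mult_mat_vec_right_smult[OF X_pow_carrier lw_carrier[OF that(2)]])
    then show ?thesis using that[THEN lw_carrier] by (simp add: form_d_def form_pq_smult_right)
  qed
  show "form_d p q X d v u = (if odd d then 1 else - 1) *\<^sub>R qcnj (form_d p q X d u v)"
    if "u \<in> lw d" "v \<in> lw d" for u v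
  proof -
    have c: "u \<in> carrier_vec N" "v \<in> carrier_vec N" using that[THEN lw_carrier] by auto
    have "qcnj (form_d p q X d u v) = form_pq p q (X ^\<^sub>m (d - 1) *\<^sub>v v) u"
      unfolding form_d_def using c by (subst form_pq_sym[symmetric]) auto
    also have "\<dots> = (- 1) ^ (d - 1) * form_d p q X d v u"
      unfolding form_d_def using c by (simp add: skew_X_pow)
    finally have eq: "qcnj (form_d p q X d u v) = (- 1) ^ (d - 1) * form_d p q X d v u" .
    obtain e where "d = Suc e" using d by (cases d) auto
    then show ?thesis unfolding eq by (auto simp: minus_one_power_iff)
  qed
  show "v = 0\<^sub>v N" if "v \<in> lw d" "\<And>u. u \<in> lw d \<Longrightarrow> form_d p q X d u v = 0" for v
    using that d by (intro form_d_nondegenerate)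
qed auto

section \<open>Bases with standard Gram matrix\<close>

lemma adapted_basis_mat:
  assumes d: "d > 0" and vs: "epsilon_hermitian.orthogonal_basis N (lw d) (form_d p q X d) vs"
    and self: "\<And>i. i < length vs \<Longrightarrow> form_d p q X d (vs ! i) (vs ! i) = S $$ (i, i)"
    and S: "S \<in> carrier_mat (length vs) (length vs)"
      "\<And>i j. i < length vs \<Longrightarrow> j < length vs \<Longrightarrow> i \<noteq> j \<Longrightarrow> S $$ (i, j) = 0"
  shows "right_dim UNIV N (lw d) = length vs"
    "mat_star (mat_of_cols N vs) * (I_pq p q * (X ^\<^sub>m (d - 1) * mat_of_cols N vs)) = S"
    "\<And>i. i < length vs \<Longrightarrow> col (mat_of_cols N vs) i \<in> lw d"
    "\<And>v. v \<in> lw d \<Longrightarrow> \<exists>c\<in>carrier_vec (length vs). mat_of_cols N vs *\<^sub>v c = v"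
proof -
  interpret epsilon_hermitian N "lw d" "form_d p q X d" "if odd d then 1 else - 1"
    by (rule epsilon_hermitian_lw[OF d])
  note rb = orthogonal_basis_right_basis[OF vs]
  show "right_dim UNIV N (lw d) = length vs" by (rule right_dim_eq[OF division_subring_UNIV L rb])
  have sub: "set vs \<subseteq> lw d" by (rule orthogonal_basisD(2)[OF vs])
  have vc: "vs ! i \<in> carrier_vec N" if "i < length vs" for i
    by (rule lw_carrier[OF subsetD[OF sub nth_mem[OF that]]])
  then have col: "col (mat_of_cols N vs) i = vs ! i" if "i < length vs" for i using that by (intro col_mat_of_cols) auto
  then show "col (mat_of_cols N vs) i \<in> lw d" if "i < length vs" for i using that sub by auto
  show "\<exists>c\<in>carrier_vec (length vs). mat_of_cols N vs *\<^sub>v c = v" if "v \<in> lw d" for v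
    using rb that unfolding right_basis_iff[OF division_subring_UNIV L] by blast
  show "mat_star (mat_of_cols N vs) * (I_pq p q * (X ^\<^sub>m (d - 1) * mat_of_cols N vs)) = S"
  proof (rule eq_matI)
    fix i j assume "i < dim_row S" "j < dim_col S"
    then have ij: "i < length vs" "j < length vs" using S(1) by auto
    have M: "mat_of_cols N vs \<in> carrier_mat N (length vs)" by simp
    have XM: "X ^\<^sub>m (d - 1) * mat_of_cols N vs \<in> carrier_mat N (length vs)"
      using X_pow_carrier M by (rule mult_carrier_mat)
    have "(mat_star (mat_of_cols N vs) * (I_pq p q * (X ^\<^sub>m (d - 1) * mat_of_cols N vs))) $$ (i, j) =
        form_pq p q (col (mat_of_cols N vs) i) (col (X ^\<^sub>m (d - 1) * mat_of_cols N vs) j)"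
      by (rule gram_index[OF M XM ij])
    also have "col (X ^\<^sub>m (d - 1) * mat_of_cols N vs) j = X ^\<^sub>m (d - 1) *\<^sub>v (vs ! j)"
      using col_mult2[OF X_pow_carrier M ij(2)] col[OF ij(2)] by simp
    also have "form_pq p q (col (mat_of_cols N vs) i) \<dots> = form_d p q X d (vs ! i) (vs ! j)"
      unfolding form_d_def col[OF ij(1)] ..
    also have "\<dots> = S $$ (i, j)"
    proof (cases "i = j")
      case False
      then have "vs ! i \<noteq> vs ! j"
        using orthogonal_basisD(1)[OF vs] ij by (simp add: orthogonal_list_def nth_eq_iff_index_eq)
      then show ?thesis
        using False orthogonal_basisD(1)[OF vs] ij S(2) by (simp add: orthogonal_list_def)
    qed (use self ij in simp)
    finally show "(mat_star (mat_of_cols N vs) * (I_pq p q * (X ^\<^sub>m (d - 1) * mat_of_cols N vs))) $$ (i, j) = S $$ (i, j)" .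
  qed (use S in auto)
qed

text \<open>A skew-Hermitian form has purely imaginary values \<open>B v v\<close>, and all nonzero
  ones can be scaled to j; so no invariant besides the dimension remains.\<close>

lemma adapted_basis_even:
  assumes d: "d > 0" "even d"
  obtains M where "M \<in> carrier_mat N (right_dim UNIV N (lw d))"
    "mat_star M * (I_pq p q * (X ^\<^sub>m (d - 1) * M)) = quat_j \<cdot>\<^sub>m 1\<^sub>m (right_dim UNIV N (lw d))"
    "\<And>i. i < right_dim UNIV N (lw d) \<Longrightarrow> col M i \<in> lw d"
    "\<And>v. v \<in> lw d \<Longrightarrow> \<exists>c\<in>carrier_vec (right_dim UNIV N (lw d)). M *\<^sub>v c = v"
proof -
  interpret epsilon_hermitian N "lw d" "form_d p q X d" "if odd d then 1 else - 1"
    by (rule epsilon_hermitian_lw[OF d(1)])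
  have normal: "\<exists>a. a \<noteq> 0 \<and> qcnj a * form_d p q X d v v * a \<in> {quat_j}"
    if v: "v \<in> lw d" and "form_d p q X d v v \<noteq> 0" for v
  proof -
    have "x = (if odd d then 1 else - 1) *\<^sub>R qcnj x \<Longrightarrow> Rq x = 0" for x
      using d(2) by (cases x) (simp add: qcnj_def scaleR_quat_def)
    from this[OF symmetry[OF v v]] show ?thesis
      using imaginary_quat_congruent_j that(2) by simp
  qed
  have "0 \<notin> {quat_j}" by (simp add: quat_j_def zero_quat_def)
  then obtain vs where vs: "orthogonal_basis vs" "\<And>v. v \<in> set vs \<Longrightarrow> form_d p q X d v v \<in> {quat_j}"
    using orthogonal_basis_exists[of "{quat_j}"] normal by blast
  note M = adapted_basis_mat[OF d(1) vs(1), of "quat_j \<cdot>\<^sub>m 1\<^sub>m (length vs)"]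
  show ?thesis
    by (rule that[of "mat_of_cols N vs"]; use M vs(2) in simp)
qed

text \<open>A Hermitian form has real values \<open>B v v\<close>, scaled to 1 or - 1 by the factor
  \<open>1 / sqrt \<bar>r\<bar>\<close>. Listing the positive vectors first makes the Gram matrix
  equal to \<open>I_pq\<close>.\<close>

lemma adapted_basis_odd:
  fixes d
  defines "a \<equiv> positive_index N (lw d) (form_d p q X d)"
    and "b \<equiv> negative_index N (lw d) (form_d p q X d)"
  assumes d: "odd d"
  obtains M where "right_dim UNIV N (lw d) = a + b" "M \<in> carrier_mat N (a + b)"
    "mat_star M * (I_pq p q * (X ^\<^sub>m (d - 1) * M)) = I_pq a b"
    "\<And>i. i < a + b \<Longrightarrow> col M i \<in> lw d"
    "\<And>v. v \<in> lw d \<Longrightarrow> \<exists>c\<in>carrier_vec (a + b). M *\<^sub>v c = v"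
proof -
  have d0: "d > 0" using d by (auto intro: Nat.gr0I)
  interpret epsilon_hermitian N "lw d" "form_d p q X d" "if odd d then 1 else - 1"
    by (rule epsilon_hermitian_lw[OF d0])
  have normal: "\<exists>a. a \<noteq> 0 \<and> qcnj a * form_d p q X d v v * a \<in> {1, - 1}"
    if v: "v \<in> lw d" and nz: "form_d p q X d v v \<noteq> 0" for v
  proof -
    have "qcnj (form_d p q X d v v) = form_d p q X d v v"
    proof -
      have "x = (if odd d then 1 else - 1) *\<^sub>R qcnj x \<Longrightarrow> qcnj x = x" for x
        using d by (cases x) (simp add: qcnj_def scaleR_quat_def)
      from this[OF symmetry[OF v v]] show ?thesis .
    qed
    then obtain r where r: "form_d p q X d v v = of_real r" using quat_selfadjoint_real by metis
    then have "r \<noteq> 0" using nz by auto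
    let ?a = "of_real (1 / sqrt \<bar>r\<bar>) :: quat"
    have "qcnj ?a * form_d p q X d v v * ?a = of_real (1 / sqrt \<bar>r\<bar> * r * (1 / sqrt \<bar>r\<bar>))"
      unfolding r qcnj_of_real by (simp only: of_real_mult)
    also have "1 / sqrt \<bar>r\<bar> * r * (1 / sqrt \<bar>r\<bar>) = sgn r"
      using \<open>r \<noteq> 0\<close> by (simp add: sgn_real_def field_simps)
    finally show ?thesis using \<open>r \<noteq> 0\<close> by (intro exI[of _ ?a]) (auto simp: sgn_real_def)
  qed
  have "0 \<notin> {1, - 1 :: quat}" by simp
  then obtain vs where vs: "orthogonal_basis vs" "\<And>v. v \<in> set vs \<Longrightarrow> form_d p q X d v v \<in> {1, - 1}"
    using orthogonal_basis_exists[of "{1, - 1}"] normal by blast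
  define ps where "ps = filter (\<lambda>v. form_d p q X d v v = 1) vs"
  define ns where "ns = filter (\<lambda>v. form_d p q X d v v \<noteq> 1) vs"
  have ps: "form_d p q X d v v = 1" if "v \<in> set ps" for v using that by (simp add: ps_def)
  have ns: "form_d p q X d v v = - 1" if "v \<in> set ns" for v using that vs(2) by (auto simp: ns_def)
  have ob: "orthogonal_basis (ps @ ns)"
  proof -
    have "distinct (ps @ ns)"
      using orthogonal_basisD(1)[OF vs(1)] by (auto simp: orthogonal_list_def ps_def ns_def)
    moreover have "set (ps @ ns) = set vs" by (auto simp: ps_def ns_def)
    ultimately show ?thesis using vs(1) unfolding orthogonal_basis_def orthogonal_list_def by metis
  qed
  have ab: "a = length ps" "b = length ns"
    unfolding a_def b_def using positive_index_eq[OF ob ps ns] negative_index_eq[OF ob ps ns] by auto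
  have self: "form_d p q X d ((ps @ ns) ! i) ((ps @ ns) ! i) = I_pq a b $$ (i, i)" if "i < length (ps @ ns)" for i
    using that ps ns by (auto simp: ab I_pq_index nth_append)
  have len: "length (ps @ ns) = a + b" by (simp add: ab)
  have off: "I_pq a b $$ (i, j) = 0" if "i < length (ps @ ns)" "j < length (ps @ ns)" "i \<noteq> j" for i j
    using that len by (simp add: I_pq_index)
  have Sc: "I_pq a b \<in> carrier_mat (length (ps @ ns)) (length (ps @ ns))"
    unfolding len by simp
  note M = adapted_basis_mat[OF d0 ob self Sc off]
  show ?thesis
    using M unfolding len
    by (intro that[of "mat_of_cols N (ps @ ns)"]) (simp_all add: len[symmetric] del: length_append)
qed

end


section \<open>The centralizer in adapted bases\<close>

text \<open>The size is an argument, so that even an empty sum is a zero matrix of the right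
  shape.\<close>

definition mat_sum :: "nat \<Rightarrow> nat \<Rightarrow> 's set \<Rightarrow> ('s \<Rightarrow> quat mat) \<Rightarrow> quat mat" where
  "mat_sum r c I F = mat r c (\<lambda>ij. \<Sum>s\<in>I. F s $$ ij)"

lemma mat_sum_carrier [simp]: "mat_sum r c I F \<in> carrier_mat r c"
  and mat_sum_dim [simp]: "dim_row (mat_sum r c I F) = r" "dim_col (mat_sum r c I F) = c"
  by (simp_all add: mat_sum_def)

lemma mat_sum_mult:
  assumes "A \<in> carrier_mat c b" "\<And>s. s \<in> I \<Longrightarrow> F s \<in> carrier_mat r c"
  shows "mat_sum r c I F * A = mat_sum r b I (\<lambda>s. F s * A)"
proof (rule eq_matI)
  fix i j assume "i < dim_row (mat_sum r b I (\<lambda>s. F s * A))" "j < dim_col (mat_sum r b I (\<lambda>s. F s * A))"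
  then have ij: "i < r" "j < b" by auto
  have "(mat_sum r c I F * A) $$ (i, j) = (\<Sum>k = 0..<c. \<Sum>s\<in>I. F s $$ (i, k) * A $$ (k, j))"
    using assms(1) ij by (simp add: scalar_prod_def mat_sum_def sum_distrib_right)
  also have "\<dots> = (\<Sum>s\<in>I. \<Sum>k = 0..<c. F s $$ (i, k) * A $$ (k, j))" by (rule sum.swap)
  also have "\<dots> = (\<Sum>s\<in>I. (F s * A) $$ (i, j))"
  proof (rule sum.cong[OF refl])
    fix s assume "s \<in> I"
    from assms(2)[OF this] show "(\<Sum>k = 0..<c. F s $$ (i, k) * A $$ (k, j)) = (F s * A) $$ (i, j)"
      using assms(1) ij by (simp add: scalar_prod_def)
  qed
  finally show "(mat_sum r c I F * A) $$ (i, j) = mat_sum r b I (\<lambda>s. F s * A) $$ (i, j)"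
    using ij by (simp add: mat_sum_def)
qed (use assms in auto)

lemma mat_sum_single:
  assumes "finite I" "s \<in> I" "F s \<in> carrier_mat r c" "\<And>u. u \<in> I \<Longrightarrow> u \<noteq> s \<Longrightarrow> F u = 0\<^sub>m r c"
  shows "mat_sum r c I F = F s"
proof (rule eq_matI)
  fix i j assume "i < dim_row (F s)" "j < dim_col (F s)"
  then have ij: "i < r" "j < c" using assms(3) by auto
  have "(\<Sum>u\<in>I. F u $$ (i, j)) = (\<Sum>u\<in>I. if u = s then F s $$ (i, j) else 0)"
    using assms(4) ij by (intro sum.cong) auto
  then show "mat_sum r c I F $$ (i, j) = F s $$ (i, j)"
    using ij assms(1,2) by (simp add: mat_sum_def)
qed (use assms in auto)

lemma mat_sum_cong: "(\<And>s. s \<in> I \<Longrightarrow> F s = G s) \<Longrightarrow> mat_sum r c I F = mat_sum r c I G"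
  by (simp add: mat_sum_def)

definition isometries :: "nat \<Rightarrow> quat mat \<Rightarrow> quat mat set" where
  "isometries m S = {g \<in> carrier_mat m m. mat_star g * S * g = S}"

text \<open>A left scalar passes a matrix factor if it is central, hence the restriction to real
  scalars.\<close>

lemma real_smult_mult:
  fixes M K :: "quat mat"
  assumes "dim_col M = dim_row K"
  shows "of_real r \<cdot>\<^sub>m M * K = of_real r \<cdot>\<^sub>m (M * K)"
    "M * (of_real r \<cdot>\<^sub>m K) = of_real r \<cdot>\<^sub>m (M * K)"
proof -
  have "a * (of_real r * b) = of_real r * (a * b)" for a b :: quat
    by (metis mult.assoc of_real_quat_commute)
  then show "of_real r \<cdot>\<^sub>m M * K = of_real r \<cdot>\<^sub>m (M * K)"
    "M * (of_real r \<cdot>\<^sub>m K) = of_real r \<cdot>\<^sub>m (M * K)"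
    using assms by (auto simp: scalar_prod_def sum_distrib_left mult.assoc intro!: eq_matI sum.cong)
qed

text \<open>\<open>D\<close> collects the parts and \<open>t\<close> their multiplicities. The Gram
  matrices stay abstract, with a left inverse \<open>S'\<close>, so that parts of both parities are
  handled alike.\<close>

locale adapted_bases = sp_triple p q X H Y for p q X H Y +
  fixes D :: "nat set" and t :: "nat \<Rightarrow> nat" and B S S' :: "nat \<Rightarrow> quat mat"
  assumes D: "finite D" "d \<in> D \<Longrightarrow> d > 0"
    and B: "d \<in> D \<Longrightarrow> B d \<in> carrier_mat (p + q) (t d)"
    and B_lw: "d \<in> D \<Longrightarrow> i < t d \<Longrightarrow> col (B d) i \<in> lw d"
    and B_span: "d \<in> D \<Longrightarrow> v \<in> lw d \<Longrightarrow> \<exists>c\<in>carrier_vec (t d). B d *\<^sub>v c = v"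
    and D_complete: "d > 0 \<Longrightarrow> d \<notin> D \<Longrightarrow> lw d \<subseteq> {0\<^sub>v (p + q)}"
    and S: "d \<in> D \<Longrightarrow> S d \<in> carrier_mat (t d) (t d)"
    and S': "d \<in> D \<Longrightarrow> S' d \<in> carrier_mat (t d) (t d)"
    and S'_S: "d \<in> D \<Longrightarrow> S' d * S d = 1\<^sub>m (t d)"
    and gram: "d \<in> D \<Longrightarrow> mat_star (B d) * (I_pq p q * (X ^\<^sub>m (d - 1) * B d)) = S d"
begin

lemma dims [simp]:
  "dim_row X = N" "dim_col X = N" "dim_row (X ^\<^sub>m k) = N" "dim_col (X ^\<^sub>m k) = N"
  "d \<in> D \<Longrightarrow> dim_row (B d) = N" "d \<in> D \<Longrightarrow> dim_col (B d) = t d"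
  "d \<in> D \<Longrightarrow> dim_row (S d) = t d" "d \<in> D \<Longrightarrow> dim_col (S d) = t d"
  "d \<in> D \<Longrightarrow> dim_row (S' d) = t d" "d \<in> D \<Longrightarrow> dim_col (S' d) = t d"
  using X B S S' X_pow_carrier[of k] by (auto simp del: X_pow_carrier)

section \<open>Dual blocks, and matrices assembled from components\<close>

lemma gram_commuting:
  assumes d: "d \<in> D" "e \<in> D" and g: "commuting g" and ne: "\<not> (d = e \<and> Suc k = d)"
  shows "mat_star (B d) * (I_pq p q * (g * (X ^\<^sub>m k * B e))) = 0\<^sub>m (t d) (t e)"
proof (rule eq_matI)
  have gc: "g \<in> carrier_mat N N" using g by (simp add: commuting_def)
  fix i j assume "i < dim_row (0\<^sub>m (t d) (t e) :: quat mat)" "j < dim_col (0\<^sub>m (t d) (t e) :: quat mat)"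
  then have ij: "i < t d" "j < t e" by auto
  have XB: "X ^\<^sub>m k * B e \<in> carrier_mat N (t e)" by (rule mult_carrier_mat[OF X_pow_carrier B[OF d(2)]])
  have "(mat_star (B d) * (I_pq p q * (g * (X ^\<^sub>m k * B e)))) $$ (i, j) =
      form_pq p q (col (B d) i) (col (g * (X ^\<^sub>m k * B e)) j)"
    by (rule gram_index[OF B[OF d(1)] mult_carrier_mat[OF gc XB] ij])
  also have "col (g * (X ^\<^sub>m k * B e)) j = g *\<^sub>v (X ^\<^sub>m k *\<^sub>v col (B e) j)"
    by (simp only: col_mult2[OF gc XB ij(2)] col_mult2[OF X_pow_carrier B[OF d(2)] ij(2)])
  also have "form_pq p q (col (B d) i) \<dots> = 0"
    by (rule form_lw_eq_0[OF B_lw[OF d(1) ij(1)] B_lw[OF d(2) ij(2)] g ne])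
  finally show "(mat_star (B d) * (I_pq p q * (g * (X ^\<^sub>m k * B e)))) $$ (i, j) = 0\<^sub>m (t d) (t e) $$ (i, j)"
    using ij by simp
qed (use d in auto)

lemma gram_pow:
  assumes d: "d \<in> D" "e \<in> D"
  shows "mat_star (B d) * (I_pq p q * (X ^\<^sub>m k * B e)) = (if d = e \<and> Suc k = d then S d else 0\<^sub>m (t d) (t e))"
proof (cases "d = e \<and> Suc k = d")
  case True
  then show ?thesis using gram[OF d(1)] by auto
next
  case False
  have "1\<^sub>m N * (X ^\<^sub>m k * B e) = X ^\<^sub>m k * B e"
    by (rule left_mult_one_mat[OF mult_carrier_mat[OF X_pow_carrier B[OF d(2)]]])
  then show ?thesis
    using gram_commuting[OF d commuting_one False] by (simp only: if_not_P[OF False])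
qed

definition U :: "nat \<Rightarrow> nat \<Rightarrow> quat mat" where
  "U d l = X ^\<^sub>m l * B d"

definition C :: "nat \<Rightarrow> nat \<Rightarrow> quat mat" where
  "C d l = S' d * (mat_star (B d) * (I_pq p q * X ^\<^sub>m (d - 1 - l)))"

lemma U_carrier: "d \<in> D \<Longrightarrow> U d l \<in> carrier_mat N (t d)"
  unfolding U_def by (rule mult_carrier_mat[OF X_pow_carrier B])

lemma C_carrier: "d \<in> D \<Longrightarrow> C d l \<in> carrier_mat (t d) N"
  unfolding C_def by (intro carrier_matI) auto

lemma UC_dims [simp]:
  "d \<in> D \<Longrightarrow> dim_row (U d l) = N" "d \<in> D \<Longrightarrow> dim_col (U d l) = t d"
  "d \<in> D \<Longrightarrow> dim_row (C d l) = t d" "d \<in> D \<Longrightarrow> dim_col (C d l) = N"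
  using U_carrier C_carrier by blast+

text \<open>As \<open>l < d\<close>, the total exponent \<open>d - 1 - l + m\<close> equals
  \<open>d - 1\<close> exactly for \<open>l = m\<close>; by \<open>gram_pow\<close> all other
  pairings vanish, and \<open>S' d\<close> cancels the Gram matrix that remains.\<close>

lemma C_U:
  assumes d: "d \<in> D" "e \<in> D" and l: "l < d" "m < e"
  shows "C d l * U e m = (if d = e \<and> l = m then 1\<^sub>m (t d) else 0\<^sub>m (t d) (t e))"
proof -
  have "C d l * U e m = S' d * (mat_star (B d) * (I_pq p q * (X ^\<^sub>m (d - 1 - l) * (X ^\<^sub>m m * B e))))"
    unfolding C_def U_def using d by (simp add: mult_mat_assoc)
  also have "X ^\<^sub>m (d - 1 - l) * (X ^\<^sub>m m * B e) = X ^\<^sub>m (d - 1 - l + m) * B e"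
    unfolding X_pow_add[symmetric] using d by (simp add: mult_mat_assoc)
  also have "S' d * (mat_star (B d) * (I_pq p q * (X ^\<^sub>m (d - 1 - l + m) * B e))) =
      S' d * (if d = e \<and> Suc (d - 1 - l + m) = d then S d else 0\<^sub>m (t d) (t e))"
    unfolding gram_pow[OF d] ..
  also have "d = e \<and> Suc (d - 1 - l + m) = d \<longleftrightarrow> d = e \<and> l = m" using l by auto
  finally show ?thesis
    using S'_S[OF d(1)] right_mult_zero_mat[OF S'[OF d(1)], of "t e"] by auto
qed

definition index_set :: "(nat \<times> nat) set" where
  "index_set = (SIGMA d:D. {..<d})"

lemma index_set: "finite index_set" "(d, l) \<in> index_set \<longleftrightarrow> d \<in> D \<and> l < d"
  using D by (auto simp: index_set_def)

definition assemble :: "(nat \<Rightarrow> quat mat) \<Rightarrow> quat mat" where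
  "assemble G = mat_sum N N index_set (\<lambda>(d, l). U d l * (G d * C d l))"

lemma assemble_carrier [simp]: "assemble G \<in> carrier_mat N N"
  and assemble_dim [simp]: "dim_row (assemble G) = N" "dim_col (assemble G) = N"
  by (simp_all add: assemble_def)

lemma assemble_U:
  assumes G: "\<And>d. d \<in> D \<Longrightarrow> G d \<in> carrier_mat (t d) (t d)" and e: "e \<in> D" "m < e"
  shows "assemble G * U e m = U e m * G e"
proof -
  have Gd: "dim_row (G d) = t d" "dim_col (G d) = t d" if "d \<in> D" for d using G[OF that] by auto
  have "assemble G * U e m = mat_sum N (t e) index_set (\<lambda>s. (\<lambda>(d, l). U d l * (G d * C d l)) s * U e m)"
    unfolding assemble_def
    by (rule mat_sum_mult[OF U_carrier[OF e(1)]]) (auto simp: index_set Gd intro!: carrier_matI)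
  also have "\<dots> = (\<lambda>(d, l). U d l * (G d * C d l)) (e, m) * U e m"
  proof (rule mat_sum_single[OF index_set(1)])
    show "(e, m) \<in> index_set" using e by (simp add: index_set)
    show "(\<lambda>(d, l). U d l * (G d * C d l)) (e, m) * U e m \<in> carrier_mat N (t e)"
      using e by (auto simp: Gd intro!: carrier_matI)
    fix s assume s: "s \<in> index_set" "s \<noteq> (e, m)"
    then obtain d l where dl: "s = (d, l)" "d \<in> D" "l < d" by (cases s) (auto simp: index_set)
    have "U d l * (G d * C d l) * U e m = U d l * (G d * (C d l * U e m))"
      using dl e by (simp add: mult_mat_assoc Gd)
    also have "C d l * U e m = 0\<^sub>m (t d) (t e)" using C_U[OF dl(2) e(1) dl(3) e(2)] s dl by auto
    also have "G d * 0\<^sub>m (t d) (t e) = 0\<^sub>m (t d) (t e)" by (rule right_mult_zero_mat[OF G[OF dl(2)]])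
    also have "U d l * 0\<^sub>m (t d) (t e) = 0\<^sub>m N (t e)" by (rule right_mult_zero_mat[OF U_carrier[OF dl(2)]])
    finally show "(\<lambda>(d, l). U d l * (G d * C d l)) s * U e m = 0\<^sub>m N (t e)" using dl by simp
  qed
  also have "\<dots> = U e m * (G e * (C e m * U e m))"
    using e by (simp add: mult_mat_assoc Gd)
  also have "C e m * U e m = 1\<^sub>m (t e)" using C_U[OF e(1) e(1) e(2) e(2)] by simp
  finally show ?thesis using right_mult_one_mat[OF G[OF e(1)]] by simp
qed

lemma mat_eq_on_U:
  assumes P: "P \<in> carrier_mat a N" and Q: "Q \<in> carrier_mat a N"
    and eq: "\<And>d l. d \<in> D \<Longrightarrow> l < d \<Longrightarrow> P * U d l = Q * U d l"
  shows "P = Q"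
proof (rule mat_eq_on_lw[OF P Q])
  fix d l v assume v: "v \<in> lw d" and l: "l < d"
  have Pv: "A *\<^sub>v (X ^\<^sub>m l *\<^sub>v (B d *\<^sub>v c)) = (A * U d l) *\<^sub>v c"
    if "A \<in> carrier_mat a N" "d \<in> D" "c \<in> carrier_vec (t d)" for A c
    unfolding U_def
    using assoc_mult_mat_vec[OF that(1) mult_carrier_mat[OF X_pow_carrier B[OF that(2)]] that(3), of l]
      assoc_mult_mat_vec[OF X_pow_carrier B[OF that(2)] that(3), of l] by simp
  show "P *\<^sub>v (X ^\<^sub>m l *\<^sub>v v) = Q *\<^sub>v (X ^\<^sub>m l *\<^sub>v v)"
  proof (cases "d \<in> D")
    case True
    then obtain c where "c \<in> carrier_vec (t d)" "B d *\<^sub>v c = v" using B_span v by blast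
    then show ?thesis using Pv[OF P True] Pv[OF Q True] eq[OF True l] by auto
  next
    case False
    then have "v = 0\<^sub>v N" using D_complete[of d] v l by auto
    then show ?thesis
      by (simp only: mult_mat_vec_zero[OF X_pow_carrier] mult_mat_vec_zero[OF P] mult_mat_vec_zero[OF Q])
  qed
qed

lemma assemble_one: "assemble (\<lambda>d. 1\<^sub>m (t d)) = 1\<^sub>m N"
proof (rule mat_eq_on_U[of _ N])
  fix d l assume d: "d \<in> D" "l < d"
  show "assemble (\<lambda>d. 1\<^sub>m (t d)) * U d l = 1\<^sub>m N * U d l"
    using assemble_U[OF _ d, of "\<lambda>d. 1\<^sub>m (t d)"] right_mult_one_mat[OF U_carrier[OF d(1)]]
      left_mult_one_mat[OF U_carrier[OF d(1)]] by simp
qed auto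

text \<open>\<open>A\<close> acts on the blocks from the left and permutes those of a string up to
  real factors, while \<open>assemble G\<close> multiplies all blocks of a string by the same
  \<open>G d\<close> from the right. Real factors pass through \<open>G d\<close>.\<close>

lemma assemble_commutes:
  assumes G: "\<And>d. d \<in> D \<Longrightarrow> G d \<in> carrier_mat (t d) (t d)" and A: "A \<in> carrier_mat N N"
    and AU: "\<And>d l. d \<in> D \<Longrightarrow> l < d \<Longrightarrow> \<exists>r. \<exists>m<d. A * U d l = of_real r \<cdot>\<^sub>m U d m"
  shows "assemble G * A = A * assemble G"
proof (rule mat_eq_on_U[of _ N])
  show "assemble G * A \<in> carrier_mat N N" "A * assemble G \<in> carrier_mat N N"
    using A by (auto intro!: mult_carrier_mat[of _ N N])
  fix d l assume d: "d \<in> D" "l < d"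
  obtain r m where rm: "m < d" "A * U d l = of_real r \<cdot>\<^sub>m U d m" using AU[OF d] by blast
  have Ad: "dim_row A = N" "dim_col A = N" "dim_row (G d) = t d" "dim_col (G d) = t d" using A G[OF d(1)] by auto
  have "assemble G * A * U d l = assemble G * (A * U d l)" using d by (simp add: mult_mat_assoc Ad)
  also have "\<dots> = of_real r \<cdot>\<^sub>m (U d m * G d)"
    using d rm by (simp add: real_smult_mult assemble_U[OF G])
  also have "\<dots> = A * U d l * G d"
    unfolding rm(2) by (rule real_smult_mult(1)[symmetric]) (use d Ad in simp)
  also have "\<dots> = A * (U d l * G d)" using d by (simp add: mult_mat_assoc Ad)
  also have "\<dots> = A * (assemble G * U d l)" using d by (simp add: assemble_U[OF G])
  also have "\<dots> = A * assemble G * U d l" using d by (simp add: mult_mat_assoc Ad)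
  finally show "assemble G * A * U d l = A * assemble G * U d l" .
qed

lemma col_U: "d \<in> D \<Longrightarrow> i < t d \<Longrightarrow> col (U d l) i = X ^\<^sub>m l *\<^sub>v col (B d) i"
  unfolding U_def by (rule col_mult2[OF X_pow_carrier B])

lemma mat_mult_U_eqI:
  assumes A: "A \<in> carrier_mat N N" and d: "d \<in> D"
    and eq: "\<And>v. v \<in> lw d \<Longrightarrow> A *\<^sub>v (X ^\<^sub>m l *\<^sub>v v) = right_smult_vec (X ^\<^sub>m m *\<^sub>v v) (of_real r)"
  shows "A * U d l = of_real r \<cdot>\<^sub>m U d m"
proof (rule eq_matI)
  fix i j assume "i < dim_row (of_real r \<cdot>\<^sub>m U d m)" "j < dim_col (of_real r \<cdot>\<^sub>m U d m)"
  then have ij: "i < N" "j < t d" using d by auto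
  have v: "col (B d) j \<in> lw d" by (rule B_lw[OF d ij(2)])
  have dimv: "dim_vec (X ^\<^sub>m m *\<^sub>v col (B d) j) = N" by simp
  have "(A * U d l) $$ (i, j) = col (A * U d l) j $ i" using A d ij by simp
  also have "\<dots> = right_smult_vec (col (U d m) j) (of_real r) $ i"
    unfolding col_mult2[OF A U_carrier[OF d] ij(2)] col_U[OF d ij(2)] eq[OF v] ..
  also have "\<dots> = U d m $$ (i, j) * of_real r" using d ij by simp
  finally show "(A * U d l) $$ (i, j) = (of_real r \<cdot>\<^sub>m U d m) $$ (i, j)"
    using d ij by (simp add: of_real_quat_commute)
qed (use A d in auto)

lemma X_U:
  assumes d: "d \<in> D" "l < d"
  shows "\<exists>r. \<exists>m<d. X * U d l = of_real r \<cdot>\<^sub>m U d m"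
proof (cases "Suc l < d")
  case True
  have "X * U d l = of_real 1 \<cdot>\<^sub>m U d (Suc l)"
  proof (rule mat_mult_U_eqI[OF X d(1)])
    fix v assume "v \<in> lw d"
    then have "v \<in> carrier_vec N" by (rule lw_carrier)
    then show "X *\<^sub>v (X ^\<^sub>m l *\<^sub>v v) = right_smult_vec (X ^\<^sub>m Suc l *\<^sub>v v) (of_real 1)"
      by (subst X_pow_Suc_vec(1)) (auto intro!: eq_vecI)
  qed
  then show ?thesis using True by blast
next
  case False
  \<comment> \<open>At the top of the string the image is 0, and the block on the right is a
    placeholder.\<close>
  have "X * U d l = of_real 0 \<cdot>\<^sub>m U d l"
  proof (rule mat_mult_U_eqI[OF X d(1)])
    fix v assume v: "v \<in> lw d"
    then have vc: "v \<in> carrier_vec N" by (rule lw_carrier)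
    have "X *\<^sub>v (X ^\<^sub>m l *\<^sub>v v) = 0\<^sub>v N"
      unfolding X_pow_Suc_vec(1)[OF vc, symmetric] using False by (intro lw_X_pow_eq_0[OF v]) simp
    also have "\<dots> = right_smult_vec (X ^\<^sub>m l *\<^sub>v v) (of_real 0)"
      by (intro eq_vecI) (auto simp del: index_mult_mat_vec)
    finally show "X *\<^sub>v (X ^\<^sub>m l *\<^sub>v v) = right_smult_vec (X ^\<^sub>m l *\<^sub>v v) (of_real 0)" .
  qed
  then show ?thesis using d(2) by blast
qed

lemma H_U:
  assumes d: "d \<in> D" "l < d"
  shows "\<exists>r. \<exists>m<d. H * U d l = of_real r \<cdot>\<^sub>m U d m"
  using mat_mult_U_eqI[OF H d(1) lw_H] d(2) by blast

lemma Y_U: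
  assumes d: "d \<in> D" "l < d"
  shows "\<exists>r. \<exists>m<d. Y * U d l = of_real r \<cdot>\<^sub>m U d m"
proof (cases l)
  case 0
  have "Y * U d l = of_real 0 \<cdot>\<^sub>m U d 0"
  proof (rule mat_mult_U_eqI[OF Y d(1)])
    fix v assume v: "v \<in> lw d"
    then have vc: "v \<in> carrier_vec N" by (rule lw_carrier)
    have "X ^\<^sub>m l *\<^sub>v v = v" using 0 vc by simp
    then have "Y *\<^sub>v (X ^\<^sub>m l *\<^sub>v v) = 0\<^sub>v N" using v by (simp add: lw_def)
    also have "\<dots> = right_smult_vec (X ^\<^sub>m 0 *\<^sub>v v) (of_real 0)"
      by (intro eq_vecI) (auto simp del: index_mult_mat_vec)
    finally show "Y *\<^sub>v (X ^\<^sub>m l *\<^sub>v v) = right_smult_vec (X ^\<^sub>m 0 *\<^sub>v v) (of_real 0)" .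
  qed
  then show ?thesis using d(2) 0 by blast
next
  case (Suc k)
  have "Y * U d (Suc k) = of_real (real (Suc k) * (real d - real (Suc k))) \<cdot>\<^sub>m U d k"
    by (rule mat_mult_U_eqI[OF Y d(1) lw_Y])
  moreover have "k < d" using Suc d(2) by simp
  ultimately show ?thesis using Suc by blast
qed

lemma gram_U:
  assumes d: "d \<in> D" "e \<in> D"
  shows "mat_star (U d l) * (I_pq p q * U e m) =
    (if d = e \<and> Suc (l + m) = d then of_real ((- 1) ^ l) \<cdot>\<^sub>m S d else 0\<^sub>m (t d) (t e))"
proof -
  have "mat_star (U d l) * (I_pq p q * U e m) =
      of_real ((- 1) ^ l) \<cdot>\<^sub>m (mat_star (B d) * (I_pq p q * (X ^\<^sub>m (l + m) * B e)))"
  proof (rule eq_matI)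
    fix i j assume "i < dim_row (of_real ((- 1) ^ l) \<cdot>\<^sub>m (mat_star (B d) * (I_pq p q * (X ^\<^sub>m (l + m) * B e))))"
      "j < dim_col (of_real ((- 1) ^ l) \<cdot>\<^sub>m (mat_star (B d) * (I_pq p q * (X ^\<^sub>m (l + m) * B e))))"
    then have ij: "i < t d" "j < t e" using d by auto
    have c: "col (B d) i \<in> carrier_vec N" "col (B e) j \<in> carrier_vec N"
      using lw_carrier[OF B_lw[OF d(1) ij(1)]] lw_carrier[OF B_lw[OF d(2) ij(2)]] by auto
    have XB: "X ^\<^sub>m (l + m) * B e \<in> carrier_mat N (t e)" by (rule mult_carrier_mat[OF X_pow_carrier B[OF d(2)]])
    have "(mat_star (U d l) * (I_pq p q * U e m)) $$ (i, j) =
        form_pq p q (X ^\<^sub>m l *\<^sub>v col (B d) i) (X ^\<^sub>m m *\<^sub>v col (B e) j)"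
      unfolding gram_index[OF U_carrier[OF d(1)] U_carrier[OF d(2)] ij] col_U[OF d(1) ij(1)] col_U[OF d(2) ij(2)] ..
    also have "\<dots> = (- 1) ^ l * form_pq p q (col (B d) i) (X ^\<^sub>m (l + m) *\<^sub>v col (B e) j)"
      using c by (simp add: skew_X_pow X_pow_add_vec)
    also have "X ^\<^sub>m (l + m) *\<^sub>v col (B e) j = col (X ^\<^sub>m (l + m) * B e) j"
      by (rule col_mult2[OF X_pow_carrier B[OF d(2)] ij(2), symmetric])
    also have "form_pq p q (col (B d) i) \<dots> = (mat_star (B d) * (I_pq p q * (X ^\<^sub>m (l + m) * B e))) $$ (i, j)"
      by (rule gram_index[OF B[OF d(1)] XB ij, symmetric])
    finally show "(mat_star (U d l) * (I_pq p q * U e m)) $$ (i, j) =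
        (of_real ((- 1) ^ l) \<cdot>\<^sub>m (mat_star (B d) * (I_pq p q * (X ^\<^sub>m (l + m) * B e)))) $$ (i, j)"
      using d ij by (simp del: index_mult_mat(1))
  qed (use d in auto)
  also have "\<dots> = (if d = e \<and> Suc (l + m) = d then of_real ((- 1) ^ l) \<cdot>\<^sub>m S d else 0\<^sub>m (t d) (t e))"
    unfolding gram_pow[OF d] by (auto intro!: eq_matI)
  finally show ?thesis .
qed

text \<open>Between blocks the form is 0 or a real multiple of \<open>S d\<close>, and each
  \<open>G d\<close> preserves \<open>S d\<close>. So the form and its pullback agree on all pairs
  of blocks.\<close>

lemma assemble_isometry:
  assumes G: "\<And>d. d \<in> D \<Longrightarrow> G d \<in> isometries (t d) (S d)"
  shows "assemble G \<in> isometries N (I_pq p q)"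
proof -
  have Gc: "\<And>d. d \<in> D \<Longrightarrow> G d \<in> carrier_mat (t d) (t d)" and GS: "\<And>d. d \<in> D \<Longrightarrow> mat_star (G d) * S d * G d = S d"
    using G by (auto simp: isometries_def)
  have Gd: "dim_row (G d) = t d" "dim_col (G d) = t d" if "d \<in> D" for d using Gc[OF that] by auto
  let ?A = "assemble G"
  let ?P = "mat_star ?A * I_pq p q * ?A"
  have P: "?P \<in> carrier_mat N N" by (intro carrier_matI) auto
  have UPU: "mat_star (U d l) * ?P * U e m = mat_star (U d l) * I_pq p q * U e m"
    if d: "d \<in> D" "e \<in> D" "l < d" "m < e" for d e l m
  proof -
    have "mat_star (U d l) * ?P * U e m = mat_star (?A * U d l) * (I_pq p q * (?A * U e m))"
      using d by (simp add: mult_mat_assoc mat_star_mult)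
    also have "\<dots> = mat_star (U d l * G d) * (I_pq p q * (U e m * G e))"
      using d by (simp add: assemble_U[OF Gc])
    also have "\<dots> = mat_star (G d) * (mat_star (U d l) * (I_pq p q * U e m) * G e)"
      using d by (simp add: mult_mat_assoc mat_star_mult Gd)
    also have "\<dots> = mat_star (U d l) * (I_pq p q * U e m)"
    proof (cases "d = e \<and> Suc (l + m) = d")
      case True
      have "mat_star (G d) * (of_real r \<cdot>\<^sub>m S d * G d) = of_real r \<cdot>\<^sub>m (mat_star (G d) * S d * G d)" for r
        using d by (simp add: real_smult_mult mult_mat_assoc Gd)
      from this[of "(- 1) ^ l"] show ?thesis
        unfolding gram_U[OF d(1,2)] using True GS[OF d(1)]
        by (auto simp del: of_real_power of_real_minus of_real_1)
    next
      case False
      have "mat_star (G d) * (0\<^sub>m (t d) (t e) * G e) = 0\<^sub>m (t d) (t e)"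
        using left_mult_zero_mat[OF Gc[OF d(2)], of "t d"] right_mult_zero_mat[OF mat_star_carrier[OF Gc[OF d(1)]], of "t e"]
        by simp
      then show ?thesis unfolding gram_U[OF d(1,2)] using False by auto
    qed
    finally show ?thesis using d by (simp add: mult_mat_assoc)
  qed
  have UP: "mat_star (U d l) * ?P = mat_star (U d l) * I_pq p q" if d: "d \<in> D" "l < d" for d l
  proof (rule mat_eq_on_U[of _ "t d"])
    show "mat_star (U d l) * ?P \<in> carrier_mat (t d) N" "mat_star (U d l) * I_pq p q \<in> carrier_mat (t d) N"
      using d by (auto intro!: carrier_matI)
    show "mat_star (U d l) * ?P * U e m = mat_star (U d l) * I_pq p q * U e m" if "e \<in> D" "m < e" for e m
      using UPU d that by blast
  qed
  have star: "mat_star ?P * U d l = mat_star (I_pq p q) * U d l" if d: "d \<in> D" "l < d" for d l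
  proof -
    have "mat_star (mat_star (U d l) * K) = mat_star K * U d l" if "K \<in> carrier_mat N N" for K
      using that d by (subst mat_star_mult) auto
    then show ?thesis using UP[OF d] P I_pq_carrier by metis
  qed
  \<comment> \<open>\<open>mat_eq_on_U\<close> compares matrices by their products with blocks on
    the right; passing to adjoints lets it cancel the left factor too.\<close>
  have "mat_star ?P = mat_star (I_pq p q)"
    by (rule mat_eq_on_U[of _ N, OF _ _ star]) (auto intro!: carrier_matI)
  then have "?P = I_pq p q" by (metis mat_star_mat_star)
  then show ?thesis by (simp add: isometries_def)
qed

section \<open>Components of a centralizer element\<close>

definition component :: "nat \<Rightarrow> quat mat \<Rightarrow> quat mat" where
  "component d g = C d 0 * (g * B d)"

lemma component_carrier:
  assumes "d \<in> D" "g \<in> carrier_mat N N"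
  shows "component d g \<in> carrier_mat (t d) (t d)"
  unfolding component_def
  by (rule mult_carrier_mat[OF C_carrier[OF assms(1)] mult_carrier_mat[OF assms(2) B[OF assms(1)]]])

text \<open>Expand \<open>g B\<^sub>d\<close> along the resolution of the identity \<open>assemble_one\<close>; by the weight argument
  only the term \<open>(d, 0)\<close> survives.\<close>

lemma commuting_B:
  assumes g: "commuting g" and d: "d \<in> D"
  shows "g * B d = B d * component d g"
proof -
  have gc: "g \<in> carrier_mat N N" using g by (simp add: commuting_def)
  then have gd: "dim_row g = N" "dim_col g = N" by auto
  have gB: "g * B d \<in> carrier_mat N (t d)" by (rule mult_carrier_mat[OF gc B[OF d]])
  have zero: "C e l * (g * B d) = 0\<^sub>m (t e) (t d)" if e: "e \<in> D" "l < e" "(e, l) \<noteq> (d, 0)" for e l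
  proof -
    have "C e l * (g * B d) = S' e * (mat_star (B e) * (I_pq p q * (X ^\<^sub>m (e - 1 - l) * g * B d)))"
      unfolding C_def using e d by (simp add: mult_mat_assoc gd)
    also have "X ^\<^sub>m (e - 1 - l) * g * B d = g * (X ^\<^sub>m (e - 1 - l) * B d)"
      unfolding commuting_X_pow[OF g, symmetric] using d by (simp add: mult_mat_assoc gd)
    also have "mat_star (B e) * (I_pq p q * (g * (X ^\<^sub>m (e - 1 - l) * B d))) = 0\<^sub>m (t e) (t d)"
      using e by (intro gram_commuting[OF e(1) d g]) auto
    also have "S' e * 0\<^sub>m (t e) (t d) = 0\<^sub>m (t e) (t d)" by (rule right_mult_zero_mat[OF S'[OF e(1)]])
    finally show ?thesis .
  qed
  have "g * B d = assemble (\<lambda>d. 1\<^sub>m (t d)) * (g * B d)"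
    unfolding assemble_one using left_mult_one_mat[OF gB] by simp
  also have "\<dots> = mat_sum N (t d) index_set (\<lambda>s. (\<lambda>(e, l). U e l * (1\<^sub>m (t e) * C e l)) s * (g * B d))"
    unfolding assemble_def by (rule mat_sum_mult[OF gB]) (auto simp: index_set intro!: carrier_matI)
  also have "\<dots> = (\<lambda>(e, l). U e l * (1\<^sub>m (t e) * C e l)) (d, 0) * (g * B d)"
  proof (rule mat_sum_single[OF index_set(1)])
    show "(d, 0) \<in> index_set" using d D by (simp add: index_set)
    show "(\<lambda>(e, l). U e l * (1\<^sub>m (t e) * C e l)) (d, 0) * (g * B d) \<in> carrier_mat N (t d)"
      using d gd by (auto intro!: carrier_matI)
    fix s assume s: "s \<in> index_set" "s \<noteq> (d, 0)"
    then obtain e l where el: "s = (e, l)" "e \<in> D" "l < e" by (cases s) (auto simp: index_set)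
    have "U e l * (1\<^sub>m (t e) * C e l) * (g * B d) = U e l * (C e l * (g * B d))"
      using el d left_mult_one_mat[OF C_carrier[OF el(2)]] by (simp add: mult_mat_assoc gd)
    also have "\<dots> = 0\<^sub>m N (t d)"
      using zero[OF el(2,3)] s el right_mult_zero_mat[OF U_carrier[OF el(2)]] by simp
    finally show "(\<lambda>(e, l). U e l * (1\<^sub>m (t e) * C e l)) s * (g * B d) = 0\<^sub>m N (t d)" using el by simp
  qed
  also have "\<dots> = U d 0 * (C d 0 * (g * B d))"
    using d left_mult_one_mat[OF C_carrier[OF d]] by (simp add: mult_mat_assoc gd)
  also have "U d 0 = B d" unfolding U_def using left_mult_one_mat[OF B[OF d]] by simp
  finally show ?thesis unfolding component_def .
qed

lemma commuting_U:
  assumes g: "commuting g" and d: "d \<in> D"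
  shows "g * U d l = U d l * component d g"
proof -
  have gc: "g \<in> carrier_mat N N" using g by (simp add: commuting_def)
  then have gd: "dim_row g = N" "dim_col g = N" "dim_row (component d g) = t d" "dim_col (component d g) = t d"
    using component_carrier[OF d gc] by auto
  have "g * U d l = g * X ^\<^sub>m l * B d" unfolding U_def using d by (simp add: mult_mat_assoc gd)
  also have "\<dots> = X ^\<^sub>m l * (g * B d)"
    unfolding commuting_X_pow[OF g] using d by (simp add: mult_mat_assoc gd)
  also have "\<dots> = U d l * component d g"
    unfolding commuting_B[OF g d] U_def using d by (simp add: mult_mat_assoc gd)
  finally show ?thesis .
qed

lemma assemble_component:
  assumes g: "commuting g"
  shows "assemble (\<lambda>d. component d g) = g"
proof (rule mat_eq_on_U[of _ N])
  show gc: "g \<in> carrier_mat N N" using g by (simp add: commuting_def)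
  show "assemble (\<lambda>d. component d g) * U d l = g * U d l" if "d \<in> D" "l < d" for d l
    using that by (simp add: assemble_U component_carrier[OF _ gc] commuting_U[OF g])
qed simp

lemma component_B:
  assumes "d \<in> D" "M \<in> carrier_mat (t d) (t d)"
  shows "C d 0 * (B d * M) = M"
proof -
  have "U d 0 = B d" unfolding U_def using left_mult_one_mat[OF B[OF assms(1)]] by simp
  then have "C d 0 * B d = 1\<^sub>m (t d)" using C_U[OF assms(1,1), of 0 0] D(2)[OF assms(1)] by simp
  moreover have "C d 0 * (B d * M) = C d 0 * B d * M" using assms by (simp add: mult_mat_assoc)
  ultimately show ?thesis using assms by simp
qed

lemma component_assemble:
  assumes G: "\<And>d. d \<in> D \<Longrightarrow> G d \<in> carrier_mat (t d) (t d)" and d: "d \<in> D"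
  shows "component d (assemble G) = G d"
proof -
  have "U d 0 = B d" unfolding U_def using left_mult_one_mat[OF B[OF d]] by simp
  then have "assemble G * B d = B d * G d" using assemble_U[OF G d D(2)[OF d]] by simp
  then show ?thesis unfolding component_def using component_B[OF d G[OF d]] by simp
qed

text \<open>Writing \<open>g'\<close>, \<open>h'\<close> for the components,
  \<open>g h B = g B h' = B g' h'\<close>; as they appear on the right of the basis, the order is
  preserved.\<close>

lemma component_mult:
  assumes g: "commuting g" and h: "commuting h" and d: "d \<in> D"
  shows "component d (g * h) = component d g * component d h"
proof -
  have c: "g \<in> carrier_mat N N" "h \<in> carrier_mat N N" using g h by (auto simp: commuting_def)
  note cc = component_carrier[OF d c(1)] component_carrier[OF d c(2)]
  have dims': "dim_row g = N" "dim_col g = N" "dim_row h = N" "dim_col h = N"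
    "dim_row (component d g) = t d" "dim_col (component d g) = t d" "dim_row (component d h) = t d"
    using c cc by auto
  have "g * h * B d = g * (B d * component d h)"
    unfolding commuting_B[OF h d, symmetric] using d by (simp add: mult_mat_assoc dims')
  also have "\<dots> = g * B d * component d h" using d by (simp add: mult_mat_assoc dims')
  also have "\<dots> = B d * (component d g * component d h)"
    unfolding commuting_B[OF g d] using d by (simp add: mult_mat_assoc dims')
  finally show ?thesis
    unfolding component_def[of d "g * h"]
    using component_B[OF d mult_carrier_mat[OF cc]] by simp
qed

text \<open>\<open>S d\<close> is the Gram matrix of \<open>B d\<close>, in which \<open>g\<close>
  commutes with \<open>X^(d-1)\<close> and preserves the form.\<close>

lemma component_isometry:
  assumes g: "commuting g" "g \<in> isometries N (I_pq p q)" and d: "d \<in> D"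
  shows "component d g \<in> isometries (t d) (S d)"
proof -
  have gc: "g \<in> carrier_mat N N" and gI: "mat_star g * I_pq p q * g = I_pq p q"
    using g by (auto simp: isometries_def)
  let ?c = "component d g"
  note cc = component_carrier[OF d gc]
  have dims': "dim_row g = N" "dim_col g = N" "dim_row ?c = t d" "dim_col ?c = t d" using gc cc by auto
  have "mat_star ?c * S d * ?c = mat_star ?c * (mat_star (B d) * (I_pq p q * (X ^\<^sub>m (d - 1) * (B d * ?c))))"
    unfolding gram[OF d, symmetric] using d by (simp add: mult_mat_assoc dims')
  also have "\<dots> = mat_star (B d * ?c) * (I_pq p q * (X ^\<^sub>m (d - 1) * (B d * ?c)))"
    using d by (simp add: mult_mat_assoc mat_star_mult dims')
  also have "\<dots> = mat_star (g * B d) * (I_pq p q * (X ^\<^sub>m (d - 1) * (g * B d)))"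
    unfolding commuting_B[OF g(1) d, symmetric] ..
  also have "X ^\<^sub>m (d - 1) * (g * B d) = X ^\<^sub>m (d - 1) * g * B d"
    using d by (simp add: mult_mat_assoc dims')
  also have "\<dots> = g * (X ^\<^sub>m (d - 1) * B d)"
    unfolding commuting_X_pow[OF g(1), symmetric] using d by (simp add: mult_mat_assoc dims')
  also have "mat_star (g * B d) * (I_pq p q * (g * (X ^\<^sub>m (d - 1) * B d))) =
      mat_star (B d) * ((mat_star g * I_pq p q * g) * (X ^\<^sub>m (d - 1) * B d))"
    using d by (simp add: mult_mat_assoc mat_star_mult dims')
  also have "\<dots> = S d" unfolding gI by (rule gram[OF d])
  finally show ?thesis using cc by (simp add: isometries_def)
qed

end


section \<open>The groups\<close>

lemma complexify_inject:
  assumes "A \<in> carrier_mat n n" "B \<in> carrier_mat n n" "complexify A = complexify B"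
  shows "A = B"
proof (rule eq_matI)
  fix i j assume "i < dim_row B" "j < dim_col B"
  then have ij: "i < n" "j < n" using assms by auto
  have "complexify A $$ (i, j) = complexify B $$ (i, j)" "complexify A $$ (i, n + j) = complexify B $$ (i, n + j)"
    using assms(3) by simp_all
  then show "A $$ (i, j) = B $$ (i, j)"
    using assms(1,2) ij
    by (simp add: complexify_four_block zpart_def wpart_def quat_eq_iff)
qed (use assms in auto)

text \<open>Over the complex numbers one-sided inverses of square matrices are two-sided; the
  embedding is multiplicative and injective, so this descends.\<close>

lemma quat_mat_inverse_commute:
  fixes A B :: "quat mat"
  assumes A: "A \<in> carrier_mat n n" and B: "B \<in> carrier_mat n n" and AB: "A * B = 1\<^sub>m n"
  shows "B * A = 1\<^sub>m n"
proof (rule complexify_inject)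
  have "complexify A * complexify B = 1\<^sub>m (n + n)"
    using AB by (simp add: complexify_mult[OF A B, symmetric] complexify_one)
  then have "complexify B * complexify A = 1\<^sub>m (n + n)"
    by (rule mat_mult_left_right_inverse[OF complexify_carrier[OF A] complexify_carrier[OF B]])
  then show "complexify (B * A) = complexify (1\<^sub>m n)"
    by (simp add: complexify_mult[OF B A] complexify_one)
qed (use A B in auto)

lemma isometries_SL_H:
  assumes "S \<in> carrier_mat n n" "T \<in> carrier_mat n n" "S * T = 1\<^sub>m n"
  shows "{g \<in> SL_H n. mat_star g * S * g = S} = isometries n S"
  using reduced_norm_isometry[OF _ assms] by (auto simp: SL_H_def isometries_def)

lemma Sp_eq: "Sp p q = mat_group (p + q) (isometries (p + q) (I_pq p q))"
  unfolding Sp_def isometries_SL_H[OF I_pq_carrier I_pq_carrier I_pq_square] ..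

lemma quat_j_smult_inverse:
  "(- quat_j \<cdot>\<^sub>m 1\<^sub>m m) * (quat_j \<cdot>\<^sub>m 1\<^sub>m m) = (1\<^sub>m m :: quat mat)"
  "(quat_j \<cdot>\<^sub>m 1\<^sub>m m) * (- quat_j \<cdot>\<^sub>m 1\<^sub>m m) = (1\<^sub>m m :: quat mat)"
proof -
  have jj: "quat_j * quat_j = - 1" by (simp add: quat_j_def quat_ops)
  have "(a \<cdot>\<^sub>m 1\<^sub>m m) * (b \<cdot>\<^sub>m 1\<^sub>m m) = a * b \<cdot>\<^sub>m (1\<^sub>m m :: quat mat)" for a b
    by (rule eq_matI)
      (auto simp: scalar_prod_def if_distrib[of "\<lambda>x. _ * x"] if_distrib[of "\<lambda>x. x * _"] cong: if_cong)
  then show "(- quat_j \<cdot>\<^sub>m 1\<^sub>m m) * (quat_j \<cdot>\<^sub>m 1\<^sub>m m) = (1\<^sub>m m :: quat mat)"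
    "(quat_j \<cdot>\<^sub>m 1\<^sub>m m) * (- quat_j \<cdot>\<^sub>m 1\<^sub>m m) = (1\<^sub>m m :: quat mat)"
    by (auto simp: jj intro!: eq_matI)
qed

lemma SO_star_eq: "SO_star m = mat_group m (isometries m (quat_j \<cdot>\<^sub>m 1\<^sub>m m))"
  unfolding SO_star_def
  by (subst isometries_SL_H[OF _ _ quat_j_smult_inverse(2)]) auto

lemma isometries_mult:
  assumes g: "g \<in> isometries n S" and h: "h \<in> isometries n S" and S: "S \<in> carrier_mat n n"
  shows "g * h \<in> isometries n S"
proof -
  have c: "g \<in> carrier_mat n n" "h \<in> carrier_mat n n" using g h by (auto simp: isometries_def)
  then have "mat_star (g * h) * S * (g * h) = mat_star h * (mat_star g * S * g) * h"
    using S by (simp add: mat_star_mult mult_mat_assoc)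
  then show ?thesis using g h c by (simp add: isometries_def)
qed

lemma group_Sp: "group (Sp p q)"
  unfolding Sp_eq
proof (rule groupI)
  let ?n = "p + q" and ?I = "I_pq p q"
  let ?G = "mat_group ?n (isometries ?n ?I)"
  have I_star: "mat_star ?I = ?I" by (rule eq_matI) (auto simp: I_pq_index)
  show "x \<otimes>\<^bsub>?G\<^esub> y \<in> carrier ?G" if "x \<in> carrier ?G" "y \<in> carrier ?G" for x y
    using that by (simp add: mat_group_def isometries_mult)
  show "\<one>\<^bsub>?G\<^esub> \<in> carrier ?G"
  proof -
    have "mat_star (1\<^sub>m ?n) = 1\<^sub>m ?n" by (rule eq_matI) auto
    then show ?thesis by (simp add: mat_group_def isometries_def)
  qed
  show "x \<otimes>\<^bsub>?G\<^esub> y \<otimes>\<^bsub>?G\<^esub> z = x \<otimes>\<^bsub>?G\<^esub> (y \<otimes>\<^bsub>?G\<^esub> z)"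
    if "x \<in> carrier ?G" "y \<in> carrier ?G" "z \<in> carrier ?G" for x y z
    using that assoc_mult_mat[of x ?n ?n y ?n z ?n] by (simp add: mat_group_def isometries_def)
  show "\<one>\<^bsub>?G\<^esub> \<otimes>\<^bsub>?G\<^esub> x = x" if "x \<in> carrier ?G" for x
    using that left_mult_one_mat[of x ?n ?n] by (simp add: mat_group_def isometries_def)
  show "\<exists>y\<in>carrier ?G. y \<otimes>\<^bsub>?G\<^esub> x = \<one>\<^bsub>?G\<^esub>" if "x \<in> carrier ?G" for x
  proof -
    have x: "x \<in> carrier_mat ?n ?n" "mat_star x * ?I * x = ?I" using that by (auto simp: mat_group_def isometries_def)
    \<comment> \<open>The inverse is read off from the invariance equation, because
      \<open>?I\<close> is its own inverse.\<close>
    define y where "y = ?I * mat_star x * ?I"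
    have d: "dim_row x = ?n" "dim_col x = ?n" using x by auto
    have y: "y \<in> carrier_mat ?n ?n" unfolding y_def by (intro carrier_matI) auto
    have yx: "y * x = 1\<^sub>m ?n"
    proof -
      have "y * x = ?I * (mat_star x * ?I * x)" unfolding y_def by (simp add: mult_mat_assoc d)
      then show ?thesis by (simp add: x(2) I_pq_square)
    qed
    have xy: "x * y = 1\<^sub>m ?n" by (rule quat_mat_inverse_commute[OF y x(1) yx])
    \<comment> \<open>Invariance under the inverse reduces to this equation, which is
      \<open>x * y = 1\<close> multiplied by \<open>?I\<close> on the right.\<close>
    have "x * (?I * mat_star x) = ?I"
    proof -
      have "x * y * ?I = x * (?I * mat_star x) * (?I * ?I)" unfolding y_def by (simp add: mult_mat_assoc d)
      then show ?thesis using x(1) unfolding xy I_pq_square by (simp add: mult_mat_assoc d)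
    qed
    moreover have "mat_star y * ?I * y = ?I * (x * (?I * ?I * (?I * mat_star x))) * ?I"
      unfolding y_def by (simp add: mat_star_mult I_star mult_mat_assoc d)
    ultimately have "mat_star y * ?I * y = ?I"
      unfolding I_pq_square by (simp add: mult_mat_assoc d I_pq_square)
    then show ?thesis using y yx by (intro bexI[of _ y]) (auto simp: mat_group_def isometries_def)
  qed
qed

lemma carrier_centralizer:
  assumes X: "X \<in> carrier_mat (p + q) (p + q)" and H: "H \<in> carrier_mat (p + q) (p + q)"
    and Y: "Y \<in> carrier_mat (p + q) (p + q)"
  shows "carrier (centralizer (Sp p q) X H Y) =
    {g \<in> isometries (p + q) (I_pq p q). g * X = X * g \<and> g * H = H * g \<and> g * Y = Y * g}"
proof -
  interpret group "Sp p q" by (rule group_Sp)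
  have Ad: "Ad (Sp p q) g A = A \<longleftrightarrow> g * A = A * g"
    if g: "g \<in> carrier (Sp p q)" and A: "A \<in> carrier_mat (p + q) (p + q)" for g A
  proof -
    let ?h = "inv\<^bsub>Sp p q\<^esub> g"
    have h: "?h \<in> carrier (Sp p q)" using g by (rule inv_closed)
    have c: "g \<in> carrier_mat (p + q) (p + q)" "?h \<in> carrier_mat (p + q) (p + q)"
      using g h by (auto simp: Sp_eq mat_group_def isometries_def)
    have inv: "g * ?h = 1\<^sub>m (p + q)" "?h * g = 1\<^sub>m (p + q)"
      using r_inv[OF g] l_inv[OF g] by (simp_all add: Sp_def mat_group_def)
    have d: "dim_row g = p + q" "dim_col g = p + q" "dim_row ?h = p + q" "dim_col ?h = p + q"
      "dim_row A = p + q" "dim_col A = p + q"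
      using c A by auto
    show ?thesis
    proof
      assume "Ad (Sp p q) g A = A"
      then have "g * A * ?h * g = A * g" by (simp add: Ad_def)
      moreover have "g * A * ?h * g = g * A * (?h * g)" by (simp add: mult_mat_assoc d)
      ultimately show "g * A = A * g" using inv A c by simp
    next
      assume eq: "g * A = A * g"
      have "A * g * ?h = A * (g * ?h)" by (simp add: mult_mat_assoc d)
      then show "Ad (Sp p q) g A = A" using inv A c unfolding Ad_def eq by simp
    qed
  qed
  have "carrier (centralizer (Sp p q) X H Y) =
      {g \<in> carrier (Sp p q). g * X = X * g \<and> g * H = H * g \<and> g * Y = Y * g}"
    using Ad X H Y by (auto simp: centralizer_def)
  then show ?thesis by (simp add: Sp_eq mat_group_def)
qed


section \<open>Topology\<close>

lemma topspace_mat_topology [simp]: "topspace (mat_topology n G) = carrier G"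
  by (auto simp: mat_topology_def topspace_pullback_topology)

lemma continuous_map_mat_entry:
  assumes "i < n" "j < n"
  shows "continuous_map (mat_topology n G) euclidean (\<lambda>A. A $$ (i, j))"
proof -
  have "continuous_map (product_topology (\<lambda>_. euclidean) ({..<n} \<times> {..<n})) euclidean (\<lambda>f. f (i, j) :: quat)"
    using assms by (intro continuous_map_product_projection) auto
  then have "continuous_map (mat_topology n G) euclidean
      ((\<lambda>f. f (i, j)) \<circ> (\<lambda>A. \<lambda>ij\<in>{..<n} \<times> {..<n}. A $$ ij))"
    unfolding mat_topology_def by (rule continuous_map_pullback)
  then show ?thesis using assms by (simp add: o_def)
qed

lemma continuous_map_into_mat_topology:
  assumes "\<And>x. x \<in> topspace T \<Longrightarrow> f x \<in> carrier G"
    and "\<And>i j. i < n \<Longrightarrow> j < n \<Longrightarrow> continuous_map T euclidean (\<lambda>x. f x $$ (i, j))"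
  shows "continuous_map T (mat_topology n G) f"
  unfolding mat_topology_def
proof (rule continuous_map_pullback')
  show "continuous_map T (product_topology (\<lambda>_. euclidean) ({..<n} \<times> {..<n}))
      ((\<lambda>A. \<lambda>ij\<in>{..<n} \<times> {..<n}. A $$ ij) \<circ> f)"
    unfolding continuous_map_componentwise using assms(2) by auto
qed (use assms(1) in auto)

lemma continuous_map_quat_mult:
  fixes f :: "'a \<Rightarrow> quat"
  assumes "continuous_map T euclidean f"
  shows "continuous_map T euclidean (\<lambda>x. a * f x)" "continuous_map T euclidean (\<lambda>x. f x * a)"
proof -
  have "continuous_map euclidean euclidean (\<lambda>y :: quat. a * y)" "continuous_map euclidean euclidean (\<lambda>y :: quat. y * a)"
    by (auto simp: continuous_map_iff_continuous2 intro!: continuous_intros)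
  then show "continuous_map T euclidean (\<lambda>x. a * f x)" "continuous_map T euclidean (\<lambda>x. f x * a)"
    using continuous_map_compose[OF assms, of euclidean "\<lambda>y. a * y"]
      continuous_map_compose[OF assms, of euclidean "\<lambda>y. y * a"] by (simp_all add: o_def)
qed

lemma continuous_map_mult_mat_left:
  assumes "\<And>i j. i < r \<Longrightarrow> j < c \<Longrightarrow> continuous_map T euclidean (\<lambda>x. F x $$ (i, j))"
    and "\<And>x. x \<in> topspace T \<Longrightarrow> F x \<in> carrier_mat r c" and "A \<in> carrier_mat a r" "i < a" "j < c"
  shows "continuous_map T euclidean (\<lambda>x. (A * F x :: quat mat) $$ (i, j))"
proof (rule continuous_map_eq)
  show "continuous_map T euclidean (\<lambda>x. \<Sum>k\<in>{0..<r}. A $$ (i, k) * F x $$ (k, j))"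
    using assms by (intro continuous_map_sum continuous_map_quat_mult) auto
  fix x assume "x \<in> topspace T"
  from assms(2)[OF this] show "(\<Sum>k\<in>{0..<r}. A $$ (i, k) * F x $$ (k, j)) = (A * F x) $$ (i, j)"
    using assms(3-5) by (simp add: scalar_prod_def)
qed

lemma continuous_map_mult_mat_right:
  assumes "\<And>i j. i < r \<Longrightarrow> j < c \<Longrightarrow> continuous_map T euclidean (\<lambda>x. F x $$ (i, j))"
    and "\<And>x. x \<in> topspace T \<Longrightarrow> F x \<in> carrier_mat r c" and "A \<in> carrier_mat c b" "i < r" "j < b"
  shows "continuous_map T euclidean (\<lambda>x. (F x * A :: quat mat) $$ (i, j))"
proof (rule continuous_map_eq)
  show "continuous_map T euclidean (\<lambda>x. \<Sum>k\<in>{0..<c}. F x $$ (i, k) * A $$ (k, j))"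
    using assms by (intro continuous_map_sum continuous_map_quat_mult) auto
  fix x assume "x \<in> topspace T"
  from assms(2)[OF this] show "(\<Sum>k\<in>{0..<c}. F x $$ (i, k) * A $$ (k, j)) = (F x * A) $$ (i, j)"
    using assms(3-5) by (simp add: scalar_prod_def)
qed

section \<open>The isomorphism of topological groups\<close>

context adapted_bases
begin

lemma continuous_map_component:
  assumes d: "d \<in> D" and Z: "carrier Z \<subseteq> carrier_mat N N" and ij: "i < t d" "j < t d"
  shows "continuous_map (mat_topology N Z) euclidean (\<lambda>g. component d g $$ (i, j))"
  unfolding component_def
proof (rule continuous_map_mult_mat_left[OF _ _ C_carrier[OF d] ij])
  show "g * B d \<in> carrier_mat N (t d)" if "g \<in> topspace (mat_topology N Z)" for g
    using that Z by (intro mult_carrier_mat[OF _ B[OF d]]) auto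
  show "continuous_map (mat_topology N Z) euclidean (\<lambda>g. (g * B d) $$ (k, l))" if "k < N" "l < t d" for k l
    using Z that by (intro continuous_map_mult_mat_right[OF continuous_map_mat_entry _ B[OF d]]) auto
qed

lemma continuous_map_assemble:
  assumes G: "\<And>d x. d \<in> D \<Longrightarrow> x \<in> topspace T \<Longrightarrow> G x d \<in> carrier_mat (t d) (t d)"
    and cont: "\<And>d i j. d \<in> D \<Longrightarrow> i < t d \<Longrightarrow> j < t d \<Longrightarrow> continuous_map T euclidean (\<lambda>x. G x d $$ (i, j))"
    and ij: "i < N" "j < N"
  shows "continuous_map T euclidean (\<lambda>x. assemble (G x) $$ (i, j))"
proof (rule continuous_map_eq)
  show "continuous_map T euclidean (\<lambda>x. \<Sum>s\<in>index_set. (\<lambda>(d, l). U d l * (G x d * C d l)) s $$ (i, j))"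
  proof (rule continuous_map_sum[OF index_set(1)])
    fix s assume "s \<in> index_set"
    then obtain d l where dl: "s = (d, l)" "d \<in> D" by (cases s) (auto simp: index_set)
    have "continuous_map T euclidean (\<lambda>x. (U d l * (G x d * C d l)) $$ (i, j))"
    proof (rule continuous_map_mult_mat_left[OF _ _ U_carrier[OF dl(2)] ij])
      show "G x d * C d l \<in> carrier_mat (t d) N" if "x \<in> topspace T" for x
        by (rule mult_carrier_mat[OF G[OF dl(2) that] C_carrier[OF dl(2)]])
      show "continuous_map T euclidean (\<lambda>x. (G x d * C d l) $$ (k, m))" if "k < t d" "m < N" for k m
        using that by (intro continuous_map_mult_mat_right[OF cont[OF dl(2)] G[OF dl(2)] C_carrier[OF dl(2)]])
    qed
    then show "continuous_map T euclidean (\<lambda>x. (\<lambda>(d, l). U d l * (G x d * C d l)) s $$ (i, j))"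
      using dl by simp
  qed
  show "(\<Sum>s\<in>index_set. (\<lambda>(d, l). U d l * (G x d * C d l)) s $$ (i, j)) = assemble (G x) $$ (i, j)" for x
    using ij by (simp add: assemble_def mat_sum_def)
qed

text \<open>The sizes and groups are tied to \<open>t\<close> and \<open>S\<close> only on
  \<open>E1\<close> and \<open>E2\<close>, because the theorem names the odd factors by
  \<open>p'\<close> and \<open>q'\<close>, whose sum is known to be \<open>t\<close> for odd parts
  alone.\<close>

lemma centralizer_iso:
  fixes K1 K2 :: "nat \<Rightarrow> quat mat monoid" and m1 m2 :: "nat \<Rightarrow> nat"
  assumes E12: "D = E1 \<union> E2" "E1 \<inter> E2 = {}"
    and K1: "\<And>d. d \<in> E1 \<Longrightarrow> m1 d = t d" "\<And>d. d \<in> E1 \<Longrightarrow> K1 d = mat_group (t d) (isometries (t d) (S d))"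
    and K2: "\<And>d. d \<in> E2 \<Longrightarrow> m2 d = t d" "\<And>d. d \<in> E2 \<Longrightarrow> K2 d = mat_group (t d) (isometries (t d) (S d))"
  shows "topological_group_iso
      (centralizer (Sp p q) X H Y) (mat_topology (p + q) (centralizer (Sp p q) X H Y))
      (product_group E1 K1 \<times>\<times> product_group E2 K2)
      (prod_topology (product_topology (\<lambda>d. mat_topology (m1 d) (K1 d)) E1)
        (product_topology (\<lambda>d. mat_topology (m2 d) (K2 d)) E2))"
proof -
  let ?Z = "centralizer (Sp p q) X H Y"
  let ?K = "product_group E1 K1 \<times>\<times> product_group E2 K2"
  let ?T1 = "product_topology (\<lambda>d. mat_topology (m1 d) (K1 d)) E1"
  let ?T2 = "product_topology (\<lambda>d. mat_topology (m2 d) (K2 d)) E2"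
  let ?I = "I_pq p q"
  have Z: "carrier ?Z = {g \<in> isometries N ?I. g * X = X * g \<and> g * H = H * g \<and> g * Y = Y * g}"
    by (rule carrier_centralizer[OF X H Y])
  then have Zc: "carrier ?Z \<subseteq> carrier_mat N N" and Z_comm: "\<And>g. g \<in> carrier ?Z \<Longrightarrow> commuting g"
    by (auto simp: isometries_def commuting_def)
  have c1: "carrier (K1 d) = isometries (t d) (S d)" "x \<otimes>\<^bsub>K1 d\<^esub> y = x * y" if "d \<in> E1" for d x y
    using K1(2)[OF that] by (simp_all add: mat_group_def)
  have c2: "carrier (K2 d) = isometries (t d) (S d)" "x \<otimes>\<^bsub>K2 d\<^esub> y = x * y" if "d \<in> E2" for d x y
    using K2(2)[OF that] by (simp_all add: mat_group_def)
  have multZ: "g \<otimes>\<^bsub>?Z\<^esub> h = g * h" for g h by (simp add: centralizer_def Sp_def mat_group_def)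
  define \<phi> where "\<phi> g = (\<lambda>d\<in>E1. component d g, \<lambda>d\<in>E2. component d g)" for g
  \<comment> \<open>Glues the even and the odd family into the single one that
    \<open>assemble\<close> expects.\<close>
  define fam where "fam x d = (if d \<in> E1 then fst x d else snd x d)" for x :: "(nat \<Rightarrow> quat mat) \<times> (nat \<Rightarrow> quat mat)" and d
  define \<psi> where "\<psi> x = assemble (fam x)" for x
  have fam: "fam x d \<in> isometries (t d) (S d)" if "x \<in> carrier ?K" "d \<in> D" for x d
    using that E12 c1 c2 by (auto simp: fam_def PiE_iff)
  then have famc: "fam x d \<in> carrier_mat (t d) (t d)" if "x \<in> carrier ?K" "d \<in> D" for x d
    using that by (auto simp: isometries_def)
  have \<phi>_in: "\<phi> g \<in> carrier ?K" if "g \<in> carrier ?Z" for g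
    using that component_isometry[OF Z_comm[OF that]] Z E12 c1 c2 by (auto simp: \<phi>_def)
  have \<psi>_in: "\<psi> x \<in> carrier ?Z" if x: "x \<in> carrier ?K" for x
    unfolding Z \<psi>_def
    using assemble_isometry[OF fam[OF x]] assemble_commutes[OF famc[OF x] X X_U]
      assemble_commutes[OF famc[OF x] H H_U] assemble_commutes[OF famc[OF x] Y Y_U] by simp
  have \<psi>\<phi>: "\<psi> (\<phi> g) = g" if g: "g \<in> carrier ?Z" for g
  proof -
    have "fam (\<phi> g) d = component d g" if "d \<in> D" for d
      using that E12 by (auto simp: fam_def \<phi>_def)
    then have "assemble (fam (\<phi> g)) = assemble (\<lambda>d. component d g)"
      unfolding assemble_def by (intro mat_sum_cong) (auto simp: index_set)
    then show ?thesis using assemble_component[OF Z_comm[OF g]] by (simp add: \<psi>_def)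
  qed
  have \<phi>\<psi>: "\<phi> (\<psi> x) = x" if x: "x \<in> carrier ?K" for x
  proof -
    have c: "component d (\<psi> x) = fam x d" if "d \<in> D" for d
      unfolding \<psi>_def using component_assemble[OF famc[OF x] that] .
    obtain a b where ab: "x = (a, b)" by (cases x)
    \<comment> \<open>Elements of the product groups are functions fixed outside the index set, so
      equality on that set suffices.\<close>
    have "a \<in> extensional E1" "b \<in> extensional E2" using x by (auto simp: ab PiE_iff)
    moreover have "component d (\<psi> x) = a d" if "d \<in> E1" for d using c[of d] that E12 by (simp add: fam_def ab)
    moreover have "component d (\<psi> x) = b d" if "d \<in> E2" for d
      using c[of d] that E12 by (auto simp: fam_def ab)
    ultimately have "(\<lambda>d\<in>E1. component d (\<psi> x)) = a" "(\<lambda>d\<in>E2. component d (\<psi> x)) = b"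
      by (auto intro: extensionalityI[of _ E1] extensionalityI[of _ E2])
    then show ?thesis by (simp add: \<phi>_def ab)
  qed
  have "\<phi> \<in> iso ?Z ?K"
    unfolding iso_def
  proof (intro CollectI conjI homI)
    show "\<phi> (g \<otimes>\<^bsub>?Z\<^esub> h) = \<phi> g \<otimes>\<^bsub>?K\<^esub> \<phi> h" if "g \<in> carrier ?Z" "h \<in> carrier ?Z" for g h
      using that E12 component_mult[OF Z_comm Z_comm]
      by (auto simp: multZ \<phi>_def DirProd_def c1 c2 restrict_def fun_eq_iff)
    show "bij_betw \<phi> (carrier ?Z) (carrier ?K)"
      by (rule bij_betw_byWitness[of _ \<psi>]; intro ballI image_subsetI \<psi>\<phi> \<phi>\<psi> \<phi>_in \<psi>_in)
  qed (rule \<phi>_in)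
  moreover have "homeomorphic_maps (mat_topology N ?Z) (prod_topology ?T1 ?T2) \<phi> \<psi>"
    unfolding homeomorphic_maps_def
  proof (intro conjI ballI)
    have topK: "topspace (prod_topology ?T1 ?T2) = carrier ?K" by simp
    show "\<psi> (\<phi> g) = g" if "g \<in> topspace (mat_topology N ?Z)" for g using that \<psi>\<phi> by simp
    show "\<phi> (\<psi> x) = x" if "x \<in> topspace (prod_topology ?T1 ?T2)" for x
      using that \<phi>\<psi> unfolding topK by blast
    have comp: "continuous_map (mat_topology N ?Z) (mat_topology (t d) (mat_group (t d) (isometries (t d) (S d)))) (component d)"
      if d: "d \<in> D" for d
    proof (rule continuous_map_into_mat_topology)
      show "component d g \<in> carrier (mat_group (t d) (isometries (t d) (S d)))"
        if "g \<in> topspace (mat_topology N ?Z)" for g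
        using that component_isometry[OF Z_comm _ d] Z by (simp add: mat_group_def)
    qed (rule continuous_map_component[OF d Zc])
    have "continuous_map (mat_topology N ?Z) ?T1 (\<lambda>g. \<lambda>d\<in>E1. component d g)"
      "continuous_map (mat_topology N ?Z) ?T2 (\<lambda>g. \<lambda>d\<in>E2. component d g)"
      unfolding continuous_map_componentwise using comp K1 K2 E12 by auto
    then show "continuous_map (mat_topology N ?Z) (prod_topology ?T1 ?T2) \<phi>"
      unfolding \<phi>_def[abs_def] by (simp add: continuous_map_paired)
    show "continuous_map (prod_topology ?T1 ?T2) (mat_topology N ?Z) \<psi>"
    proof (rule continuous_map_into_mat_topology)
      show "\<psi> x \<in> carrier ?Z" if "x \<in> topspace (prod_topology ?T1 ?T2)" for x
        using that \<psi>_in unfolding topK by blast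
      fix i j assume ij: "i < N" "j < N"
      show "continuous_map (prod_topology ?T1 ?T2) euclidean (\<lambda>x. \<psi> x $$ (i, j))"
        unfolding \<psi>_def
      proof (rule continuous_map_assemble[OF _ _ ij])
        show "fam x d \<in> carrier_mat (t d) (t d)" if "d \<in> D" "x \<in> topspace (prod_topology ?T1 ?T2)" for d x
          using that famc unfolding topK by blast
        fix d k l assume d: "d \<in> D" and kl: "k < t d" "l < t d"
        show "continuous_map (prod_topology ?T1 ?T2) euclidean (\<lambda>x. fam x d $$ (k, l))"
        proof (cases "d \<in> E1")
          case True
          have "continuous_map ?T1 (mat_topology (m1 d) (K1 d)) (\<lambda>f. f d)"
            by (rule continuous_map_product_projection[OF True])
          then have "continuous_map (prod_topology ?T1 ?T2) (mat_topology (m1 d) (K1 d)) ((\<lambda>f. f d) \<circ> fst)"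
            by (rule continuous_map_compose[OF continuous_map_fst])
          then have "continuous_map (prod_topology ?T1 ?T2) euclidean ((\<lambda>A. A $$ (k, l)) \<circ> ((\<lambda>f. f d) \<circ> fst))"
            using kl K1(1)[OF True] by (intro continuous_map_compose[OF _ continuous_map_mat_entry]) auto
          then show ?thesis using True by (simp add: o_def fam_def)
        next
          case False
          then have dO: "d \<in> E2" using d E12 by blast
          have "continuous_map ?T2 (mat_topology (m2 d) (K2 d)) (\<lambda>f. f d)"
            by (rule continuous_map_product_projection[OF dO])
          then have "continuous_map (prod_topology ?T1 ?T2) (mat_topology (m2 d) (K2 d)) ((\<lambda>f. f d) \<circ> snd)"
            by (rule continuous_map_compose[OF continuous_map_snd])
          then have "continuous_map (prod_topology ?T1 ?T2) euclidean ((\<lambda>A. A $$ (k, l)) \<circ> ((\<lambda>f. f d) \<circ> snd))"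
            using kl K2(1)[OF dO] by (intro continuous_map_compose[OF _ continuous_map_mat_entry]) auto
          then show ?thesis using False by (simp add: o_def fam_def)
        qed
      qed
    qed
  qed
  then have "homeomorphic_map (mat_topology N ?Z) (prod_topology ?T1 ?T2) \<phi>"
    by (rule homeomorphic_maps_imp_map)
  ultimately show ?thesis unfolding topological_group_iso_def by blast
qed

end


section \<open>The Lie algebra\<close>

lemma sp_carrier: "A \<in> sp p q \<Longrightarrow> A \<in> carrier_mat (p + q) (p + q)"
  by (simp add: lie_algebra_def)

lemma has_vector_derivative_unique:
  assumes "(f has_vector_derivative a) (at x)" "(f has_vector_derivative b) (at x)"
  shows "a = b"
proof -
  have "(\<lambda>t. t *\<^sub>R a) = (\<lambda>t. t *\<^sub>R b)"
    using assms unfolding has_vector_derivative_def by (rule has_derivative_unique)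
  from fun_cong[OF this, of 1] show ?thesis by simp
qed

text \<open>The entrywise derivative at the identity of \<open>g^* I g = I\<close> along a curve;
  \<open>s\<close> is the diagonal of \<open>I_pq\<close>.\<close>

lemma sp_entries:
  assumes A: "A \<in> sp p q" and ij: "i < p + q" "j < p + q"
  defines "s \<equiv> \<lambda>k. if k < p then 1 else - 1 :: quat"
  shows "qcnj (A $$ (j, i)) * s j + s i * A $$ (i, j) = 0"
proof -
  let ?n = "p + q"
  obtain \<gamma> :: "real \<Rightarrow> quat mat" where \<gamma>: "\<And>t. \<gamma> t \<in> carrier (Sp p q)" "\<gamma> 0 = 1\<^sub>m ?n"
    and deriv: "\<And>i j. i < ?n \<Longrightarrow> j < ?n \<Longrightarrow> ((\<lambda>t. \<gamma> t $$ (i, j)) has_vector_derivative A $$ (i, j)) (at 0)"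
    using A unfolding lie_algebra_def by blast
  have lin: "bounded_linear qcnj"
  proof (rule bounded_linear_intro[of _ 1])
    show "norm (qcnj x) \<le> norm x * 1" for x by (simp add: norm_quat_def qcnj_def)
  qed simp_all
  have const: "(\<Sum>k<?n. qcnj (\<gamma> t $$ (k, i)) * (s k * \<gamma> t $$ (k, j))) = I_pq p q $$ (i, j)" for t
  proof -
    have g: "\<gamma> t \<in> carrier_mat ?n ?n" "mat_star (\<gamma> t) * I_pq p q * \<gamma> t = I_pq p q"
      using \<gamma>(1)[of t] by (auto simp: Sp_eq mat_group_def isometries_def)
    have "(mat_star (\<gamma> t) * (I_pq p q * \<gamma> t)) $$ (i, j) = form_pq p q (col (\<gamma> t) i) (col (\<gamma> t) j)"
      by (rule gram_index[OF g(1) g(1) ij])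
    also have "\<dots> = (\<Sum>k<?n. qcnj (\<gamma> t $$ (k, i)) * (s k * \<gamma> t $$ (k, j)))"
      using g(1) ij by (subst form_pq_expand) (auto simp: s_def intro!: sum.cong)
    also have "mat_star (\<gamma> t) * (I_pq p q * \<gamma> t) = I_pq p q"
      using g by (simp add: mult_mat_assoc)
    finally show ?thesis by simp
  qed
  have "((\<lambda>t. \<Sum>k<?n. qcnj (\<gamma> t $$ (k, i)) * (s k * \<gamma> t $$ (k, j))) has_vector_derivative
      (\<Sum>k<?n. qcnj (\<gamma> 0 $$ (k, i)) * (s k * A $$ (k, j)) + qcnj (A $$ (k, i)) * (s k * \<gamma> 0 $$ (k, j)))) (at 0)"
  proof (intro has_vector_derivative_sum has_vector_derivative_mult)
    fix k assume "k \<in> {..<?n}"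
    then have k: "k < ?n" by simp
    show "((\<lambda>t. qcnj (\<gamma> t $$ (k, i))) has_vector_derivative qcnj (A $$ (k, i))) (at 0)"
      by (rule bounded_linear.has_vector_derivative[OF lin deriv[OF k ij(1)]])
    show "((\<lambda>t. s k * \<gamma> t $$ (k, j)) has_vector_derivative s k * A $$ (k, j)) (at 0)"
      by (rule bounded_linear.has_vector_derivative[OF bounded_linear_mult_right deriv[OF k ij(2)]])
  qed
  moreover have "((\<lambda>t. \<Sum>k<?n. qcnj (\<gamma> t $$ (k, i)) * (s k * \<gamma> t $$ (k, j))) has_vector_derivative 0) (at 0)"
    unfolding const by (rule has_vector_derivative_const)
  ultimately have "0 = (\<Sum>k<?n. qcnj (\<gamma> 0 $$ (k, i)) * (s k * A $$ (k, j)) + qcnj (A $$ (k, i)) * (s k * \<gamma> 0 $$ (k, j)))"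
    by (rule has_vector_derivative_unique[symmetric])
  also have "\<dots> = (\<Sum>k<?n. if k = i then s i * A $$ (i, j) else 0) + (\<Sum>k<?n. if k = j then qcnj (A $$ (j, i)) * s j else 0)"
    unfolding sum.distrib[symmetric] \<gamma>(2) using ij by (intro sum.cong) auto
  also have "\<dots> = s i * A $$ (i, j) + qcnj (A $$ (j, i)) * s j"
    using ij by simp
  finally show ?thesis by (simp add: add.commute)
qed

lemma sp_skew:
  assumes A: "A \<in> sp p q" and v: "v \<in> carrier_vec (p + q)" and w: "w \<in> carrier_vec (p + q)"
  shows "form_pq p q (A *\<^sub>v v) w = - form_pq p q v (A *\<^sub>v w)"
proof -
  let ?n = "p + q"
  define s where "s k = (if k < p then 1 else - 1 :: quat)" for k
  have Ac: "A \<in> carrier_mat ?n ?n" using A by (rule sp_carrier)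
  have Av: "A *\<^sub>v u \<in> carrier_vec ?n" if "u \<in> carrier_vec ?n" for u using Ac that by (rule mult_mat_vec_carrier)
  have entry: "(A *\<^sub>v u) $ i = (\<Sum>j<?n. A $$ (i, j) * u $ j)" if "i < ?n" "u \<in> carrier_vec ?n" for i u
    using that Ac by (simp add: scalar_prod_def atLeast0LessThan)
  have form: "form_pq p q u u' = (\<Sum>i<?n. qcnj (u $ i) * (s i * u' $ i))"
    if "u \<in> carrier_vec ?n" "u' \<in> carrier_vec ?n" for u u'
    unfolding form_pq_expand[OF that] by (intro sum.cong) (auto simp: s_def)
  have skew: "qcnj (A $$ (i, j)) * s i = - (s j * A $$ (j, i))" if "i < ?n" "j < ?n" for i j
    using sp_entries[OF A that(2,1)] unfolding s_def by (simp add: eq_neg_iff_add_eq_0)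
  have "form_pq p q (A *\<^sub>v v) w = (\<Sum>i<?n. \<Sum>j<?n. qcnj (v $ j) * (qcnj (A $$ (i, j)) * s i) * w $ i)"
    unfolding form[OF Av[OF v] w]
    by (intro sum.cong refl) (simp add: entry v qcnj_sum qcnj_mult sum_distrib_right mult.assoc del: index_mult_mat_vec)
  also have "\<dots> = (\<Sum>i<?n. \<Sum>j<?n. - (qcnj (v $ j) * (s j * (A $$ (j, i) * w $ i))))"
    by (intro sum.cong refl) (simp add: skew mult.assoc)
  also have "\<dots> = (\<Sum>j<?n. \<Sum>i<?n. - (qcnj (v $ j) * (s j * (A $$ (j, i) * w $ i))))"
    by (rule sum.swap)
  also have "\<dots> = - form_pq p q v (A *\<^sub>v w)"
    unfolding form[OF v Av[OF w]] sum_negf[symmetric]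
    by (intro sum.cong refl) (simp add: entry w sum_distrib_left sum_negf del: index_mult_mat_vec)
  finally show ?thesis .
qed

section \<open>From the signed diagram to adapted bases\<close>

lemma (in sl2_matrices) finite_lw_nontrivial: "finite {d. d > 0 \<and> right_dim UNIV n (lw d) > 0}"
proof -
  obtain k where k: "X ^\<^sub>m k = 0\<^sub>m n n" using nilX by (auto simp: nilpotent_mat_def)
  \<comment> \<open>\<open>X^k\<close> is 0, yet injective on \<open>lw d\<close> for
    \<open>k < d\<close>.\<close>
  have "d \<le> k" if d: "right_dim UNIV n (lw d) > 0" for d
  proof (rule ccontr)
    assume "\<not> d \<le> k"
    then have "v = 0\<^sub>v n" if "v \<in> lw d" for v
    proof -
      have "X ^\<^sub>m k *\<^sub>v v = 0\<^sub>v n"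
        unfolding k using lw_carrier[OF that] by (intro eq_vecI) (auto simp: scalar_prod_def)
      then show ?thesis using lw_X_pow_inj[OF that] \<open>\<not> d \<le> k\<close> by simp
    qed
    moreover obtain vs where vs: "right_basis UNIV n vs (lw d)" "right_dim UNIV n (lw d) = length vs"
      using right_basis_exists[OF lw_right_subspace] by metis
    ultimately have "set vs \<subseteq> {0\<^sub>v n}" "right_indep UNIV n vs"
      using right_basis_iff[OF division_subring_UNIV lw_right_subspace, of vs d] by auto
    moreover from this have "vs ! 0 = 0\<^sub>v n" using d vs(2) nth_mem[of 0 vs] by (auto simp del: nth_mem)
    ultimately have "mat_of_cols n vs *\<^sub>v unit_vec (length vs) 0 = 0\<^sub>v n"
      using d vs(2) mat_of_cols_mult_unit[of 0 vs n] by simp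
    then have "unit_vec (length vs) 0 = (0\<^sub>v (length vs) :: quat vec)"
      using \<open>right_indep UNIV n vs\<close> by (auto simp: right_indep_def)
    then have "unit_vec (length vs) 0 $ 0 = (0\<^sub>v (length vs) :: quat vec) $ 0" by simp
    then show False using d vs(2) by simp
  qed
  then have "{d. d > 0 \<and> right_dim UNIV n (lw d) > 0} \<subseteq> {..k}" by auto
  then show ?thesis by (rule finite_subset) simp
qed

lemma right_dim_zero: "right_dim UNIV n {0\<^sub>v n} = 0"
proof -
  have "mat_of_cols n [] *\<^sub>v 0\<^sub>v 0 = (0\<^sub>v n :: quat vec)" by (rule eq_vecI) (auto simp: scalar_prod_def)
  then have "right_basis UNIV n [] {0\<^sub>v n}"
    unfolding right_basis_iff[OF division_subring_UNIV right_subspace_zero]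
    by (auto simp: right_indep_def)
  from right_dim_eq[OF division_subring_UNIV right_subspace_zero this] show ?thesis by simp
qed

lemma right_dim_eq_0:
  assumes W: "right_subspace UNIV n W" and "right_dim UNIV n W = 0"
  shows "W \<subseteq> {0\<^sub>v n}"
proof
  fix w assume w: "w \<in> W"
  obtain vs where vs: "right_basis UNIV n vs W" "right_dim UNIV n W = length vs"
    using right_basis_exists[OF W] by metis
  then obtain c where "c \<in> carrier_vec 0" "mat_of_cols n [] *\<^sub>v c = w"
    using w assms(2) unfolding right_basis_iff[OF division_subring_UNIV W] by fastforce
  then have "w = 0\<^sub>v n" by (auto simp: scalar_prod_def)
  then show "w \<in> {0\<^sub>v n}" by simp
qed

text \<open>Finiteness matters: over an infinite index set the sum would be the empty multiset by
  convention.\<close>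

lemma count_sum_replicate_mset:
  assumes "finite {d. f d > 0}"
  shows "count (\<Sum>d \<in> {d. f d > 0}. replicate_mset (f d) d) e = f e"
proof -
  have "count (\<Sum>d \<in> {d. f d > 0}. replicate_mset (f d) d) e = (\<Sum>d \<in> {d. f d > 0}. if d = e then f e else 0)"
    unfolding count_sum by (intro sum.cong) auto
  then show ?thesis using assms by simp
qed

theorem proposition3p34:
  fixes p q :: nat and X H Y :: "quat mat"
    and D :: signed_diagram and \<d> :: "nat multiset" and t p' q' :: "nat \<Rightarrow> nat"
  assumes "X \<in> sp p q" and "X \<noteq> 0\<^sub>m (p + q) (p + q)" and "nilpotent_mat (p + q) X"
    and "sl2_triple (p + q) (sp p q) X H Y"
    and "D = signed_young_diagram p q X H Y"
    and "\<d> = underlying_partition D"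
    and "\<And>d. t d = count \<d> d"
    and "\<And>\<theta>. \<theta> \<in> odd_parts \<d> \<Longrightarrow> p' \<theta> = count (first_column D \<theta>) 1"
    and "\<And>\<theta>. \<theta> \<in> odd_parts \<d> \<Longrightarrow> q' \<theta> = count (first_column D \<theta>) (- 1)"
  shows "topological_group_iso
      (centralizer (Sp p q) X H Y)
      (mat_topology (p + q) (centralizer (Sp p q) X H Y))
      (product_group (even_parts \<d>) (\<lambda>\<eta>. SO_star (t \<eta>)) \<times>\<times>
       product_group (odd_parts \<d>) (\<lambda>\<theta>. Sp (p' \<theta>) (q' \<theta>)))
      (prod_topology
        (product_topology (\<lambda>\<eta>. mat_topology (t \<eta>) (SO_star (t \<eta>))) (even_parts \<d>))
        (product_topology (\<lambda>\<theta>. mat_topology (p' \<theta> + q' \<theta>) (Sp (p' \<theta>) (q' \<theta>))) (odd_parts \<d>)))"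
proof -
  let ?n = "p + q"
  have triple: "H \<in> sp p q" "Y \<in> sp p q" "lie_bracket H X = 2 \<cdot>\<^sub>m X" "lie_bracket H Y = (- 2) \<cdot>\<^sub>m Y"
    "lie_bracket X Y = H"
    using assms(4) by (auto simp: sl2_triple_def)
  interpret sp_triple p q X H Y
    by unfold_locales (use assms(1,3) triple sp_carrier sp_skew in auto)
  define m where "m d = right_dim UNIV ?n (lowest ?n X H Y d)" for d
  \<comment> \<open>\<open>lowest_eq\<close> speaks of positive indices, so index 0 is ruled out
    separately.\<close>
  have m0: "m 0 = 0" by (simp add: m_def lowest_0 right_dim_zero)
  have m: "m d = right_dim UNIV ?n (lw d)" if "d > 0" for d using that by (simp add: m_def lowest_eq)
  have pos: "d > 0" if "m d > 0" for d using that m0 by (cases d) auto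
  define P where "P = {d. m d > 0}"
  have "P = {d. d > 0 \<and> right_dim UNIV ?n (lw d) > 0}" unfolding P_def using m pos by metis
  then have fin: "finite P" using finite_lw_nontrivial by simp
  have d: "\<d> = (\<Sum>d \<in> P. replicate_mset (m d) d)"
    using assms(5,6) by (simp add: signed_young_diagram_def Let_def m_def P_def)
  have tm: "t d = m d" for d
    using count_sum_replicate_mset[of m d] fin unfolding assms(7) d P_def by simp
  have set_d: "set_mset \<d> = P"
    unfolding set_mset_def P_def assms(7)[symmetric] tm ..
  have parts: "even_parts \<d> = {d \<in> P. even d}" "odd_parts \<d> = {d \<in> P. odd d}"
    by (simp_all add: even_parts_def odd_parts_def set_d)
  have P_pos: "d > 0" if "d \<in> P" for d using that pos unfolding P_def by blast
  \<comment> \<open>The entries 1 and - 1 are distinct, so their counts in the first column separate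
    the two indices.\<close>
  have p': "p' \<theta> = positive_index ?n (lw \<theta>) (form_d p q X \<theta>)"
    and q': "q' \<theta> = negative_index ?n (lw \<theta>) (form_d p q X \<theta>)" if "\<theta> \<in> odd_parts \<d>" for \<theta>
    using assms(8,9)[OF that] that P_pos[of \<theta>] unfolding assms(5)
    by (simp_all add: signed_young_diagram_def Let_def parts lowest_eq)
  define S where "S d = (if even d then quat_j \<cdot>\<^sub>m 1\<^sub>m (t d) else I_pq (p' d) (q' d))" for d
  \<comment> \<open>\<open>- quat_j\<close> is the inverse of \<open>quat_j\<close>, and
    \<open>I_pq\<close> is its own inverse.\<close>
  define S' where "S' d = (if even d then - quat_j \<cdot>\<^sub>m 1\<^sub>m (t d) else I_pq (p' d) (q' d))" for d
  have "\<forall>d\<in>P. \<exists>M. M \<in> carrier_mat ?n (t d) \<and> mat_star M * (I_pq p q * (X ^\<^sub>m (d - 1) * M)) = S d \<and>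
      (\<forall>i<t d. col M i \<in> lw d) \<and> (\<forall>v\<in>lw d. \<exists>c\<in>carrier_vec (t d). M *\<^sub>v c = v) \<and>
      (odd d \<longrightarrow> t d = p' d + q' d)"
  proof
    fix d assume dP: "d \<in> P"
    have t: "t d = right_dim UNIV ?n (lw d)" using tm m P_pos[OF dP] by simp
    show "\<exists>M. M \<in> carrier_mat ?n (t d) \<and> mat_star M * (I_pq p q * (X ^\<^sub>m (d - 1) * M)) = S d \<and>
      (\<forall>i<t d. col M i \<in> lw d) \<and> (\<forall>v\<in>lw d. \<exists>c\<in>carrier_vec (t d). M *\<^sub>v c = v) \<and>
      (odd d \<longrightarrow> t d = p' d + q' d)"
    proof (cases "even d")
      case True
      then show ?thesis
        using adapted_basis_even[OF P_pos[OF dP] True] t unfolding S_def by (metis (full_types))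
    next
      case False
      then have "d \<in> odd_parts \<d>" using dP by (simp add: parts)
      note pq = p'[OF this, symmetric] q'[OF this, symmetric]
      show ?thesis
        using adapted_basis_odd[OF False] False t unfolding S_def pq by (metis (full_types))
    qed
  qed
  from bchoice[OF this] obtain B where "\<forall>d\<in>P. B d \<in> carrier_mat ?n (t d) \<and>
      mat_star (B d) * (I_pq p q * (X ^\<^sub>m (d - 1) * B d)) = S d \<and>
      (\<forall>i<t d. col (B d) i \<in> lw d) \<and> (\<forall>v\<in>lw d. \<exists>c\<in>carrier_vec (t d). B d *\<^sub>v c = v) \<and>
      (odd d \<longrightarrow> t d = p' d + q' d)" ..
  then have basis: "\<And>d. d \<in> P \<Longrightarrow> B d \<in> carrier_mat ?n (t d)"
    "\<And>d. d \<in> P \<Longrightarrow> mat_star (B d) * (I_pq p q * (X ^\<^sub>m (d - 1) * B d)) = S d"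
    "\<And>d i. d \<in> P \<Longrightarrow> i < t d \<Longrightarrow> col (B d) i \<in> lw d"
    "\<And>d v. d \<in> P \<Longrightarrow> v \<in> lw d \<Longrightarrow> \<exists>c\<in>carrier_vec (t d). B d *\<^sub>v c = v"
    "\<And>d. d \<in> P \<Longrightarrow> odd d \<Longrightarrow> t d = p' d + q' d"
    by simp_all
  interpret adapted_bases p q X H Y P t B S S'
  proof unfold_locales
    show "lw d \<subseteq> {0\<^sub>v ?n}" if "d > 0" "d \<notin> P" for d
      using that m[of d] by (intro right_dim_eq_0 lw_right_subspace) (simp add: P_def)
    show "S d \<in> carrier_mat (t d) (t d)" "S' d \<in> carrier_mat (t d) (t d)" "S' d * S d = 1\<^sub>m (t d)"
      if "d \<in> P" for d
      using basis(5)[OF that] by (auto simp: S_def S'_def quat_j_smult_inverse I_pq_square)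
  qed (use fin P_pos basis in auto)
  show ?thesis
  proof (rule centralizer_iso)
    show "P = even_parts \<d> \<union> odd_parts \<d>" "even_parts \<d> \<inter> odd_parts \<d> = {}"
      by (auto simp: parts)
    show "SO_star (t d) = mat_group (t d) (isometries (t d) (S d))" if "d \<in> even_parts \<d>" for d
      using that by (simp add: SO_star_eq S_def parts)
    show "p' d + q' d = t d" if "d \<in> odd_parts \<d>" for d
      using that basis(5) by (simp add: parts)
    then show "Sp (p' d) (q' d) = mat_group (t d) (isometries (t d) (S d))" if "d \<in> odd_parts \<d>" for d
      using that by (simp add: Sp_eq S_def parts)
  qed simp
qed

end
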